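(* Let $A : I \times J \to \{0,1\}$ and $B : J \times K \to \{0,1\}$ be two relations. Then there is a zigzag of weak equivalences $$\mathrm{B}\mathbf{R}(A,B) \simeq \mathrm{B}\mathbf{C}(A,B),$$ natural with respect to morphisms of relations.
   Context: A relation is a map $A : I \times J \to \{0,1\}$ with $I,J$ sets. Its row complex $R(A)$ is the simplicial complex whose simplices are the (nonempty, finite) $\sigma \subseteq I$ such that there is some $j \in J$ with $A(i,j)=1$ for all $i \in \sigma$. Its column complex $C(A)$ is the simplicial complex whose simplices are the (nonempty, finite) $\tau \subseteq J$ such that there is some $i \in I$ with $A(i,j)=1$ for all $j \in \tau$. $|\cdot|$ denotes geometric realization. For $\sigma \subseteq I$ put $J_\sigma = \{j \in J \mid A(i,j)=1 \text{ for all } i\in\sigma\}$, and for $\rho \subseteq K$ put $J_\rho = \{j \in J \mid B(j,k)=1 \text{ for all } k\in\rho\}$. $\mathbf{R}(A,B)$ is the topological category with space of objects $\bigsqcup_{\sigma \in R(A)} |R(B|_{J_\sigma \times K})|$ and space of morphisms $\bigsqcup_{\sigma_1 \subseteq \sigma_0} |R(B|_{J_{\sigma_0}\times K})|$, indexed by pairs $\sigma_1\subseteq\sigma_0$ of simplices of $R(A)$. A morphism $x \in |R(B|_{J_{\sigma_0}\times K})|$ in the component $\sigma_1 \subseteq \sigma_0$ has source $x$ in the component $\sigma_0$ and target the image of $x$ under the inclusion $|R(B|_{J_{\sigma_0}\times K})| \hookrightarrow |R(B|_{J_{\sigma_1}\times K})|$ in the component $\sigma_1$. $\mathbf{C}(A,B)$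 is defined similarly by augmenting simplices of the column complex of $B$ with parts of the column complex of $A$: its space of objects is $\bigsqcup_{\rho \in C(B)} |C(A|_{I \times J_\rho})|$ and its space of morphisms is $\bigsqcup_{\rho_1 \subseteq \rho_0} |C(A|_{I\times J_{\rho_0}})|$ (pairs of simplices of $C(B)$), with source given by the identity into the component $\rho_0$ and target by the inclusion into the component $\rho_1$. For a topological category $\mathbf{T}$, $\mathrm{B}\mathbf{T}$ is its classifying space, the geometric realization of its nerve (a simplicial space). A morphism of relations $a : A \to A'$, with $A : I\times J\to\{0,1\}$ and $A' : I'\times J'\to\{0,1\}$, is a pair of maps $a_0 : I \to I'$, $a_1 : J \to J'$ such that $A(i,j)=1$ implies $A'(a_0(i),a_1(j))=1$. Naturality means: for relations $A' : I'\times J'\to\{0,1\}$, $B' : J'\times K'\to\{0,1\}$ and morphisms of relations $a : A\to A'$, $b : B\to B'$, the square formed by the maps $\mathrm{B}\mathbf{R}(A,B)\to\mathrm{B}\mathbf{R}(A',B')$ and $\mathrm{B}\mathbf{C}(A,B)\to\mathrm{B}\mathbf{C}(A',B')$ induced in the obvious way by $a$ and $b$, together with the zigzags for $(A,B)$ and $(A',B')$, commutes. *)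

theory Defs
  imports "HOL-Homology.Simplices"
begin

section \<open>Relations and their complexes\<close>

record ('i, 'j) bin_rel =
  row_set :: "'i set"
  col_set :: "'j set"
  holds :: "'i \<Rightarrow> 'j \<Rightarrow> bool"

text \<open>
  The index sets of a relation are subsets of the types \<^typ>\<open>'i\<close> and \<^typ>\<open>'j\<close>, which play the role
  of universes: any two index sets embed into a common type.  Only the values of \<^term>\<open>holds A\<close> on
  \<^term>\<open>row_set A \<times> col_set A\<close> are ever used.
\<close>

definition row_complex :: "('i, 'j) bin_rel \<Rightarrow> 'i set set" where
  "row_complex A = {\<sigma>. \<sigma> \<noteq> {} \<and> finite \<sigma> \<and> \<sigma> \<subseteq> row_set A \<and> (\<exists>j\<in>col_set A. \<forall>i\<in>\<sigma>. holds A i j)}"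

definition col_complex :: "('i, 'j) bin_rel \<Rightarrow> 'j set set" where
  "col_complex A = {\<tau>. \<tau> \<noteq> {} \<and> finite \<tau> \<and> \<tau> \<subseteq> col_set A \<and> (\<exists>i\<in>row_set A. \<forall>j\<in>\<tau>. holds A i j)}"

definition common_cols :: "('i, 'j) bin_rel \<Rightarrow> 'i set \<Rightarrow> 'j set" where
  "common_cols A \<sigma> = {j \<in> col_set A. \<forall>i\<in>\<sigma>. holds A i j}"

definition common_rows :: "('i, 'j) bin_rel \<Rightarrow> 'j set \<Rightarrow> 'i set" where
  "common_rows A \<rho> = {i \<in> row_set A. \<forall>j\<in>\<rho>. holds A i j}"

text \<open>A morphism of relations is a pair of maps between the index sets; maps between sets are
  represented by extensional functions.\<close>

definition rel_morphism ::
  "('i, 'j) bin_rel \<Rightarrow> ('i, 'j) bin_rel \<Rightarrow> ('i \<Rightarrow> 'i) \<times> ('j \<Rightarrow> 'j) \<Rightarrow> bool" where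
  "rel_morphism A A' a \<longleftrightarrow>
     fst a \<in> row_set A \<rightarrow>\<^sub>E row_set A' \<and> snd a \<in> col_set A \<rightarrow>\<^sub>E col_set A' \<and>
     (\<forall>i\<in>row_set A. \<forall>j\<in>col_set A. holds A i j \<longrightarrow> holds A' (fst a i) (snd a j))"

definition rel_id :: "('i, 'j) bin_rel \<Rightarrow> ('i \<Rightarrow> 'i) \<times> ('j \<Rightarrow> 'j)" where
  "rel_id A = ((\<lambda>i\<in>row_set A. i), (\<lambda>j\<in>col_set A. j))"

definition rel_comp ::
  "('i, 'j) bin_rel \<Rightarrow> ('i \<Rightarrow> 'i) \<times> ('j \<Rightarrow> 'j) \<Rightarrow> ('i \<Rightarrow> 'i) \<times> ('j \<Rightarrow> 'j) \<Rightarrow> ('i \<Rightarrow> 'i) \<times> ('j \<Rightarrow> 'j)" where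
  "rel_comp A a' a = (compose (row_set A) (fst a') (fst a), compose (col_set A) (snd a') (snd a))"

section \<open>Geometric realization of simplicial complexes\<close>

text \<open>A complex is given by its set of simplices, and a point of its realization by its barycentric
  coordinates, extended by zero to all of the vertex type.  Hence inclusions of subcomplexes
  realize to inclusions of sets.  The topology is the weak topology determined by the closed
  simplices.\<close>

definition closed_simplex :: "'v set \<Rightarrow> ('v \<Rightarrow> real) set" where
  "closed_simplex \<sigma> = {x. (\<forall>v. 0 \<le> x v) \<and> (\<forall>v. v \<notin> \<sigma> \<longrightarrow> x v = 0) \<and> (\<Sum>v\<in>\<sigma>. x v) = 1}"

definition complex_realization :: "'v set set \<Rightarrow> ('v \<Rightarrow> real) topology" where
  "complex_realization K = topology (\<lambda>U. U \<subseteq> (\<Union>\<sigma>\<in>K. closed_simplex \<sigma>) \<and>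
     (\<forall>\<sigma>\<in>K. openin (subtopology (powertop_real UNIV) (closed_simplex \<sigma>)) (U \<inter> closed_simplex \<sigma>)))"

lemma openin_complex_realization:
  "openin (complex_realization K) U \<longleftrightarrow> U \<subseteq> (\<Union>\<sigma>\<in>K. closed_simplex \<sigma>) \<and>
     (\<forall>\<sigma>\<in>K. openin (subtopology (powertop_real UNIV) (closed_simplex \<sigma>)) (U \<inter> closed_simplex \<sigma>))"
proof -
  let ?P = "\<lambda>U. U \<subseteq> (\<Union>\<sigma>\<in>K. closed_simplex \<sigma>) \<and>
     (\<forall>\<sigma>\<in>K. openin (subtopology (powertop_real UNIV) (closed_simplex \<sigma>)) (U \<inter> closed_simplex \<sigma>))"
  have 1: "S \<inter> T \<inter> C = (S \<inter> C) \<inter> (T \<inter> C)" for S T C :: "('a \<Rightarrow> real) set" by blast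
  have 2: "\<Union>\<K> \<inter> C = (\<Union>U\<in>\<K>. U \<inter> C)" for \<K> and C :: "('a \<Rightarrow> real) set" by blast
  have "?P (S \<inter> T)" if "?P S" "?P T" for S T
    using that by (simp only: 1[of S T]) blast
  moreover have "?P (\<Union>\<K>)" if "\<forall>S\<in>\<K>. ?P S" for \<K>
    using that unfolding 2 by blast
  ultimately have "istopology ?P"
    unfolding istopology_def by blast
  then show ?thesis
    by (simp add: complex_realization_def)
qed

lemma topspace_complex_realization [simp]:
  "topspace (complex_realization K) = (\<Union>\<sigma>\<in>K. closed_simplex \<sigma>)"
proof -
  have "openin (complex_realization K) (\<Union>\<sigma>\<in>K. closed_simplex \<sigma>)"
    unfolding openin_complex_realization
  proof (intro conjI ballI)
    fix \<sigma> assume "\<sigma> \<in> K"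
    then have "(\<Union>\<sigma>\<in>K. closed_simplex \<sigma>) \<inter> closed_simplex \<sigma> = topspace (subtopology (powertop_real UNIV) (closed_simplex \<sigma>))" by auto
    then show "openin (subtopology (powertop_real UNIV) (closed_simplex \<sigma>))
        ((\<Union>\<sigma>\<in>K. closed_simplex \<sigma>) \<inter> closed_simplex \<sigma>)"
      by (metis openin_topspace)
  qed simp
  then show ?thesis
    by (metis openin_complex_realization openin_subset openin_topspace subset_antisym)
qed

lemma continuous_map_complex:
  assumes "\<And>\<sigma>. \<sigma> \<in> K \<Longrightarrow> continuous_map (subtopology (powertop_real UNIV) (closed_simplex \<sigma>)) Y f"
  shows "continuous_map (complex_realization K) Y f"
  unfolding continuous_map_def
proof (intro conjI allI impI)
  show "f \<in> topspace (complex_realization K) \<rightarrow> topspace Y"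
    using assms by (force simp: continuous_map_def)
  fix U assume U: "openin Y U"
  show "openin (complex_realization K) {x \<in> topspace (complex_realization K). f x \<in> U}"
    unfolding openin_complex_realization
  proof (intro conjI ballI)
    fix \<sigma> assume s: "\<sigma> \<in> K"
    have "{x \<in> topspace (complex_realization K). f x \<in> U} \<inter> closed_simplex \<sigma> = 
       {x \<in> topspace (subtopology (powertop_real UNIV) (closed_simplex \<sigma>)). f x \<in> U}" using s by auto
    then show "openin (subtopology (powertop_real UNIV) (closed_simplex \<sigma>)) ({x \<in> topspace (complex_realization K). f x \<in> U} \<inter> closed_simplex \<sigma>)"
      using assms[OF s] U by (simp add: continuous_map_def)
  qed auto
qed

lemma continuous_map_closed_simplex:
  assumes "\<sigma> \<in> K"
  shows "continuous_map (subtopology (powertop_real UNIV) (closed_simplex \<sigma>)) (complex_realization K) id"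
  unfolding continuous_map_def
proof (intro conjI allI impI)
  fix U assume U: "openin (complex_realization K) U"
  have "{x \<in> topspace (subtopology (powertop_real UNIV) (closed_simplex \<sigma>)). id x \<in> U} = U \<inter> closed_simplex \<sigma>" by auto
  then show "openin (subtopology (powertop_real UNIV) (closed_simplex \<sigma>)) {x \<in> topspace (subtopology (powertop_real UNIV) (closed_simplex \<sigma>)). id x \<in> U}"
    using U assms by (simp add: openin_complex_realization)
qed (use assms in auto)

definition pushforward :: "('v \<Rightarrow> 'w) \<Rightarrow> ('v \<Rightarrow> real) \<Rightarrow> 'w \<Rightarrow> real" where
  "pushforward f x = (\<lambda>w. \<Sum>v | x v \<noteq> 0 \<and> f v = w. x v)"

section \<open>Simplicial spaces and topological categories\<close>

text \<open>\<^term>\<open>operator X m n \<theta>\<close> is the map from level n to level m given by a monotone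
  map from \<open>{..m}\<close> to \<open>{..n}\<close>.\<close>

record 'a simplicial_space =
  level :: "nat \<Rightarrow> 'a topology"
  operator :: "nat \<Rightarrow> nat \<Rightarrow> (nat \<Rightarrow> nat) \<Rightarrow> 'a \<Rightarrow> 'a"

definition quotient_topology :: "'a topology \<Rightarrow> ('a \<Rightarrow> 'b) \<Rightarrow> 'b topology" where
  "quotient_topology X q = topology (\<lambda>U. U \<subseteq> q ` topspace X \<and> openin X {x \<in> topspace X. q x \<in> U})"

lemma openin_quotient_topology:
  "openin (quotient_topology X q) U \<longleftrightarrow>
     U \<subseteq> q ` topspace X \<and> openin X {x \<in> topspace X. q x \<in> U}"
proof -
  have 1: "{x \<in> topspace X. q x \<in> S \<inter> T} = {x \<in> topspace X. q x \<in> S} \<inter> {x \<in> topspace X. q x \<in> T}"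
    for S T by blast
  have 2: "{x \<in> topspace X. q x \<in> \<Union>\<K>} = (\<Union>U\<in>\<K>. {x \<in> topspace X. q x \<in> U})" for \<K> by blast
  have "istopology (\<lambda>U. U \<subseteq> q ` topspace X \<and> openin X {x \<in> topspace X. q x \<in> U})"
    unfolding istopology_def 1 2 by blast
  then show ?thesis
    by (simp add: quotient_topology_def)
qed

lemma quotient_map_quotient_topology: "quotient_map X (quotient_topology X q) q"
proof -
  have "{x \<in> topspace X. q x \<in> q ` topspace X} = topspace X" by blast
  then have "openin (quotient_topology X q) (q ` topspace X)"
    by (simp add: openin_quotient_topology)
  then have "topspace (quotient_topology X q) = q ` topspace X"
    by (metis openin_quotient_topology openin_subset openin_topspace subset_antisym)
  then show ?thesis
    unfolding quotient_map_def openin_quotient_topology by simp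
qed

definition realization_sum :: "'a simplicial_space \<Rightarrow> (nat \<times> 'a \<times> (nat \<Rightarrow> real)) topology" where
  "realization_sum X =
     sum_topology (\<lambda>n. prod_topology (level X n)
                         (subtopology (powertop_real UNIV) (standard_simplex n))) UNIV"

inductive glue ::
  "'a simplicial_space \<Rightarrow> nat \<times> 'a \<times> (nat \<Rightarrow> real) \<Rightarrow> nat \<times> 'a \<times> (nat \<Rightarrow> real) \<Rightarrow> bool"
  for X :: "'a simplicial_space" where
  "\<lbrakk>mono_on {..m} \<theta>; \<theta> \<in> {..m} \<rightarrow> {..n}; x \<in> topspace (level X n); t \<in> standard_simplex m\<rbrakk>
    \<Longrightarrow> glue X (m, operator X m n \<theta> x, t) (n, x, pushforward \<theta> t)"

definition glue_class ::
  "'a simplicial_space \<Rightarrow> nat \<times> 'a \<times> (nat \<Rightarrow> real) \<Rightarrow> (nat \<times> 'a \<times> (nat \<Rightarrow> real)) set" where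
  "glue_class X p = {p'. equivclp (glue X) p p'}"

definition realization :: "'a simplicial_space \<Rightarrow> (nat \<times> 'a \<times> (nat \<Rightarrow> real)) set topology" where
  "realization X = quotient_topology (realization_sum X) (glue_class X)"

text \<open>The map of realizations induced by a simplicial map \<open>\<phi>\<close>; the union is over a single class.\<close>

definition realization_map ::
  "'b simplicial_space \<Rightarrow> (nat \<Rightarrow> 'a \<Rightarrow> 'b) \<Rightarrow>
     (nat \<times> 'a \<times> (nat \<Rightarrow> real)) set \<Rightarrow> (nat \<times> 'b \<times> (nat \<Rightarrow> real)) set" where
  "realization_map Y \<phi> c = (\<Union>(n, x, t)\<in>c. glue_class Y (n, \<phi> n x, t))"

record ('o, 'm) top_category =
  Ob :: "'o topology"
  Mor :: "'m topology"
  src :: "'m \<Rightarrow> 'o"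
  tgt :: "'m \<Rightarrow> 'o"
  idm :: "'o \<Rightarrow> 'm"
  cmp :: "'m \<Rightarrow> 'm \<Rightarrow> 'm"  \<comment> \<open>\<open>cmp g f\<close> is \<open>f\<close> followed by \<open>g\<close>\<close>

definition topological_category :: "('o, 'm) top_category \<Rightarrow> bool" where
  "topological_category T \<longleftrightarrow>
     continuous_map (Mor T) (Ob T) (src T) \<and> continuous_map (Mor T) (Ob T) (tgt T) \<and>
     continuous_map (Ob T) (Mor T) (idm T) \<and>
     continuous_map (subtopology (prod_topology (Mor T) (Mor T)) {(g, f). tgt T f = src T g})
       (Mor T) (\<lambda>(g, f). cmp T g f) \<and>
     (\<forall>x\<in>topspace (Ob T). src T (idm T x) = x \<and> tgt T (idm T x) = x) \<and>
     (\<forall>f\<in>topspace (Mor T). cmp T f (idm T (src T f)) = f \<and> cmp T (idm T (tgt T f)) f = f) \<and>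
     (\<forall>f\<in>topspace (Mor T). \<forall>g\<in>topspace (Mor T). tgt T f = src T g \<longrightarrow>
        src T (cmp T g f) = src T f \<and> tgt T (cmp T g f) = tgt T g) \<and>
     (\<forall>f\<in>topspace (Mor T). \<forall>g\<in>topspace (Mor T). \<forall>h\<in>topspace (Mor T).
        tgt T f = src T g \<longrightarrow> tgt T g = src T h \<longrightarrow> cmp T h (cmp T g f) = cmp T (cmp T h g) f)"

text \<open>Level n of the nerve is the space of functors from the poset \<open>{..n}\<close>, given by their values
  on objects i and on arrows (i, j) with \<open>i \<le> j\<close>.\<close>

abbreviation poset_arrows :: "nat \<Rightarrow> (nat \<times> nat) set" where
  "poset_arrows n \<equiv> {(i, j). i \<le> j \<and> j \<le> n}"

type_synonym ('o, 'm) nerve_simplex = "(nat \<Rightarrow> 'o) \<times> (nat \<times> nat \<Rightarrow> 'm)"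

definition nerve :: "('o, 'm) top_category \<Rightarrow> ('o, 'm) nerve_simplex simplicial_space" where
  "nerve T = \<lparr>
     level = (\<lambda>n. subtopology
       (prod_topology (product_topology (\<lambda>_. Ob T) {..n}) (product_topology (\<lambda>_. Mor T) (poset_arrows n)))
       {(x, f).
          (\<forall>(i, j)\<in>poset_arrows n. src T (f (i, j)) = x i \<and> tgt T (f (i, j)) = x j) \<and>
          (\<forall>i\<le>n. f (i, i) = idm T (x i)) \<and>
          (\<forall>i j k. i \<le> j \<and> j \<le> k \<and> k \<le> n \<longrightarrow> f (i, k) = cmp T (f (j, k)) (f (i, j)))}),
     operator = (\<lambda>m n \<theta> (x, f).
       ((\<lambda>i\<in>{..m}. x (\<theta> i)), (\<lambda>(i, j)\<in>poset_arrows m. f (\<theta> i, \<theta> j))))\<rparr>"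

definition nerve_map ::
  "('o \<Rightarrow> 'p) \<Rightarrow> ('m \<Rightarrow> 'q) \<Rightarrow> nat \<Rightarrow> ('o, 'm) nerve_simplex \<Rightarrow> ('p, 'q) nerve_simplex" where
  "nerve_map F G n = (\<lambda>(x, f). ((\<lambda>i\<in>{..n}. F (x i)), (\<lambda>e\<in>poset_arrows n. G (f e))))"

type_synonym ('o, 'm) classifying_point = "(nat \<times> ('o, 'm) nerve_simplex \<times> (nat \<Rightarrow> real)) set"

definition classifying_space :: "('o, 'm) top_category \<Rightarrow> ('o, 'm) classifying_point topology" where
  "classifying_space T = realization (nerve T)"

definition classifying_map :: "('p, 'q) top_category \<Rightarrow> ('o \<Rightarrow> 'p) \<Rightarrow> ('m \<Rightarrow> 'q) \<Rightarrow>
    ('o, 'm) classifying_point \<Rightarrow> ('p, 'q) classifying_point" where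
  "classifying_map T' F G = realization_map (nerve T') (nerve_map F G)"

section \<open>The topological categories of a pair of relations\<close>

text \<open>A morphism \<open>((\<sigma>\<^sub>0, \<sigma>\<^sub>1), x)\<close> goes from \<open>(\<sigma>\<^sub>0, x)\<close> to \<open>(\<sigma>\<^sub>1, x)\<close>.\<close>

definition row_category :: "('i, 'j) bin_rel \<Rightarrow> ('j, 'k) bin_rel \<Rightarrow>
    ('i set \<times> ('j \<Rightarrow> real), ('i set \<times> 'i set) \<times> ('j \<Rightarrow> real)) top_category" where
  "row_category A B = \<lparr>
     Ob = sum_topology
       (\<lambda>\<sigma>. complex_realization (row_complex (B\<lparr>row_set := common_cols A \<sigma>\<rparr>)))
       (row_complex A),
     Mor = sum_topology
       (\<lambda>(\<sigma>\<^sub>0, \<sigma>\<^sub>1). complex_realization (row_complex (B\<lparr>row_set := common_cols A \<sigma>\<^sub>0\<rparr>)))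
       {(\<sigma>\<^sub>0, \<sigma>\<^sub>1). \<sigma>\<^sub>0 \<in> row_complex A \<and> \<sigma>\<^sub>1 \<in> row_complex A \<and> \<sigma>\<^sub>1 \<subseteq> \<sigma>\<^sub>0},
     src = (\<lambda>((\<sigma>\<^sub>0, \<sigma>\<^sub>1), x). (\<sigma>\<^sub>0, x)),
     tgt = (\<lambda>((\<sigma>\<^sub>0, \<sigma>\<^sub>1), x). (\<sigma>\<^sub>1, x)),
     idm = (\<lambda>(\<sigma>, x). ((\<sigma>, \<sigma>), x)),
     cmp = (\<lambda>((\<tau>\<^sub>0, \<tau>\<^sub>1), y) ((\<sigma>\<^sub>0, \<sigma>\<^sub>1), x). ((\<sigma>\<^sub>0, \<tau>\<^sub>1), x))\<rparr>"

definition col_category :: "('i, 'j) bin_rel \<Rightarrow> ('j, 'k) bin_rel \<Rightarrow>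
    ('k set \<times> ('j \<Rightarrow> real), ('k set \<times> 'k set) \<times> ('j \<Rightarrow> real)) top_category" where
  "col_category A B = \<lparr>
     Ob = sum_topology
       (\<lambda>\<rho>. complex_realization (col_complex (A\<lparr>col_set := common_rows B \<rho>\<rparr>)))
       (col_complex B),
     Mor = sum_topology
       (\<lambda>(\<rho>\<^sub>0, \<rho>\<^sub>1). complex_realization (col_complex (A\<lparr>col_set := common_rows B \<rho>\<^sub>0\<rparr>)))
       {(\<rho>\<^sub>0, \<rho>\<^sub>1). \<rho>\<^sub>0 \<in> col_complex B \<and> \<rho>\<^sub>1 \<in> col_complex B \<and> \<rho>\<^sub>1 \<subseteq> \<rho>\<^sub>0},
     src = (\<lambda>((\<rho>\<^sub>0, \<rho>\<^sub>1), x). (\<rho>\<^sub>0, x)),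
     tgt = (\<lambda>((\<rho>\<^sub>0, \<rho>\<^sub>1), x). (\<rho>\<^sub>1, x)),
     idm = (\<lambda>(\<rho>, x). ((\<rho>, \<rho>), x)),
     cmp = (\<lambda>((\<tau>\<^sub>0, \<tau>\<^sub>1), y) ((\<rho>\<^sub>0, \<rho>\<^sub>1), x). ((\<rho>\<^sub>0, \<tau>\<^sub>1), x))\<rparr>"

lemma continuous_map_sum_topology:
  assumes "\<And>i. i \<in> I \<Longrightarrow> h i \<in> J" "\<And>i. i \<in> I \<Longrightarrow> continuous_map (X i) (Y (h i)) (g i)"
  shows "continuous_map (sum_topology X I) (sum_topology Y J) (\<lambda>(i,x). (h i, g i x))"
  unfolding continuous_map_def
proof (intro conjI allI impI)
  show "(\<lambda>(i,x). (h i, g i x)) \<in> topspace (sum_topology X I) \<rightarrow> topspace (sum_topology Y J)"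
    using assms by (force simp: continuous_map_def)
  fix U assume U: "openin (sum_topology Y J) U"
  have "openin (X i) {x. (i, x) \<in> {z \<in> topspace (sum_topology X I). (case z of (i, x) \<Rightarrow> (h i, g i x)) \<in> U}}" if "i \<in> I" for i
  proof -
    have "openin (Y (h i)) {y. (h i, y) \<in> U}" using U assms that by (auto simp: openin_sum_topology)
    then have "openin (X i) {x \<in> topspace (X i). g i x \<in> {y. (h i, y) \<in> U}}"
      using assms(2)[OF that] by (simp only: continuous_map_def)
    then show ?thesis using that by simp
  qed
  then show "openin (sum_topology X I) {z \<in> topspace (sum_topology X I). (case z of (i, x) \<Rightarrow> (h i, g i x)) \<in> U}"
    unfolding openin_sum_topology by auto
qed

lemma openin_sum_topology_singleton: "i \<in> I \<Longrightarrow> openin (X i) S \<Longrightarrow> openin (sum_topology X I) ({i} \<times> S)"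
proof -
  assume a: "i \<in> I" "openin (X i) S"
  have "{x. (j,x) \<in> {i} \<times> S} = (if j = i then S else {})" for j by auto
  then show ?thesis using a openin_subset[OF a(2)] unfolding openin_sum_topology by auto
qed
lemma topological_category_row_category: "topological_category (row_category A B)"
proof -
  let ?M = "Mor (row_category A B)"
  have c: "continuous_map (complex_realization (row_complex (B\<lparr>row_set := common_cols A \<sigma>\<rparr>)))
     (complex_realization (row_complex (B\<lparr>row_set := common_cols A \<tau>\<rparr>))) (\<lambda>x. x)" if "\<tau> \<subseteq> \<sigma>" for \<sigma> \<tau>
    apply (rule continuous_map_complex)
    apply (rule continuous_map_closed_simplex[unfolded id_def])
    using that by (auto simp: row_complex_def common_cols_def)
  have e: "(\<lambda>(s,x). ((\<lambda>(\<sigma>0,\<sigma>1). \<sigma>0) s, x)) = (\<lambda>((\<sigma>0,\<sigma>1),x). (\<sigma>0,x))"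
     "(\<lambda>(s,x). ((\<lambda>(\<sigma>0,\<sigma>1). \<sigma>1) s, x)) = (\<lambda>((\<sigma>0,\<sigma>1),x). (\<sigma>1,x))" by (auto simp: fun_eq_iff)
  have 1: "continuous_map ?M (Ob (row_category A B)) (\<lambda>(s,x). ((\<lambda>(\<sigma>0,\<sigma>1). \<sigma>0) s, x))"
    unfolding row_category_def top_category.simps by (rule continuous_map_sum_topology) (use c in auto)
  have 2: "continuous_map ?M (Ob (row_category A B)) (\<lambda>(s,x). ((\<lambda>(\<sigma>0,\<sigma>1). \<sigma>1) s, x))"
    unfolding row_category_def top_category.simps by (rule continuous_map_sum_topology) (use c in auto)
  have 3: "continuous_map (Ob (row_category A B)) ?M (\<lambda>(s,x). ((s,s), x))"
    unfolding row_category_def top_category.simps by (rule continuous_map_sum_topology) (use c in auto)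
  have 4: "continuous_map (subtopology (prod_topology ?M ?M) {(g, f). tgt (row_category A B) f = src (row_category A B) g})
       ?M (\<lambda>(g, f). cmp (row_category A B) g f)" (is "continuous_map ?P _ ?c")
    unfolding continuous_map_def
  proof (intro conjI allI impI)
    show ty: "?c \<in> topspace ?P \<rightarrow> topspace ?M"
      by (auto simp: row_category_def)
    fix U assume U: "openin ?M U"
    show "openin ?P {x \<in> topspace ?P. ?c x \<in> U}"
    proof (subst openin_subopen, safe)
      fix g f assume gf: "(g,f) \<in> topspace ?P" "cmp (row_category A B) g f \<in> U"
      obtain s0 s1 s2 x where d: "g = ((s1,s2),x)" "f = ((s0,s1),x)"
        using gf(1) by (cases g; cases f) (auto simp: row_category_def)
      have s: "s0 \<in> row_complex A" "s1 \<in> row_complex A" "s2 \<in> row_complex A" "s1 \<subseteq> s0" "s2 \<subseteq> s1" 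
        using gf(1) by (auto simp: d row_category_def)
      let ?R = "complex_realization (row_complex (B\<lparr>row_set := common_cols A s0\<rparr>))"
      have o: "openin ?R {y. ((s0,s2),y) \<in> U}"
        using U s by (auto simp: row_category_def openin_sum_topology)
      define V where "V = {(s0,s1)} \<times> {y. ((s0,s2),y) \<in> U}"
      have V: "openin ?M V" unfolding V_def row_category_def top_category.simps
        by (rule openin_sum_topology_singleton) (use s o in auto)
      define W where "W = {(s1,s2)} \<times> topspace (complex_realization (row_complex (B\<lparr>row_set := common_cols A s1\<rparr>)))"
      have W: "openin ?M W" unfolding W_def row_category_def top_category.simps
        by (rule openin_sum_topology_singleton) (use s in \<open>auto simp del: topspace_complex_realization\<close>)
      have "openin (prod_topology ?M ?M) (W \<times> V)" using V W by (simp add: openin_prod_Times_iff)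
      then have "openin ?P ((W \<times> V) \<inter> {(g, f). tgt (row_category A B) f = src (row_category A B) g})"
        by (rule openin_subtopology_Int)
      moreover have "(g,f) \<in> (W \<times> V) \<inter> {(g, f). tgt (row_category A B) f = src (row_category A B) g}"
        using gf by (auto simp: d V_def W_def row_category_def)
      moreover have "(W \<times> V) \<inter> {(g, f). tgt (row_category A B) f = src (row_category A B) g} \<subseteq> {x \<in> topspace ?P. ?c x \<in> U}"
        using openin_subset[OF V] openin_subset[OF W] s(4,5) by (auto simp: V_def W_def row_category_def)
      ultimately show "\<exists>T. openin ?P T \<and> (g,f) \<in> T \<and> T \<subseteq> {x \<in> topspace ?P. ?c x \<in> U}" by blast
    qed
  qed
  show ?thesis unfolding topological_category_def 
    using 1[unfolded e] 2[unfolded e] 3 4 by (auto simp: row_category_def)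
qed

definition rel_transpose :: "('i, 'j) bin_rel \<Rightarrow> ('j, 'i) bin_rel" where
  "rel_transpose A = \<lparr>row_set = col_set A, col_set = row_set A, holds = (\<lambda>j i. holds A i j)\<rparr>"

lemma rel_transpose_simps:
  "row_complex (rel_transpose A) = col_complex A"
  "common_cols (rel_transpose A) = common_rows A"
  "(rel_transpose A)\<lparr>row_set := S\<rparr> = rel_transpose (A\<lparr>col_set := S\<rparr>)"
  by (auto simp: rel_transpose_def row_complex_def col_complex_def common_cols_def common_rows_def
      fun_eq_iff)

lemma col_category_eq_row_category:
  "col_category A B = row_category (rel_transpose B) (rel_transpose A)"
  by (simp add: col_category_def row_category_def rel_transpose_simps)

lemma topological_category_col_category: "topological_category (col_category A B)"
  by (simp add: col_category_eq_row_category topological_category_row_category)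

section \<open>Weak homotopy equivalences\<close>

definition cube :: "nat \<Rightarrow> (nat \<Rightarrow> real) topology" where
  "cube n = product_topology (\<lambda>_. top_of_set {0..1}) {..<n}"

definition based_at :: "nat \<Rightarrow> 'a \<Rightarrow> ((nat \<Rightarrow> real) \<Rightarrow> 'a) \<Rightarrow> bool" where
  "based_at n x g \<longleftrightarrow> (\<forall>s\<in>topspace (cube n). (\<exists>i<n. s i = 0 \<or> s i = 1) \<longrightarrow> g s = x)"

definition sphere_class ::
  "nat \<Rightarrow> 'a topology \<Rightarrow> 'a \<Rightarrow> ((nat \<Rightarrow> real) \<Rightarrow> 'a) \<Rightarrow> ((nat \<Rightarrow> real) \<Rightarrow> 'a) set" where
  "sphere_class n X x g = {h. homotopic_with (based_at n x) (cube n) X g h}"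

definition homotopy_group :: "nat \<Rightarrow> 'a topology \<Rightarrow> 'a \<Rightarrow> ((nat \<Rightarrow> real) \<Rightarrow> 'a) set set" where
  "homotopy_group n X x = sphere_class n X x ` {g. continuous_map (cube n) X g \<and> based_at n x g}"

definition homotopy_group_map :: "nat \<Rightarrow> 'b topology \<Rightarrow> ('a \<Rightarrow> 'b) \<Rightarrow> 'a \<Rightarrow>
    ((nat \<Rightarrow> real) \<Rightarrow> 'a) set \<Rightarrow> ((nat \<Rightarrow> real) \<Rightarrow> 'b) set" where
  "homotopy_group_map n Y f x c = (\<Union>g\<in>c. sphere_class n Y (f x) (f \<circ> g))"

definition path_components_map :: "'b topology \<Rightarrow> ('a \<Rightarrow> 'b) \<Rightarrow> 'a set \<Rightarrow> 'b set" where
  "path_components_map Y f C = (\<Union>x\<in>C. path_component_of_set Y (f x))"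

text \<open>The map induced on homotopy groups is always a homomorphism, so that it is an isomorphism
  precisely when it is bijective.  Path components are treated separately to cover the empty
  space.\<close>

definition weak_equivalence :: "'a topology \<Rightarrow> 'b topology \<Rightarrow> ('a \<Rightarrow> 'b) \<Rightarrow> bool" where
  "weak_equivalence X Y f \<longleftrightarrow> continuous_map X Y f \<and>
     bij_betw (path_components_map Y f) (path_components_of X) (path_components_of Y) \<and>
     (\<forall>n\<ge>1. \<forall>x\<in>topspace X.
        bij_betw (homotopy_group_map n Y f x) (homotopy_group n X x) (homotopy_group n Y (f x)))"

section \<open>Functors on pairs of relations, and natural zigzags\<close>

type_synonym ('i, 'j, 'k) rel_pair = "('i, 'j) bin_rel \<times> ('j, 'k) bin_rel"
type_synonym ('i, 'j, 'k) pair_mor = "(('i \<Rightarrow> 'i) \<times> ('j \<Rightarrow> 'j)) \<times> (('j \<Rightarrow> 'j) \<times> ('k \<Rightarrow> 'k))"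

definition composable :: "('i, 'j, 'k) rel_pair \<Rightarrow> bool" where
  "composable = (\<lambda>(A, B). col_set A = row_set B)"

text \<open>The two morphisms must agree on the common index set J: otherwise they do not induce maps
  of the categories above.\<close>

definition pair_morphism ::
  "('i, 'j, 'k) rel_pair \<Rightarrow> ('i, 'j, 'k) rel_pair \<Rightarrow> ('i, 'j, 'k) pair_mor \<Rightarrow> bool" where
  "pair_morphism = (\<lambda>(A, B) (A', B') (a, b).
     rel_morphism A A' a \<and> rel_morphism B B' b \<and> snd a = fst b)"

definition pair_id :: "('i, 'j, 'k) rel_pair \<Rightarrow> ('i, 'j, 'k) pair_mor" where
  "pair_id = (\<lambda>(A, B). (rel_id A, rel_id B))"

definition pair_comp ::
  "('i, 'j, 'k) rel_pair \<Rightarrow> ('i, 'j, 'k) pair_mor \<Rightarrow> ('i, 'j, 'k) pair_mor \<Rightarrow> ('i, 'j, 'k) pair_mor" where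
  "pair_comp = (\<lambda>(A, B) (a', b') (a, b). (rel_comp A a' a, rel_comp B b' b))"

record ('i, 'j, 'k, 'z) space_functor =
  space_of :: "('i, 'j, 'k) rel_pair \<Rightarrow> 'z topology"
  map_of_mor ::
    "('i, 'j, 'k) rel_pair \<Rightarrow> ('i, 'j, 'k) rel_pair \<Rightarrow> ('i, 'j, 'k) pair_mor \<Rightarrow> 'z \<Rightarrow> 'z"

definition is_space_functor :: "('i, 'j, 'k, 'z) space_functor \<Rightarrow> bool" where
  "is_space_functor F \<longleftrightarrow>
     (\<forall>P P' m. composable P \<and> composable P' \<and> pair_morphism P P' m \<longrightarrow>
        continuous_map (space_of F P) (space_of F P') (map_of_mor F P P' m)) \<and>
     (\<forall>P. composable P \<longrightarrow>
        (\<forall>z\<in>topspace (space_of F P). map_of_mor F P P (pair_id P) z = z)) \<and>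
     (\<forall>P P' P'' m m'. composable P \<and> composable P' \<and> composable P'' \<and>
        pair_morphism P P' m \<and> pair_morphism P' P'' m' \<longrightarrow>
        (\<forall>z\<in>topspace (space_of F P).
           map_of_mor F P P'' (pair_comp P m' m) z = map_of_mor F P' P'' m' (map_of_mor F P P' m z)))"

definition natural_weak_equivalence :: "('i, 'j, 'k, 'y) space_functor \<Rightarrow>
    ('i, 'j, 'k, 'z) space_functor \<Rightarrow> (('i, 'j, 'k) rel_pair \<Rightarrow> 'y \<Rightarrow> 'z) \<Rightarrow> bool" where
  "natural_weak_equivalence F G \<phi> \<longleftrightarrow> is_space_functor F \<and> is_space_functor G \<and>
     (\<forall>P. composable P \<longrightarrow> weak_equivalence (space_of F P) (space_of G P) (\<phi> P)) \<and>
     (\<forall>P P' m. composable P \<and> composable P' \<and> pair_morphism P P' m \<longrightarrow>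
        (\<forall>y\<in>topspace (space_of F P).
           map_of_mor G P P' m (\<phi> P y) = \<phi> P' (map_of_mor F P P' m y)))"

definition zigzag_step ::
  "('i, 'j, 'k, 'y) space_functor \<Rightarrow> ('i, 'j, 'k, 'z) space_functor \<Rightarrow> bool" where
  "zigzag_step F G \<longleftrightarrow>
     (\<exists>\<phi>. natural_weak_equivalence F G \<phi>) \<or> (\<exists>\<psi>. natural_weak_equivalence G F \<psi>)"

definition BR ::
  "('i, 'j, 'k, ('i set \<times> ('j \<Rightarrow> real), ('i set \<times> 'i set) \<times> ('j \<Rightarrow> real)) classifying_point) space_functor"
  where
  "BR = \<lparr>
     space_of = (\<lambda>(A, B). classifying_space (row_category A B)),
     map_of_mor = (\<lambda>(A, B) (A', B') ((a\<^sub>0, a\<^sub>1), b).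
       classifying_map (row_category A' B')
         (\<lambda>(\<sigma>, x). (a\<^sub>0 ` \<sigma>, pushforward a\<^sub>1 x))
         (\<lambda>((\<sigma>\<^sub>0, \<sigma>\<^sub>1), x). ((a\<^sub>0 ` \<sigma>\<^sub>0, a\<^sub>0 ` \<sigma>\<^sub>1), pushforward a\<^sub>1 x)))\<rparr>"

definition BC ::
  "('i, 'j, 'k, ('k set \<times> ('j \<Rightarrow> real), ('k set \<times> 'k set) \<times> ('j \<Rightarrow> real)) classifying_point) space_functor"
  where
  "BC = \<lparr>
     space_of = (\<lambda>(A, B). classifying_space (col_category A B)),
     map_of_mor = (\<lambda>(A, B) (A', B') (a, (b\<^sub>0, b\<^sub>1)).
       classifying_map (col_category A' B')
         (\<lambda>(\<rho>, x). (b\<^sub>1 ` \<rho>, pushforward b\<^sub>0 x))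
         (\<lambda>((\<rho>\<^sub>0, \<rho>\<^sub>1), x). ((b\<^sub>1 ` \<rho>\<^sub>0, b\<^sub>1 ` \<rho>\<^sub>1), pushforward b\<^sub>0 x)))\<rparr>"

text \<open>The points of the intermediate spaces of a zigzag.  This type has to be chosen in
  advance; it injectively contains the set of all sets of sets of elements of I, J, K and real
  numbers, and has room for realizations of simplicial sets or spaces whose simplices are sequences
  of subsets of the disjoint union of I, J and K.\<close>

type_synonym ('i, 'j, 'k) zigzag_point =
  "(nat \<times> (nat \<Rightarrow> ('i + 'j + 'k + real) set) \<times> (nat \<Rightarrow> real)) set"

end

theory Submission
  imports Defs
begin

text \<open>
  Let Q be the simplicial complex of those finite sets of columns of A that have both a common row in A
  and a common column in B.  Forgetting the chain of simplices of R(A) gives a map from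
  BR(A, B) to the realization of Q, natural in A and B; its fibre over a point with support \<open>\<tau>\<close> is the
  subdivision of the full simplex on the rows related to all of \<open>\<tau>\<close>, hence contractible.
  Since Q is invariant under exchanging (A, B) with the transposed pair, BC(A, B) maps to it in the
  same way, so that it suffices to show that the map is a weak equivalence.

  A point of BR(A, B) is determined by its image x in Q and the weights \<open>z i\<close>, the total
  weight of the simplices of the chain that contain i; the chain is recovered from the
  superlevel sets of z.  In these coordinates maps of cubes given on the boundary are lifted along the
  projection: move inwards from the boundary, cut off the small coordinates of x, and meanwhile
  replace z by weights on the rows that are related to all columns where x has not been cut off.
\<close>

section \<open>Lifting maps of cubes\<close>

text \<open>Two obstacles shape the lifting. The rows available over x are those related to all of
  supp x, and supp x can grow under arbitrarily small changes of x, so that rows admissible at a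
  point may be inadmissible nearby. Hence the lift is required to cover the given map only up to a
  homotopy fixing the boundary, which is all that homotopy groups see. Cutting off creates the
  slack: a row may receive weight as soon as the columns unrelated to it have total coordinate below
  the current level. This is an open condition, and while the level is positive at least one row
  meets it. The other obstacle is topological: BR(A, B) is a quotient of a sum, Q carries the weak
  topology, and maps into them cannot in general be tested on coordinates. A cube, however, is
  compact, and weighted sums of coordinates are continuous on these spaces for weights growing as
  fast as desired, so only finitely many rows and columns occur. Over finitely many indices a map is
  pasted from finitely many closed pieces, on each of which the chain and a closed simplex
  containing x are fixed.\<close>

definition cube_boundary :: "nat \<Rightarrow> (nat \<Rightarrow> real) set" where
  "cube_boundary n = {s \<in> topspace (cube n). \<exists>i<n. s i = 0 \<or> s i = 1}"

lemma topspace_cube: "topspace (cube n) = {..<n} \<rightarrow>\<^sub>E {0..1}"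
  by (simp add: cube_def)

lemma continuous_map_cube_coord:
  assumes "i < n"
  shows "continuous_map (cube n) euclideanreal (\<lambda>p. p i)"
  unfolding cube_def
  using continuous_map_product_projection[of i "{..<n}" "\<lambda>_. top_of_set {0..1::real}"] assms
  by (simp add: continuous_map_in_subtopology)

lemma continuous_map_into_cube:
  assumes "\<And>i. i < n \<Longrightarrow> continuous_map X euclideanreal (\<lambda>p. f p i)"
    and "\<And>p. p \<in> topspace X \<Longrightarrow> f p \<in> {..<n} \<rightarrow>\<^sub>E {0..1}"
  shows "continuous_map X (cube n) f"
  unfolding cube_def continuous_map_componentwise
  using assms by (fastforce simp: continuous_map_in_subtopology PiE_iff)

lemma based_at_iff: "based_at n x g \<longleftrightarrow> (\<forall>p\<in>cube_boundary n. g p = x)"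
  by (auto simp: based_at_def cube_boundary_def)

text \<open>This is the relative lifting criterion for weak equivalences, with cubes in place of
  disks. Dimension 0 has empty boundary and yields surjectivity on path components; dimension
  \<open>n\<close> yields surjectivity on the \<open>n\<close>-th homotopy group, and dimension
  \<open>n + 1\<close> injectivity there.\<close>

definition lifting_property :: "'a topology \<Rightarrow> 'b topology \<Rightarrow> ('a \<Rightarrow> 'b) \<Rightarrow> bool" where
  "lifting_property X Y f \<longleftrightarrow> continuous_map X Y f \<and>
     (\<forall>n u v. continuous_map (subtopology (cube n) (cube_boundary n)) X u \<longrightarrow>
        continuous_map (cube n) Y v \<longrightarrow> (\<forall>p\<in>cube_boundary n. f (u p) = v p) \<longrightarrow>
        (\<exists>w. continuous_map (cube n) X w \<and> (\<forall>p\<in>cube_boundary n. w p = u p) \<and>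
           homotopic_with (\<lambda>h. \<forall>p\<in>cube_boundary n. h p = v p) (cube n) Y (f \<circ> w) v))"

lemma lifting_propertyE:
  assumes "lifting_property X Y f"
    and "continuous_map (subtopology (cube n) (cube_boundary n)) X u" "continuous_map (cube n) Y v"
    and "\<forall>p\<in>cube_boundary n. f (u p) = v p"
  obtains w where "continuous_map (cube n) X w" "\<forall>p\<in>cube_boundary n. w p = u p"
    "homotopic_with (\<lambda>h. \<forall>p\<in>cube_boundary n. h p = v p) (cube n) Y (f \<circ> w) v"
  using assms unfolding lifting_property_def by blast

section \<open>Maps induced on homotopy groups and path components\<close>

lemma homotopic_based_compose:
  assumes "continuous_map X Y f" "homotopic_with (based_at n x) (cube n) X g h"
  shows "homotopic_with (based_at n (f x)) (cube n) Y (f \<circ> g) (f \<circ> h)"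
  by (rule homotopic_with_compose_continuous_map_left[OF assms(2,1)]) (auto simp: based_at_def)

lemma sphere_class_eq:
  assumes "homotopic_with (based_at n x) (cube n) X g h"
  shows "sphere_class n X x g = sphere_class n X x h"
  unfolding sphere_class_def using assms homotopic_with_trans homotopic_with_symD by blast

text \<open>The conditions on \<open>h\<close> provide its constant homotopy, so that
  \<open>h\<close> lies in its own class; without them both classes could be empty, hence
  equal.\<close>

lemma sphere_class_eq_iff:
  assumes "continuous_map (cube n) X h" "based_at n x h"
  shows "sphere_class n X x g = sphere_class n X x h \<longleftrightarrow> homotopic_with (based_at n x) (cube n) X g h"
proof
  assume "sphere_class n X x g = sphere_class n X x h"
  moreover have "h \<in> sphere_class n X x h"
    using assms by (simp add: sphere_class_def)
  ultimately have "h \<in> sphere_class n X x g"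
    by (simp only:)
  then show "homotopic_with (based_at n x) (cube n) X g h"
    by (simp only: sphere_class_def mem_Collect_eq)
qed (rule sphere_class_eq)

text \<open>The union defining the induced map runs over homotopic representatives, which all give
  the same class, and it is not empty because \<open>g\<close> is one of them.\<close>

lemma homotopy_group_map_sphere_class:
  assumes f: "continuous_map X Y f" and g: "continuous_map (cube n) X g" "based_at n x g"
  shows "homotopy_group_map n Y f x (sphere_class n X x g) = sphere_class n Y (f x) (f \<circ> g)"
proof -
  have "sphere_class n Y (f x) (f \<circ> h) = sphere_class n Y (f x) (f \<circ> g)"
    if "h \<in> sphere_class n X x g" for h
    using sphere_class_eq[OF homotopic_based_compose[OF f]] that by (auto simp: sphere_class_def)
  moreover have "g \<in> sphere_class n X x g"
    using g by (simp add: sphere_class_def)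
  ultimately show ?thesis
    unfolding homotopy_group_map_def by blast
qed

lemma path_components_map_eq:
  assumes f: "continuous_map X Y f" and x: "x \<in> topspace X"
  shows "path_components_map Y f (path_component_of_set X x) = path_component_of_set Y (f x)"
proof -
  have "path_component_of_set Y (f y) = path_component_of_set Y (f x)" if "path_component_of X x y" for y
  proof -
    have "path_component_of Y (f x) (f y)"
      by (metis f that path_component_of_continuous_image)
    then show ?thesis
      by (metis path_component_of_equiv)
  qed
  moreover have "path_component_of X x x"
    using x by (simp add: path_component_of_refl)
  ultimately show ?thesis
    unfolding path_components_map_def by blast
qed

section \<open>Cubes of one dimension higher as homotopies\<close>

lemma cube_boundary_Suc:
  "cube_boundary (Suc n) = {p \<in> topspace (cube (Suc n)). p n = 0} \<union> {p \<in> topspace (cube (Suc n)). p n = 1}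
     \<union> {p \<in> topspace (cube (Suc n)). \<exists>i<n. p i = 0 \<or> p i = 1}"
  by (auto simp: cube_boundary_def less_Suc_eq)

lemma restrict_in_cube: "p \<in> topspace (cube (Suc n)) \<Longrightarrow> restrict p {..<n} \<in> topspace (cube n)"
  by (force simp: topspace_cube PiE_iff)

lemma continuous_map_restrict_cube: "continuous_map (cube (Suc n)) (cube n) (\<lambda>p. restrict p {..<n})"
proof (rule continuous_map_into_cube)
  fix i assume "i < n"
  then show "continuous_map (cube (Suc n)) euclideanreal (\<lambda>p. restrict p {..<n} i)"
    by (simp add: continuous_map_cube_coord)
qed (metis restrict_in_cube topspace_cube)

text \<open>The last coordinate, of index \<open>n\<close>, serves as time. The congruence condition
  on \<open>P\<close> is there because the end slices of \<open>w\<close> agree with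
  \<open>g\<close> and \<open>h\<close> only on points of the cube.\<close>

lemma cube_homotopy_of_map:
  assumes w: "continuous_map (cube (Suc n)) X w"
    and 0: "\<And>p. p \<in> topspace (cube n) \<Longrightarrow> w (p(n := 0)) = g p"
    and 1: "\<And>p. p \<in> topspace (cube n) \<Longrightarrow> w (p(n := 1)) = h p"
    and P: "\<And>t. t \<in> {0..1} \<Longrightarrow> P (\<lambda>p. w (p(n := t)))"
    and P': "\<And>h k. (\<And>x. x \<in> topspace (cube n) \<Longrightarrow> h x = k x) \<Longrightarrow> P h = P k"
  shows "homotopic_with P (cube n) X g h"
proof -
  have up: "p(n := t) \<in> topspace (cube (Suc n))" if "p \<in> topspace (cube n)" "t \<in> {0..1}" for p t
    using that by (force simp: topspace_cube PiE_iff extensional_def less_Suc_eq)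
  have "continuous_map (prod_topology (top_of_set {0..1}) (cube n)) (cube (Suc n)) (\<lambda>(t,p). p(n := t))"
  proof (rule continuous_map_into_cube)
    fix i assume i: "i < Suc n"
    show "continuous_map (prod_topology (top_of_set {0..1}) (cube n)) euclideanreal (\<lambda>q. (case q of (t,p) \<Rightarrow> p(n := t)) i)"
    proof (cases "i = n")
      case True
      then show ?thesis
        using continuous_map_into_fulltopology[OF continuous_map_fst[of "top_of_set {0..1::real}" "cube n"]]
        by (simp add: case_prod_unfold)
    next
      case False
      then have "continuous_map (prod_topology (top_of_set {0..1::real}) (cube n)) euclideanreal ((\<lambda>p. p i) \<circ> snd)"
        using i by (intro continuous_map_compose[OF continuous_map_snd] continuous_map_cube_coord) auto
      then show ?thesis using False by (simp add: case_prod_unfold o_def)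
    qed
  qed (use up in \<open>auto simp flip: topspace_cube\<close>)
  from continuous_map_compose[OF this w]
  have c: "continuous_map (prod_topology (top_of_set {0..1}) (cube n)) X (\<lambda>(t,p). w (p(n := t)))"
    by (simp add: o_def case_prod_unfold)
  show ?thesis
    apply (subst homotopic_with[OF P'], assumption)
    apply (rule exI[of _ "\<lambda>(t,p). w (p(n := t))"])
    using c 0 1 P by auto
qed

lemma closed_in_cube_coord:
  assumes "i < n" "closed C"
  shows "closedin (cube n) {p \<in> topspace (cube n). p i \<in> C}"
  using closedin_continuous_map_preimage[OF continuous_map_cube_coord[OF assms(1)], of C] assms(2) by simp

lemma closed_in_cube_bd: "closedin (cube n) {p \<in> topspace (cube n). \<exists>i<m. p i = 0 \<or> p i = 1}" if "m \<le> n"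
proof -
  have "{p \<in> topspace (cube n). \<exists>i<m. p i = 0 \<or> p i = 1} = (\<Union>i<m. {p \<in> topspace (cube n). p i \<in> {0,1}})"
    by auto
  also have "closedin (cube n) \<dots>"
    using that closed_in_cube_coord[of _ n "{0,1}"] by (intro closedin_Union) auto
  finally show ?thesis .
qed

lemma closedin_cube_boundary: "closedin (cube n) (cube_boundary n)"
  unfolding cube_boundary_def by (rule closed_in_cube_bd) simp

text \<open>The boundary is the union of bottom, top and sides, all closed. Where they meet,
  \<open>g\<close> and \<open>h\<close> agree with the constant \<open>x\<close> because they are
  based there.\<close>

lemma cube_boundary_glue:
  assumes g: "continuous_map (cube n) X g" "based_at n x g"
    and h: "continuous_map (cube n) X h" "based_at n x h" and x: "x \<in> topspace X"
  defines "u \<equiv> \<lambda>p. if p n = (0::real) then g (restrict p {..<n}) else if p n = 1 then h (restrict p {..<n}) else x"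
  shows "continuous_map (subtopology (cube (Suc n)) (cube_boundary (Suc n))) X u"
proof -
  let ?C = "cube (Suc n)"
  let ?X = "subtopology ?C (cube_boundary (Suc n))"
  define T where "T k = (if k = 0 then {p \<in> topspace ?C. p n = 0} else if k = 1 then {p \<in> topspace ?C. p n = 1}
      else {p \<in> topspace ?C. \<exists>i<n. p i = 0 \<or> p i = 1})" for k :: nat
  define f where "f k = (if k = 0 then (\<lambda>p. g (restrict p {..<n})) else if k = 1 then (\<lambda>p. h (restrict p {..<n}))
      else (\<lambda>p. x))" for k :: nat
  have T: "\<Union>(T ` {0,1,2}) = cube_boundary (Suc n)" "\<And>k. T k \<subseteq> cube_boundary (Suc n)"
    by (auto simp: T_def cube_boundary_Suc)
  have b: "g (restrict p {..<n}) = x" "h (restrict p {..<n}) = x"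
    if "p \<in> topspace ?C" "\<exists>i<n. p i = 0 \<or> p i = 1" for p
    using that restrict_in_cube[of p n] g(2) h(2) by (auto simp: based_at_def)
  show ?thesis
  proof (rule pasting_lemma_closed[where I = "{0,1,2}" and T = T and f = f])
    fix i :: nat assume i: "i \<in> {0,1,2}"
    have "closedin ?C (T i)"
      using closed_in_cube_coord[of n "Suc n" "{0}"] closed_in_cube_coord[of n "Suc n" "{1}"]
        closed_in_cube_bd[of n "Suc n"] by (auto simp: T_def)
    then show "closedin ?X (T i)"
      using T(2)[of i] by (simp add: closedin_subset_topspace closedin_subset)
    have "continuous_map ?C X (f i)"
      using continuous_map_compose[OF continuous_map_restrict_cube] g(1) h(1) x by (auto simp: f_def o_def)
    then show "continuous_map (subtopology ?X (T i)) X (f i)"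
      by (intro continuous_map_from_subtopology)
  next
    fix i j :: nat and p assume "i \<in> {0,1,2}" "j \<in> {0,1,2}" "p \<in> topspace ?X \<inter> T i \<inter> T j"
    then show "f i p = f j p"
      using b[of p] by (auto simp: f_def T_def split: if_splits)
  next
    fix p assume p: "p \<in> topspace ?X"
    then have "p \<in> cube_boundary (Suc n)" by simp
    then consider "p \<in> T 0" | "p \<in> T 1" "p \<notin> T 0" | "p \<in> T 2" "p \<notin> T 0" "p \<notin> T 1"
      using T(1) by (auto)
    then show "\<exists>j. j \<in> {0,1,2} \<and> p \<in> T j \<and> u p = f j p"
    proof cases
      case 3
      then show ?thesis by (intro exI[of _ 2]) (auto simp: u_def f_def T_def)
    qed (auto simp: u_def f_def T_def)
  qed auto
qed

section \<open>Injectivity and surjectivity from the lifting property\<close>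

lemma cube_top_restrict: "p \<in> topspace (cube n) \<Longrightarrow> restrict (p(n := t)) {..<n} = p"
  by (auto simp: topspace_cube PiE_iff extensional_def restrict_def fun_eq_iff)

lemma based_at_cong:
  assumes "\<And>p. p \<in> topspace (cube n) \<Longrightarrow> g p = h p"
  shows "based_at n x g = based_at n x h"
  using assms by (auto simp: based_at_def)

text \<open>A homotopy downstairs is a map of the cube one dimension higher whose restriction to the
  boundary already lifts: to \<open>g\<close> and \<open>h\<close> at the two ends and to
  \<open>x\<close> on the sides. An extension of this boundary lift over the cube is a homotopy
  upstairs.\<close>

lemma lifting_property_injective:
  assumes lp: "lifting_property X Y f" and x: "x \<in> topspace X"
    and g: "continuous_map (cube n) X g" "based_at n x g"
    and h: "continuous_map (cube n) X h" "based_at n x h"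
    and gh: "homotopic_with (based_at n (f x)) (cube n) Y (f \<circ> g) (f \<circ> h)"
  shows "homotopic_with (based_at n x) (cube n) X g h"
proof -
  obtain k where k: "continuous_map (prod_topology (top_of_set {0..1::real}) (cube n)) Y k"
    "\<And>p. p \<in> topspace (cube n) \<Longrightarrow> k (0,p) = f (g p)" "\<And>p. p \<in> topspace (cube n) \<Longrightarrow> k (1,p) = f (h p)"
    "\<And>t. t \<in> {0..1} \<Longrightarrow> based_at n (f x) (\<lambda>p. k (t,p))"
    using gh unfolding homotopic_with_def o_apply by blast
  define v where "v p = k (p n, restrict p {..<n})" for p
  define u where "u \<equiv> \<lambda>p. if p n = (0::real) then g (restrict p {..<n}) else if p n = 1 then h (restrict p {..<n}) else x"
  have u: "continuous_map (subtopology (cube (Suc n)) (cube_boundary (Suc n))) X u"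
    unfolding u_def using cube_boundary_glue[OF g h x] .
  have pn: "p n \<in> {0..1}" if "p \<in> topspace (cube (Suc n))" for p
    using that by (auto simp: topspace_cube PiE_iff)
  have v: "continuous_map (cube (Suc n)) Y v"
  proof -
    have "continuous_map (cube (Suc n)) (prod_topology (top_of_set {0..1}) (cube n)) (\<lambda>p. (p n, restrict p {..<n}))"
      using continuous_map_restrict_cube continuous_map_cube_coord[of n "Suc n"] pn
      by (auto simp: continuous_map_pairedI continuous_map_in_subtopology)
    from continuous_map_compose[OF this k(1)] show ?thesis by (simp add: v_def[abs_def] o_def)
  qed
  have uv: "\<forall>p\<in>cube_boundary (Suc n). f (u p) = v p"
  proof
    fix p assume p: "p \<in> cube_boundary (Suc n)"
    then have pc: "p \<in> topspace (cube (Suc n))" by (simp add: cube_boundary_def)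
    note r = restrict_in_cube[OF pc]
    show "f (u p) = v p"
    proof (cases "p n = 0 \<or> p n = 1")
      case True
      then show ?thesis using k(2,3)[OF r] by (auto simp: u_def v_def)
    next
      case False
      then have "\<exists>i<n. p i = 0 \<or> p i = 1"
        using p by (auto simp: cube_boundary_def less_Suc_eq)
      then have "k (p n, restrict p {..<n}) = f x"
        using k(4)[OF pn[OF pc]] r by (auto simp: based_at_def)
      then show ?thesis using False by (simp add: u_def v_def)
    qed
  qed
  obtain w where w: "continuous_map (cube (Suc n)) X w" "\<forall>p\<in>cube_boundary (Suc n). w p = u p"
    by (rule lifting_propertyE[OF lp u v uv])
  have up: "p(n := t) \<in> topspace (cube (Suc n))" if "p \<in> topspace (cube n)" "t \<in> {0..1}" for p t
    using that by (force simp: topspace_cube PiE_iff extensional_def less_Suc_eq)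
  have bd: "p(n := t) \<in> cube_boundary (Suc n)" if "p \<in> topspace (cube n)" "t \<in> {0..1}" "t = 0 \<or> t = 1 \<or> (\<exists>i<n. p i = 0 \<or> p i = 1)" for p t
    using up[OF that(1,2)] that(3) unfolding cube_boundary_Suc by force
  have ub: "u (p(n := t)) = x" if p: "p \<in> topspace (cube n)" "\<exists>i<n. p i = 0 \<or> p i = 1" for p t
    using p g(2) h(2) by (auto simp: u_def cube_top_restrict[OF p(1)] based_at_def)
  show ?thesis
  proof (rule cube_homotopy_of_map[OF w(1)])
    fix p assume p: "p \<in> topspace (cube n)"
    show "w (p(n := 0)) = g p" "w (p(n := 1)) = h p"
      using w(2) bd[OF p] cube_top_restrict[OF p] by (auto simp: u_def)
  next
    fix t :: real assume t: "t \<in> {0..1}"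
    show "based_at n x (\<lambda>p. w (p(n := t)))"
      unfolding based_at_def
    proof (intro ballI impI)
      fix p assume p: "p \<in> topspace (cube n)" "\<exists>i<n. p i = 0 \<or> p i = 1"
      then have "p(n := t) \<in> cube_boundary (Suc n)"
        by (intro bd[OF p(1) t]) simp
      then show "w (p(n := t)) = x"
        using w(2) ub[OF p] by simp
    qed
  qed (rule based_at_cong)
qed

text \<open>Prescribing the constant lift \<open>x\<close> on the boundary makes the extension a
  based map, and a homotopy relative to the boundary is then a based homotopy.\<close>

lemma lifting_property_surjective:
  assumes lp: "lifting_property X Y f" and x: "x \<in> topspace X"
    and v: "continuous_map (cube n) Y v" "based_at n (f x) v"
  obtains g where "continuous_map (cube n) X g" "based_at n x g"
    "homotopic_with (based_at n (f x)) (cube n) Y (f \<circ> g) v"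
proof -
  have 1: "continuous_map (subtopology (cube n) (cube_boundary n)) X (\<lambda>p. x)"
    using x by simp
  have "\<forall>p\<in>cube_boundary n. f x = v p"
    using v(2) by (auto simp: based_at_iff)
  then obtain w where w: "continuous_map (cube n) X w" "\<forall>p\<in>cube_boundary n. w p = x"
     "homotopic_with (\<lambda>h. \<forall>p\<in>cube_boundary n. h p = v p) (cube n) Y (f \<circ> w) v"
    by (rule lifting_propertyE[OF lp 1 v(1)])
  have "homotopic_with (based_at n (f x)) (cube n) Y (f \<circ> w) v"
    by (rule homotopic_with_mono[OF w(3)]) (use v(2) in \<open>auto simp: based_at_iff\<close>)
  with w(1,2) show thesis by (intro that[of w]) (auto simp: based_at_iff)
qed

lemma cube_0: "topspace (cube 0) = {\<lambda>_. undefined}" "cube_boundary 0 = {}"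
  by (auto simp: topspace_cube cube_boundary_def)

lemma path_component_homotopic:
  assumes "homotopic_with P X Y f g" "x \<in> topspace X"
  shows "path_component_of Y (f x) (g x)"
proof -
  obtain h where h: "continuous_map (prod_topology (top_of_set {0..1}) X) Y h"
    "\<forall>x. h (0::real, x) = f x" "\<forall>x. h (1, x) = g x"
    using assms(1) unfolding homotopic_with_def by blast
  have "continuous_map (top_of_set {0..1}) Y (\<lambda>t. h (t, x))"
    using continuous_map_compose[OF _ h(1), of "top_of_set {0..1}" "\<lambda>t. (t,x)"] assms(2)
    by (simp add: o_def continuous_map_pairedI)
  then show ?thesis
    unfolding path_component_of_def pathin_def using h(2,3) by (intro exI[of _ "\<lambda>t. h (t,x)"]) auto
qed

text \<open>The extension argument in dimension 1: the boundary of an interval consists of its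
  endpoints, which lift to \<open>a\<close> and \<open>b\<close>.\<close>

lemma lifting_property_path_component:
  assumes lp: "lifting_property X Y f" and a: "a \<in> topspace X" and b: "b \<in> topspace X"
    and ab: "path_component_of Y (f a) (f b)"
  shows "path_component_of X a b"
proof -
  obtain c where c: "continuous_map (top_of_set {0..1}) Y c" "c (0::real) = f a" "c 1 = f b"
    using ab unfolding path_component_of_def pathin_def by auto
  define v where "v p = c (p 0)" for p :: "nat \<Rightarrow> real"
  define u where "u p = (if p 0 = (0::real) then a else b)" for p :: "nat \<Rightarrow> real"
  have e: "continuous_map (cube 1) (top_of_set {0..1}) (\<lambda>p. p 0)"
    using continuous_map_cube_coord[of 0 1] by (auto simp: continuous_map_in_subtopology topspace_cube PiE_iff)
  have 1: "continuous_map (cube 1) Y v"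
    using continuous_map_compose[OF e c(1)] by (simp add: v_def[abs_def] o_def)
  have 2: "continuous_map (subtopology (cube 1) (cube_boundary 1)) X u"
  proof -
    \<comment> \<open>In dimension 0 the boundary is empty, so the constant maps at \<open>a\<close>
      and at \<open>b\<close> are both vacuously based at \<open>b\<close>, and the gluing lemma
      admits two different end values.\<close>
    have "u = (\<lambda>p. if p 0 = 0 then a else if p 0 = 1 then b else b)"
      by (auto simp: u_def)
    then show ?thesis
      using cube_boundary_glue[of 0 X "\<lambda>_. a" b "\<lambda>_. b"] a b by (simp only: based_at_def) simp
  qed
  have 3: "\<forall>p\<in>cube_boundary 1. f (u p) = v p"
    using c by (auto simp: u_def v_def cube_boundary_def)
  obtain w where w: "continuous_map (cube 1) X w" "\<forall>p\<in>cube_boundary 1. w p = u p"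
    by (rule lifting_propertyE[OF lp 2 1 3])
  have i: "continuous_map (top_of_set {0..1}) (cube 1) (\<lambda>t. \<lambda>i\<in>{..<1}. t)"
    by (rule continuous_map_into_cube) auto
  have "continuous_map (top_of_set {0..1}) X (\<lambda>t. w (\<lambda>i\<in>{..<1}. t))"
    using continuous_map_compose[OF i w(1)] by (simp add: o_def)
  moreover have "w (\<lambda>i\<in>{..<1}. 0) = a" "w (\<lambda>i\<in>{..<1}. 1) = b"
    using w(2) by (auto simp: cube_boundary_def topspace_cube u_def)
  ultimately show ?thesis
    unfolding path_component_of_def pathin_def by (intro exI[of _ "\<lambda>t. w (\<lambda>i\<in>{..<1}. t)"]) auto
qed

theorem lifting_property_imp_weak_equivalence:
  assumes lp: "lifting_property X Y f"
  shows "weak_equivalence X Y f"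
  unfolding weak_equivalence_def
proof (intro conjI allI impI ballI)
  show f: "continuous_map X Y f"
    using lp by (simp add: lifting_property_def)
  show "bij_betw (path_components_map Y f) (path_components_of X) (path_components_of Y)"
    unfolding bij_betw_def
  proof
    show "inj_on (path_components_map Y f) (path_components_of X)"
    proof (rule inj_onI)
      fix C D assume CD: "C \<in> path_components_of X" "D \<in> path_components_of X"
        and e: "path_components_map Y f C = path_components_map Y f D"
      obtain a b where a: "a \<in> topspace X" "C = path_component_of_set X a"
        and b: "b \<in> topspace X" "D = path_component_of_set X b"
        using CD by (auto simp: path_components_of_def)
      have "path_component_of_set Y (f a) = path_component_of_set Y (f b)"
        using e a b path_components_map_eq[OF f] by simp
      moreover have "f b \<in> path_component_of_set Y (f b)"
        using f b by (auto simp: path_component_of_refl continuous_map_def)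
      ultimately have "path_component_of Y (f a) (f b)" by auto
      from lifting_property_path_component[OF lp a(1) b(1) this]
      show "C = D" using a b by (metis path_component_of_equiv)
    qed
    show "path_components_map Y f ` path_components_of X = path_components_of Y"
    proof (intro equalityI subsetI)
      fix D assume "D \<in> path_components_map Y f ` path_components_of X"
      then show "D \<in> path_components_of Y"
        using f by (auto simp: path_components_of_def path_components_map_eq[OF f] continuous_map_def)
    next
      fix D assume "D \<in> path_components_of Y"
      then obtain y where y: "y \<in> topspace Y" "D = path_component_of_set Y y"
        by (auto simp: path_components_of_def)
      \<comment> \<open>A point of \<open>Y\<close> is a map of the 0-cube, whose boundary is empty,
        so that nothing has to be prescribed; the homotopy obtained is a path from
        \<open>f x\<close> to \<open>y\<close>.\<close>
      have 1: "continuous_map (subtopology (cube 0) (cube_boundary 0)) X (\<lambda>_. undefined)"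
        by (simp add: cube_0 continuous_map_def)
      have 2: "continuous_map (cube 0) Y (\<lambda>_. y)" using y by simp
      obtain w where w: "continuous_map (cube 0) X w"
        "homotopic_with (\<lambda>h. \<forall>p\<in>cube_boundary 0. h p = y) (cube 0) Y (f \<circ> w) (\<lambda>_. y)"
        by (rule lifting_propertyE[OF lp 1 2]) (auto simp: cube_0)
      define x where "x = w (\<lambda>_. undefined)"
      have x: "x \<in> topspace X"
        using w(1) by (auto simp: continuous_map_def cube_0 x_def)
      have "path_component_of Y (f x) y"
        using path_component_homotopic[OF w(2), of "\<lambda>_. undefined"] by (simp add: cube_0 x_def)
      then have "D = path_components_map Y f (path_component_of_set X x)"
        using path_components_map_eq[OF f x] y by (metis path_component_of_equiv)
      then show "D \<in> path_components_map Y f ` path_components_of X"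
        using x by (auto simp: path_components_of_def)
    qed
  qed
  fix n :: nat and x assume "1 \<le> n" and x: "x \<in> topspace X"
  show "bij_betw (homotopy_group_map n Y f x) (homotopy_group n X x) (homotopy_group n Y (f x))"
    unfolding bij_betw_def
  proof
    show "inj_on (homotopy_group_map n Y f x) (homotopy_group n X x)"
    proof (rule inj_onI)
      fix C D assume CD: "C \<in> homotopy_group n X x" "D \<in> homotopy_group n X x"
        and e: "homotopy_group_map n Y f x C = homotopy_group_map n Y f x D"
      obtain g where g: "continuous_map (cube n) X g" "based_at n x g" and C: "C = sphere_class n X x g"
        using CD by (auto simp: homotopy_group_def)
      obtain h where h: "continuous_map (cube n) X h" "based_at n x h" and D: "D = sphere_class n X x h"
        using CD by (auto simp: homotopy_group_def)
      have "homotopic_with (based_at n (f x)) (cube n) Y (f \<circ> g) (f \<circ> h)"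
      proof -
        have "based_at n (f x) (f \<circ> h)"
          using h(2) by (simp add: based_at_def)
        from sphere_class_eq_iff[OF continuous_map_compose[OF h(1) f] this] show ?thesis
          using e by (simp only: C D homotopy_group_map_sphere_class[OF f] g h)
      qed
      from sphere_class_eq[OF lifting_property_injective[OF lp x g h this]]
      show "C = D" by (simp add: C D)
    qed
    show "homotopy_group_map n Y f x ` homotopy_group n X x = homotopy_group n Y (f x)"
    proof (intro equalityI subsetI)
      fix D assume "D \<in> homotopy_group_map n Y f x ` homotopy_group n X x"
      then obtain g where g: "continuous_map (cube n) X g" "based_at n x g"
        and D: "D = homotopy_group_map n Y f x (sphere_class n X x g)"
        by (auto simp: homotopy_group_def)
      then show "D \<in> homotopy_group n Y (f x)"
        using continuous_map_compose[OF g(1) f]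
        by (auto simp: homotopy_group_map_sphere_class[OF f] homotopy_group_def based_at_def intro!: imageI)
    next
      fix D assume "D \<in> homotopy_group n Y (f x)"
      then obtain v where v: "continuous_map (cube n) Y v" "based_at n (f x) v"
        and D: "D = sphere_class n Y (f x) v"
        by (auto simp: homotopy_group_def)
      obtain g where g: "continuous_map (cube n) X g" "based_at n x g"
        "homotopic_with (based_at n (f x)) (cube n) Y (f \<circ> g) v"
        by (rule lifting_property_surjective[OF lp x v])
      then have "D = homotopy_group_map n Y f x (sphere_class n X x g)"
        using sphere_class_eq[OF g(3)] by (simp add: D homotopy_group_map_sphere_class[OF f])
      then show "D \<in> homotopy_group_map n Y f x ` homotopy_group n X x"
        using g by (auto simp: homotopy_group_def)
    qed
  qed
qed

section \<open>Pushing forward barycentric coordinates\<close>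

lemma standard_simplexD:
  assumes "t \<in> standard_simplex n"
  shows "0 \<le> t i" "n < i \<Longrightarrow> t i = 0" "(\<Sum>i\<le>n. t i) = 1"
  using assms by (auto simp: standard_simplex_def)

lemma standard_simplexI:
  assumes "\<And>i. 0 \<le> t i" "\<And>i. n < i \<Longrightarrow> t i = 0" "(\<Sum>i\<le>n. t i) = 1"
  shows "t \<in> standard_simplex n"
proof -
  have "t i \<le> 1" for i
  proof (cases "i \<le> n")
    case True
    then have "t i \<le> (\<Sum>i\<le>n. t i)"
      using assms(1) by (intro member_le_sum) auto
    then show ?thesis using assms(3) by simp
  next
    case False
    then show ?thesis using assms(2)[of i] by simp
  qed
  then show ?thesis using assms by (simp add: standard_simplex_def)
qed

lemma pushforward_eq:
  assumes "finite S" "\<And>v. v \<notin> S \<Longrightarrow> x v = 0"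
  shows "pushforward f x w = (\<Sum>v | v \<in> S \<and> f v = w. x v)"
  unfolding pushforward_def using assms by (intro sum.mono_neutral_left) auto

text \<open>Change of variables for a finitely supported measure: integrating \<open>g\<close>
  against the image measure is integrating \<open>g\<close> composed with \<open>f\<close>. It
  controls total mass, composition of pushforwards, and invariance of coordinates under
  gluing.\<close>

lemma sum_pushforward:
  fixes g :: "'w \<Rightarrow> real"
  assumes "finite S" "\<And>v. v \<notin> S \<Longrightarrow> x v = 0" "f \<in> S \<rightarrow> T" "finite T"
  shows "(\<Sum>w\<in>T. pushforward f x w * g w) = (\<Sum>v\<in>S. x v * g (f v))"
proof -
  have "(\<Sum>w\<in>T. pushforward f x w * g w) = (\<Sum>w\<in>T. \<Sum>v | v \<in> S \<and> f v = w. x v * g (f v))"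
    by (intro sum.cong refl) (simp add: pushforward_eq[OF assms(1,2)] sum_distrib_right)
  also have "\<dots> = (\<Sum>v\<in>S. x v * g (f v))"
    by (rule sum.group) (use assms in auto)
  finally show ?thesis .
qed

lemma pushforward_nonneg: "(\<And>v. 0 \<le> x v) \<Longrightarrow> 0 \<le> pushforward f x w"
  unfolding pushforward_def by (rule sum_nonneg)

lemma pushforward_simplex_eq:
  "t \<in> standard_simplex m \<Longrightarrow> pushforward \<theta> t p = (\<Sum>q | q \<le> m \<and> \<theta> q = p. t q)"
  using pushforward_eq[of "{..m}" t \<theta> p] by (auto simp: standard_simplex_def)

lemma sum_pushforward_simplex:
  fixes g :: "nat \<Rightarrow> real"
  assumes "t \<in> standard_simplex m" "\<theta> \<in> {..m} \<rightarrow> {..n}"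
  shows "(\<Sum>p\<le>n. pushforward \<theta> t p * g p) = (\<Sum>q\<le>m. t q * g (\<theta> q))"
  by (rule sum_pushforward) (use assms in \<open>auto simp: standard_simplex_def\<close>)

section \<open>Maps out of realizations\<close>

lemma continuous_map_from_sum:
  assumes "\<And>i. i \<in> I \<Longrightarrow> continuous_map (X i) Z (\<lambda>x. f (i, x))"
  shows "continuous_map (sum_topology X I) Z f"
  unfolding continuous_map_def
proof (intro conjI allI impI)
  show "f \<in> topspace (sum_topology X I) \<rightarrow> topspace Z"
    using assms by (force simp: continuous_map_def)
  fix U assume U: "openin Z U"
  show "openin (sum_topology X I) {x \<in> topspace (sum_topology X I). f x \<in> U}"
    unfolding openin_sum_topology
  proof (intro conjI ballI)
    fix i assume i: "i \<in> I"
    have "{x. (i, x) \<in> {x \<in> topspace (sum_topology X I). f x \<in> U}} = {x \<in> topspace (X i). f (i, x) \<in> U}"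
      using i by auto
    then show "openin (X i) {x. (i, x) \<in> {x \<in> topspace (sum_topology X I). f x \<in> U}}"
      using assms[OF i] U by (simp add: continuous_map_def)
  qed auto
qed

lemma glue_class_refl: "p \<in> glue_class X p"
  by (simp add: glue_class_def)

lemma glue_class_eq:
  assumes "equivclp (glue X) p p'"
  shows "glue_class X p = glue_class X p'"
  using assms unfolding glue_class_def by (auto intro: equivclp_trans equivclp_sym)

lemma glue_class_eq_glue: "glue X p p' \<Longrightarrow> glue_class X p = glue_class X p'"
  by (rule glue_class_eq) (rule r_into_equivclp)

lemma topspace_realization: "topspace (realization X) = glue_class X ` topspace (realization_sum X)"
  using quotient_imp_surjective_map[OF quotient_map_quotient_topology] by (metis realization_def)

lemma continuous_map_glue_class: "continuous_map (realization_sum X) (realization X) (glue_class X)"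
  unfolding realization_def by (rule quotient_imp_continuous_map[OF quotient_map_quotient_topology])

text \<open>Descends a function to classes by evaluating it at a chosen representative; meaningful
  when the function is invariant under gluing.\<close>

definition class_lift :: "('p \<Rightarrow> 'c) \<Rightarrow> 'p set \<Rightarrow> 'c" where
  "class_lift f c = f (SOME p. p \<in> c)"

lemma equivclp_invariant:
  assumes "\<And>p p'. r p p' \<Longrightarrow> f p = f p'" "equivclp r p p'"
  shows "f p = f p'"
  using assms(2) by (induction rule: equivclp_induct) (use assms(1) in \<open>metis+\<close>)

lemma class_lift_glue_class:
  assumes "\<And>p p'. glue X p p' \<Longrightarrow> f p = f p'"
  shows "class_lift f (glue_class X p) = f p"
proof -
  have "(SOME p'. p' \<in> glue_class X p) \<in> glue_class X p"
    using glue_class_refl by (rule someI)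
  then show ?thesis
    unfolding class_lift_def using equivclp_invariant[of "glue X" f p, OF assms] by (simp add: glue_class_def)
qed

text \<open>The universal property of a quotient of a sum: an invariant function need only be
  continuous on each level times its simplex.\<close>

lemma continuous_map_class_lift:
  assumes "\<And>p p'. glue X p p' \<Longrightarrow> f p = f p'"
    and "\<And>n. continuous_map (prod_topology (level X n) (subtopology (powertop_real UNIV) (standard_simplex n)))
           Z (\<lambda>(x, t). f (n, x, t))"
  shows "continuous_map (realization X) Z (class_lift f)"
  unfolding realization_def
proof (rule continuous_compose_quotient_map[OF quotient_map_quotient_topology])
  have "class_lift f \<circ> glue_class X = f"
    using class_lift_glue_class[of X f, OF assms(1)] by auto
  then show "continuous_map (realization_sum X) Z (class_lift f \<circ> glue_class X)"
    unfolding realization_sum_def using assms(2)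
    by (auto intro!: continuous_map_from_sum simp: case_prod_unfold)
qed

definition simplicial_map ::
  "'a simplicial_space \<Rightarrow> 'b simplicial_space \<Rightarrow> (nat \<Rightarrow> 'a \<Rightarrow> 'b) \<Rightarrow> bool" where
  "simplicial_map X Y \<phi> \<longleftrightarrow> (\<forall>n. continuous_map (level X n) (level Y n) (\<phi> n)) \<and>
     (\<forall>m n \<theta>. \<forall>x\<in>topspace (level X n). mono_on {..m} \<theta> \<longrightarrow> \<theta> \<in> {..m} \<rightarrow> {..n} \<longrightarrow>
        \<phi> m (operator X m n \<theta> x) = operator Y m n \<theta> (\<phi> n x))"

lemma glue_simplicial_map:
  assumes \<phi>: "simplicial_map X Y \<phi>" and "glue X p p'"
  shows "glue Y (case p of (n, x, t) \<Rightarrow> (n, \<phi> n x, t)) (case p' of (n, x, t) \<Rightarrow> (n, \<phi> n x, t))"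
  using assms(2)
proof cases
  case (1 m \<theta> n x t)
  then have "\<phi> n x \<in> topspace (level Y n)" "\<phi> m (operator X m n \<theta> x) = operator Y m n \<theta> (\<phi> n x)"
    using \<phi> by (auto simp: simplicial_map_def continuous_map_def)
  with 1 show ?thesis
    using glue.intros[of m \<theta> n "\<phi> n x" Y t] by simp
qed

text \<open>A simplicial map sends glued points to glued points, so all representatives contribute
  the same class to the union.\<close>

lemma realization_map_glue_class:
  assumes \<phi>: "simplicial_map X Y \<phi>"
  shows "realization_map Y \<phi> (glue_class X (n, x, t)) = glue_class Y (n, \<phi> n x, t)"
proof -
  let ?f = "\<lambda>p. glue_class Y (case p of (n, x, t) \<Rightarrow> (n, \<phi> n x, t))"
  have "?f p = ?f (n, x, t)" if "p \<in> glue_class X (n, x, t)" for p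
    using equivclp_invariant[of "glue X" ?f "(n,x,t)" p] glue_class_eq_glue[OF glue_simplicial_map[OF \<phi>]] that
    by (auto simp: glue_class_def)
  then have "(\<Union>p\<in>glue_class X (n, x, t). ?f p) = ?f (n, x, t)"
    using glue_class_refl by blast
  then show ?thesis
    unfolding realization_map_def by (simp add: case_prod_unfold)
qed

lemma continuous_map_realization_map:
  assumes \<phi>: "simplicial_map X Y \<phi>"
  shows "continuous_map (realization X) (realization Y) (realization_map Y \<phi>)"
  unfolding realization_def[of X]
proof (rule continuous_compose_quotient_map[OF quotient_map_quotient_topology])
  have "continuous_map (prod_topology (level X n) (subtopology (powertop_real UNIV) (standard_simplex n)))
     (prod_topology (level Y n) (subtopology (powertop_real UNIV) (standard_simplex n))) (\<lambda>(x, t). (\<phi> n x, t))" for n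
    using \<phi> by (auto simp: simplicial_map_def continuous_map_prod_top)
  then have "continuous_map (realization_sum X) (realization_sum Y) (\<lambda>(n, p). (n, (\<lambda>(x, t). (\<phi> n x, t)) p))"
    unfolding realization_sum_def by (intro continuous_map_sum_topology) auto
  from continuous_map_compose[OF this continuous_map_glue_class]
  show "continuous_map (realization_sum X) (realization Y) (realization_map Y \<phi> \<circ> glue_class X)"
    by (rule continuous_map_eq) (auto simp: realization_map_glue_class[OF \<phi>])
qed

section \<open>Nerves\<close>

lemma topspace_nerve:
  "(x, f) \<in> topspace (level (nerve T) n) \<longleftrightarrow>
     x \<in> {..n} \<rightarrow>\<^sub>E topspace (Ob T) \<and> f \<in> poset_arrows n \<rightarrow>\<^sub>E topspace (Mor T) \<and>
     (\<forall>i j. i \<le> j \<and> j \<le> n \<longrightarrow> src T (f (i, j)) = x i \<and> tgt T (f (i, j)) = x j) \<and>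
     (\<forall>i\<le>n. f (i, i) = idm T (x i)) \<and>
     (\<forall>i j k. i \<le> j \<and> j \<le> k \<and> k \<le> n \<longrightarrow> f (i, k) = cmp T (f (j, k)) (f (i, j)))"
  by (auto simp: nerve_def)

lemma operator_nerve:
  "operator (nerve T) m n \<theta> (x, f) = ((\<lambda>i\<in>{..m}. x (\<theta> i)), (\<lambda>(i, j)\<in>poset_arrows m. f (\<theta> i, \<theta> j)))"
  by (simp add: nerve_def)

lemma continuous_map_nerve_object:
  assumes "i \<le> n"
  shows "continuous_map (level (nerve T) n) (Ob T) (\<lambda>y. fst y i)"
proof -
  have "continuous_map (level (nerve T) n) (product_topology (\<lambda>_. Ob T) {..n}) fst"
    by (simp add: nerve_def continuous_map_from_subtopology continuous_map_fst)
  from continuous_map_compose[OF this continuous_map_product_projection[of i]] assms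
  show ?thesis by (simp add: o_def)
qed

lemma continuous_map_nerve_arrow:
  assumes "i \<le> j" "j \<le> n"
  shows "continuous_map (level (nerve T) n) (Mor T) (\<lambda>y. snd y (i, j))"
proof -
  have "continuous_map (level (nerve T) n) (product_topology (\<lambda>_. Mor T) (poset_arrows n)) snd"
    by (simp add: nerve_def continuous_map_from_subtopology continuous_map_snd)
  from continuous_map_compose[OF this continuous_map_product_projection[of "(i, j)"]] assms
  show ?thesis by (simp add: o_def)
qed

lemma continuous_map_into_nerve:
  assumes "\<And>i. i \<le> n \<Longrightarrow> continuous_map X (Ob T) (\<lambda>p. x p i)"
    and "\<And>i j. i \<le> j \<Longrightarrow> j \<le> n \<Longrightarrow> continuous_map X (Mor T) (\<lambda>p. f p (i, j))"
    and "\<And>p. p \<in> topspace X \<Longrightarrow> (x p, f p) \<in> topspace (level (nerve T) n)"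
  shows "continuous_map X (level (nerve T) n) (\<lambda>p. (x p, f p))"
proof -
  have e: "x p \<in> extensional {..n}" "f p \<in> extensional (poset_arrows n)" if "p \<in> topspace X" for p
    using assms(3)[OF that] by (auto simp: topspace_nerve PiE_iff)
  have "continuous_map X (product_topology (\<lambda>_. Ob T) {..n}) x"
    unfolding continuous_map_componentwise using assms(1) e by auto
  moreover have "continuous_map X (product_topology (\<lambda>_. Mor T) (poset_arrows n)) f"
    unfolding continuous_map_componentwise using assms(2) e by auto
  ultimately have "continuous_map X
      (prod_topology (product_topology (\<lambda>_. Ob T) {..n}) (product_topology (\<lambda>_. Mor T) (poset_arrows n)))
      (\<lambda>p. (x p, f p))"
    by (rule continuous_map_pairedI)
  then show ?thesis
    unfolding nerve_def simplicial_space.simps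
    by (rule continuous_map_into_subtopology) (use assms(3) in \<open>auto simp: nerve_def\<close>)
qed

lemma simplicial_map_nerve_map:
  assumes F: "continuous_map (Ob T) (Ob T') F" and G: "continuous_map (Mor T) (Mor T') G"
    and st: "\<And>f. f \<in> topspace (Mor T) \<Longrightarrow> src T' (G f) = F (src T f) \<and> tgt T' (G f) = F (tgt T f)"
    and id: "\<And>x. x \<in> topspace (Ob T) \<Longrightarrow> G (idm T x) = idm T' (F x)"
    and cmp: "\<And>f g. f \<in> topspace (Mor T) \<Longrightarrow> g \<in> topspace (Mor T) \<Longrightarrow> tgt T f = src T g \<Longrightarrow>
       G (cmp T g f) = cmp T' (G g) (G f)"
  shows "simplicial_map (nerve T) (nerve T') (nerve_map F G)"
  unfolding simplicial_map_def
proof (intro conjI allI ballI impI)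
  fix n
  have e: "nerve_map F G n = (\<lambda>y. ((\<lambda>i\<in>{..n}. F (fst y i)), (\<lambda>e\<in>poset_arrows n. G (snd y e))))"
    by (rule ext) (simp only: nerve_map_def split_beta)
  show "continuous_map (level (nerve T) n) (level (nerve T') n) (nerve_map F G n)"
    unfolding e
  proof (rule continuous_map_into_nerve)
    fix i assume "i \<le> n"
    then show "continuous_map (level (nerve T) n) (Ob T') (\<lambda>p. (\<lambda>i\<in>{..n}. F (fst p i)) i)"
      using continuous_map_compose[OF continuous_map_nerve_object F] by (simp add: o_def)
  next
    fix i j assume "i \<le> j" "j \<le> n"
    then show "continuous_map (level (nerve T) n) (Mor T') (\<lambda>p. (\<lambda>e\<in>poset_arrows n. G (snd p e)) (i, j))"
      using continuous_map_compose[OF continuous_map_nerve_arrow G] by (simp add: o_def)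
  next
    fix y assume "y \<in> topspace (level (nerve T) n)"
    then obtain x f where y: "y = (x, f)" and xf: "(x, f) \<in> topspace (level (nerve T) n)"
      by (metis prod.collapse)
    have x: "x i \<in> topspace (Ob T)" if "i \<le> n" for i
      using xf that by (auto simp: topspace_nerve)
    have f: "f (i, j) \<in> topspace (Mor T)" if "i \<le> j" "j \<le> n" for i j
      using xf that by (auto simp: topspace_nerve PiE_iff)
    have F': "F a \<in> topspace (Ob T')" if "a \<in> topspace (Ob T)" for a
      using F that by (auto simp: continuous_map_def)
    have G': "G a \<in> topspace (Mor T')" if "a \<in> topspace (Mor T)" for a
      using G that by (auto simp: continuous_map_def)
    have s: "src T (f (i, j)) = x i" "tgt T (f (i, j)) = x j" if "i \<le> j" "j \<le> n" for i j
      using xf that unfolding topspace_nerve by blast+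
    have c: "G (f (i, k)) = cmp T' (G (f (j, k))) (G (f (i, j)))" if ijk: "i \<le> j" "j \<le> k" "k \<le> n" for i j k
    proof -
      have "f (i, k) = cmp T (f (j, k)) (f (i, j))"
        using xf ijk unfolding topspace_nerve by blast
      then show ?thesis
        using cmp[of "f (i, j)" "f (j, k)"] f s ijk by simp
    qed
    have "G (f (i, i)) = idm T' (F (x i))" if "i \<le> n" for i
    proof -
      have "f (i, i) = idm T (x i)"
        using xf that unfolding topspace_nerve by blast
      then show ?thesis
        using id[OF x[OF that]] by simp
    qed
    moreover have "src T' (G (f (i, j))) = F (x i)" "tgt T' (G (f (i, j))) = F (x j)" if "i \<le> j" "j \<le> n" for i j
      using st[OF f] s that by simp_all
    moreover have "(\<lambda>e\<in>poset_arrows n. G (f e)) \<in> poset_arrows n \<rightarrow>\<^sub>E topspace (Mor T')"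
      using f G' by (auto simp del: restrict_apply simp: restrict_PiE_iff)
    moreover have "(\<lambda>i\<in>{..n}. F (x i)) \<in> {..n} \<rightarrow>\<^sub>E topspace (Ob T')"
      using x F' by auto
    ultimately show "((\<lambda>i\<in>{..n}. F (fst y i)), (\<lambda>e\<in>poset_arrows n. G (snd y e))) \<in> topspace (level (nerve T') n)"
      unfolding topspace_nerve y by (auto intro: c)
  qed
next
  fix m n :: nat and \<theta> :: "nat \<Rightarrow> nat" and y
  assume "y \<in> topspace (level (nerve T) n)" and \<theta>: "mono_on {..m} \<theta>" "\<theta> \<in> {..m} \<rightarrow> {..n}"
  obtain x f where y: "y = (x, f)" by fastforce
  have "\<theta> i \<le> n" if "i \<le> m" for i using \<theta>(2) that by auto
  moreover have "\<theta> i \<le> \<theta> j" if "i \<le> j" "j \<le> m" for i j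
    by (rule mono_onD[OF \<theta>(1)]) (use that in auto)
  ultimately show "nerve_map F G m (operator (nerve T) m n \<theta> y) = operator (nerve T') m n \<theta> (nerve_map F G n y)"
    by (auto simp: y operator_nerve nerve_map_def restrict_def fun_eq_iff)
qed

lemma classifying_map_glue_class:
  assumes "simplicial_map (nerve T) (nerve T') (nerve_map F G)"
  shows "classifying_map T' F G (glue_class (nerve T) (n, x, t)) = glue_class (nerve T') (n, nerve_map F G n x, t)"
  unfolding classifying_map_def by (rule realization_map_glue_class[OF assms])

lemma continuous_map_classifying_map:
  assumes "simplicial_map (nerve T) (nerve T') (nerve_map F G)"
  shows "continuous_map (classifying_space T) (classifying_space T') (classifying_map T' F G)"
  unfolding classifying_map_def classifying_space_def by (rule continuous_map_realization_map[OF assms])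

section \<open>The complex on the common index set\<close>

definition supp :: "('v \<Rightarrow> real) \<Rightarrow> 'v set" where
  "supp x = {v. x v \<noteq> 0}"

lemma closed_simplex_supp:
  assumes "x \<in> closed_simplex \<tau>" "finite \<tau>"
  shows "supp x \<subseteq> \<tau>" "finite (supp x)" "supp x \<noteq> {}" "x \<in> closed_simplex (supp x)"
proof -
  show 1: "supp x \<subseteq> \<tau>"
    using assms(1) by (auto simp: supp_def closed_simplex_def)
  then show "finite (supp x)"
    using assms(2) finite_subset by blast
  have 2: "sum x (supp x) = 1"
    using assms sum.mono_neutral_left[OF assms(2) 1, of x] by (auto simp: supp_def closed_simplex_def)
  then show "supp x \<noteq> {}"
    by auto
  show "x \<in> closed_simplex (supp x)"
    using assms(1) 2 by (auto simp: closed_simplex_def supp_def)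
qed

lemma closed_simplex_mono:
  assumes "finite \<tau>" "\<tau>' \<subseteq> \<tau>"
  shows "closed_simplex \<tau>' \<subseteq> closed_simplex \<tau>"
proof
  fix x assume x: "x \<in> closed_simplex \<tau>'"
  then have "sum x \<tau> = sum x \<tau>'"
    by (intro sum.mono_neutral_right assms) (auto simp: closed_simplex_def)
  then show "x \<in> closed_simplex \<tau>"
    using x assms(2) by (auto simp: closed_simplex_def)
qed

text \<open>The complex called Q in the overview. Its vertices are taken from
  \<open>col_set A\<close>, which is \<open>row_set B\<close> for composable pairs.\<close>

definition mid_complex :: "('i, 'j) bin_rel \<Rightarrow> ('j, 'k) bin_rel \<Rightarrow> 'j set set" where
  "mid_complex A B = {\<tau>. \<tau> \<noteq> {} \<and> finite \<tau> \<and> \<tau> \<subseteq> col_set A \<and>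
     (\<exists>i\<in>row_set A. \<forall>j\<in>\<tau>. holds A i j) \<and> (\<exists>k\<in>col_set B. \<forall>j\<in>\<tau>. holds B j k)}"

abbreviation mid_space :: "('i, 'j) bin_rel \<Rightarrow> ('j, 'k) bin_rel \<Rightarrow> ('j \<Rightarrow> real) topology" where
  "mid_space A B \<equiv> complex_realization (mid_complex A B)"

lemma mid_complex_mono: "\<tau> \<in> mid_complex A B \<Longrightarrow> \<tau>' \<subseteq> \<tau> \<Longrightarrow> \<tau>' \<noteq> {} \<Longrightarrow> \<tau>' \<in> mid_complex A B"
  unfolding mid_complex_def mem_Collect_eq by (meson finite_subset order_trans subsetD)

text \<open>The complex is closed under nonempty subsets, so the support of a point is the smallest
  simplex that carries it.\<close>

lemma in_mid_space:
  "x \<in> topspace (mid_space A B) \<longleftrightarrow> supp x \<in> mid_complex A B \<and> x \<in> closed_simplex (supp x)"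
proof
  assume "x \<in> topspace (mid_space A B)"
  then obtain \<tau> where \<tau>: "\<tau> \<in> mid_complex A B" "x \<in> closed_simplex \<tau>"
    by auto
  then have "finite \<tau>" by (simp add: mid_complex_def)
  from closed_simplex_supp[OF \<tau>(2) this] show "supp x \<in> mid_complex A B \<and> x \<in> closed_simplex (supp x)"
    using mid_complex_mono[OF \<tau>(1)] by blast
qed auto

lemma mid_spaceD:
  assumes "x \<in> topspace (mid_space A B)"
  shows "0 \<le> x j" "finite (supp x)" "supp x \<noteq> {}" "supp x \<subseteq> col_set A" "sum x (supp x) = 1"
    "supp x \<in> mid_complex A B"
  using assms unfolding in_mid_space by (auto simp: mid_complex_def closed_simplex_def)

abbreviation fibre_space :: "('i, 'j) bin_rel \<Rightarrow> ('j, 'k) bin_rel \<Rightarrow> 'i set \<Rightarrow> ('j \<Rightarrow> real) topology" where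
  "fibre_space A B \<sigma> \<equiv> complex_realization (row_complex (B\<lparr>row_set := common_cols A \<sigma>\<rparr>))"

lemma fibre_complex_subset:
  assumes "\<sigma> \<in> row_complex A"
  shows "row_complex (B\<lparr>row_set := common_cols A \<sigma>\<rparr>) \<subseteq> mid_complex A B"
proof -
  obtain i where "i \<in> \<sigma>" "i \<in> row_set A"
    using assms by (auto simp: row_complex_def)
  then show ?thesis
    by (auto simp: row_complex_def mid_complex_def common_cols_def)
qed

text \<open>As \<open>\<sigma>\<close> is nonempty, any of its elements is a common row for the
  columns of a fibre simplex. The fibre complex is therefore a subcomplex of the middle complex, cut
  out by a condition on supports.\<close>

lemma topspace_fibre_space:
  assumes "\<sigma> \<in> row_complex A"
  shows "x \<in> topspace (fibre_space A B \<sigma>) \<longleftrightarrow>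
     x \<in> topspace (mid_space A B) \<and> (\<forall>i\<in>\<sigma>. \<forall>j\<in>supp x. holds A i j)"
proof
  assume "x \<in> topspace (fibre_space A B \<sigma>)"
  then obtain \<tau> where \<tau>: "\<tau> \<in> row_complex (B\<lparr>row_set := common_cols A \<sigma>\<rparr>)" "x \<in> closed_simplex \<tau>"
    by auto
  then have fin: "finite \<tau>" by (simp add: row_complex_def)
  have "\<tau> \<in> mid_complex A B"
    using fibre_complex_subset[OF assms] \<tau>(1) by blast
  then have "x \<in> topspace (mid_space A B)"
    using \<tau>(2) by auto
  moreover have "\<forall>i\<in>\<sigma>. \<forall>j\<in>supp x. holds A i j"
    using closed_simplex_supp(1)[OF \<tau>(2) fin] \<tau>(1) by (auto simp: row_complex_def common_cols_def)
  ultimately show "x \<in> topspace (mid_space A B) \<and> (\<forall>i\<in>\<sigma>. \<forall>j\<in>supp x. holds A i j)" ..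
next
  assume x: "x \<in> topspace (mid_space A B) \<and> (\<forall>i\<in>\<sigma>. \<forall>j\<in>supp x. holds A i j)"
  then have "supp x \<in> row_complex (B\<lparr>row_set := common_cols A \<sigma>\<rparr>)"
    using mid_spaceD(6)[OF conjunct1[OF x]] by (auto simp: mid_complex_def row_complex_def common_cols_def)
  then show "x \<in> topspace (fibre_space A B \<sigma>)"
    using x unfolding in_mid_space by auto
qed

lemma in_Ob_row_category:
  "(\<sigma>, x) \<in> topspace (Ob (row_category A B)) \<longleftrightarrow> \<sigma> \<in> row_complex A \<and> x \<in> topspace (mid_space A B) \<and>
     (\<forall>i\<in>\<sigma>. \<forall>j\<in>supp x. holds A i j)"
  using topspace_fibre_space[of \<sigma> A x B]
  by (auto simp: row_category_def simp del: topspace_complex_realization)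

lemma in_Mor_row_category:
  "((\<sigma>, \<tau>), x) \<in> topspace (Mor (row_category A B)) \<longleftrightarrow> \<sigma> \<in> row_complex A \<and> \<tau> \<in> row_complex A \<and> \<tau> \<subseteq> \<sigma> \<and>
     x \<in> topspace (mid_space A B) \<and> (\<forall>i\<in>\<sigma>. \<forall>j\<in>supp x. holds A i j)"
  using topspace_fibre_space[of \<sigma> A x B]
  by (auto simp: row_category_def simp del: topspace_complex_realization)

lemma row_category_structure:
  "src (row_category A B) ((\<sigma>, \<tau>), x) = (\<sigma>, x)"
  "tgt (row_category A B) ((\<sigma>, \<tau>), x) = (\<tau>, x)"
  "idm (row_category A B) (\<sigma>, x) = ((\<sigma>, \<sigma>), x)"
  "cmp (row_category A B) ((\<tau>, \<upsilon>), y) ((\<sigma>, \<rho>), x) = ((\<sigma>, \<upsilon>), x)"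
  by (simp_all add: row_category_def)

section \<open>Points of the classifying space\<close>

text \<open>No morphism changes the point \<open>x\<close>, and there is at most one morphism
  between two objects, so a simplex of the nerve is a chain of row simplices with one common
  \<open>x\<close>.\<close>

definition chain_simplex :: "nat \<Rightarrow> (nat \<Rightarrow> 'i set) \<Rightarrow> ('j \<Rightarrow> real) \<Rightarrow>
    ('i set \<times> ('j \<Rightarrow> real), ('i set \<times> 'i set) \<times> ('j \<Rightarrow> real)) nerve_simplex" where
  "chain_simplex n \<sigma> x = ((\<lambda>q\<in>{..n}. (\<sigma> q, x)), (\<lambda>(p, q)\<in>poset_arrows n. ((\<sigma> p, \<sigma> q), x)))"

text \<open>Chains descend because arrows go from larger to smaller simplices. The first member is
  the largest, so relating its rows to \<open>supp x\<close> relates the rows of all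
  members.\<close>

definition row_chain :: "('i, 'j) bin_rel \<Rightarrow> ('j, 'k) bin_rel \<Rightarrow> nat \<Rightarrow> (nat \<Rightarrow> 'i set) \<Rightarrow> ('j \<Rightarrow> real) \<Rightarrow> bool" where
  "row_chain A B n \<sigma> x \<longleftrightarrow> (\<forall>q\<le>n. \<sigma> q \<in> row_complex A) \<and> (\<forall>p q. p \<le> q \<longrightarrow> q \<le> n \<longrightarrow> \<sigma> q \<subseteq> \<sigma> p) \<and>
     x \<in> topspace (mid_space A B) \<and> (\<forall>i\<in>\<sigma> 0. \<forall>j\<in>supp x. holds A i j)"

lemma chain_simplex_cong: "(\<And>q. q \<le> n \<Longrightarrow> \<sigma> q = \<sigma>' q) \<Longrightarrow> chain_simplex n \<sigma> x = chain_simplex n \<sigma>' x"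
  by (auto simp: chain_simplex_def restrict_def fun_eq_iff)

lemma row_chain_holds:
  assumes "row_chain A B n \<sigma> x" "q \<le> n" "i \<in> \<sigma> q" "j \<in> supp x"
  shows "holds A i j"
  using assms unfolding row_chain_def by (metis le0 subsetD)

lemma chain_simplex_in_nerve:
  assumes "row_chain A B n \<sigma> x"
  shows "chain_simplex n \<sigma> x \<in> topspace (level (nerve (row_category A B)) n)"
proof -
  have 1: "(\<sigma> q, x) \<in> topspace (Ob (row_category A B))" if "q \<le> n" for q
    unfolding in_Ob_row_category using assms that row_chain_holds[OF assms that] unfolding row_chain_def by blast
  have 2: "((\<sigma> p, \<sigma> q), x) \<in> topspace (Mor (row_category A B))" if "p \<le> q" "q \<le> n" for p q
    unfolding in_Mor_row_category
    using assms that order_trans[OF that] row_chain_holds[OF assms, of p] unfolding row_chain_def by blast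
  show ?thesis
    unfolding chain_simplex_def topspace_nerve using 1 2
    by (auto simp: row_category_structure simp del: restrict_apply simp: restrict_PiE_iff)
      (auto simp: row_category_structure)
qed

text \<open>Sources and targets determine the arrows, and the arrows out of vertex 0 force every
  vertex to carry the same \<open>x\<close>.\<close>

lemma nerve_row_category_cases:
  assumes "y \<in> topspace (level (nerve (row_category A B)) n)"
  obtains \<sigma> x where "row_chain A B n \<sigma> x" "y = chain_simplex n \<sigma> x"
proof -
  obtain xs f where y: "y = (xs, f)" by fastforce
  note y' = assms[unfolded y topspace_nerve]
  define \<sigma> where "\<sigma> q = fst (xs q)" for q
  define x where "x = snd (xs 0)"
  have xs: "xs \<in> {..n} \<rightarrow>\<^sub>E topspace (Ob (row_category A B))"
    and f: "f \<in> poset_arrows n \<rightarrow>\<^sub>E topspace (Mor (row_category A B))"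
    and st: "\<And>i j. i \<le> j \<Longrightarrow> j \<le> n \<Longrightarrow> src (row_category A B) (f (i, j)) = xs i \<and> tgt (row_category A B) (f (i, j)) = xs j"
    using conjunct1[OF y'] conjunct1[OF conjunct2[OF y']] conjunct1[OF conjunct2[OF conjunct2[OF y']]]
    by (simp_all only:)
  have eq: "f (i, j) = ((\<sigma> i, \<sigma> j), snd (xs i)) \<and> snd (xs i) = snd (xs j)" if "i \<le> j" "j \<le> n" for i j
  proof -
    obtain a b c where abc: "f (i, j) = ((a, b), c)" by (metis prod.collapse)
    then have "(a, c) = xs i" "(b, c) = xs j"
      using st[OF that] by (simp_all add: row_category_structure)
    from this[symmetric] show ?thesis
      using abc by (simp add: \<sigma>_def)
  qed
  have x: "snd (xs i) = x" if "i \<le> n" for i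
    using eq[of 0 i] that by (simp add: x_def)
  have xsi: "xs i = (\<sigma> i, x)" if "i \<le> n" for i
    using x[OF that] by (metis \<sigma>_def prod.collapse)
  have ob: "(\<sigma> i, x) \<in> topspace (Ob (row_category A B))" if "i \<le> n" for i
    using xs xsi[OF that] that by (metis PiE_mem atMost_iff)
  have fij: "f (i, j) = ((\<sigma> i, \<sigma> j), x)" if "i \<le> j" "j \<le> n" for i j
    using eq[OF that] x[of i] that by simp
  have mor: "((\<sigma> i, \<sigma> j), x) \<in> topspace (Mor (row_category A B))" if "i \<le> j" "j \<le> n" for i j
    using PiE_mem[OF f, of "(i, j)"] fij[OF that] that by simp
  have "row_chain A B n \<sigma> x"
    using ob mor ob[of 0] unfolding in_Ob_row_category in_Mor_row_category row_chain_def by blast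
  moreover have "y = chain_simplex n \<sigma> x"
  proof -
    have "xs = (\<lambda>q\<in>{..n}. (\<sigma> q, x))"
      using xs xsi by (intro extensionalityI[of _ "{..n}"]) (auto simp: PiE_iff)
    moreover have "f = (\<lambda>(p, q)\<in>poset_arrows n. ((\<sigma> p, \<sigma> q), x))"
      using f fij by (intro extensionalityI[of _ "poset_arrows n"]) (auto simp: PiE_iff)
    ultimately show ?thesis by (simp add: y chain_simplex_def)
  qed
  ultimately show thesis by (rule that)
qed

lemma operator_chain_simplex:
  assumes "mono_on {..m} \<theta>" "\<theta> \<in> {..m} \<rightarrow> {..n}"
  shows "operator (nerve T) m n \<theta> (chain_simplex n \<sigma> x) = chain_simplex m (\<sigma> \<circ> \<theta>) x"
proof -
  have "\<theta> i \<le> n" if "i \<le> m" for i using assms(2) that by auto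
  moreover have "\<theta> i \<le> \<theta> j" if "i \<le> j" "j \<le> m" for i j
    by (rule mono_onD[OF assms(1)]) (use that in auto)
  ultimately show ?thesis
    by (auto simp: chain_simplex_def operator_nerve restrict_def fun_eq_iff)
qed

definition row_point :: "('i, 'j) bin_rel \<Rightarrow> ('j, 'k) bin_rel \<Rightarrow> nat \<Rightarrow> (nat \<Rightarrow> 'i set) \<Rightarrow> ('j \<Rightarrow> real) \<Rightarrow> (nat \<Rightarrow> real) \<Rightarrow>
    ('i set \<times> ('j \<Rightarrow> real), ('i set \<times> 'i set) \<times> ('j \<Rightarrow> real)) classifying_point" where
  "row_point A B n \<sigma> x t = glue_class (nerve (row_category A B)) (n, chain_simplex n \<sigma> x, t)"

abbreviation row_space :: "('i, 'j) bin_rel \<Rightarrow> ('j, 'k) bin_rel \<Rightarrow>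
    ('i set \<times> ('j \<Rightarrow> real), ('i set \<times> 'i set) \<times> ('j \<Rightarrow> real)) classifying_point topology" where
  "row_space A B \<equiv> classifying_space (row_category A B)"

lemma topspace_row_space:
  "c \<in> topspace (row_space A B) \<longleftrightarrow>
     (\<exists>n \<sigma> x t. row_chain A B n \<sigma> x \<and> t \<in> standard_simplex n \<and> c = row_point A B n \<sigma> x t)"
proof
  assume "c \<in> topspace (row_space A B)"
  then obtain n y t where "y \<in> topspace (level (nerve (row_category A B)) n)" "t \<in> standard_simplex n"
    and c: "c = glue_class (nerve (row_category A B)) (n, y, t)"
    by (auto simp: classifying_space_def topspace_realization realization_sum_def)
  then show "\<exists>n \<sigma> x t. row_chain A B n \<sigma> x \<and> t \<in> standard_simplex n \<and> c = row_point A B n \<sigma> x t"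
    unfolding row_point_def by (metis nerve_row_category_cases)
next
  assume "\<exists>n \<sigma> x t. row_chain A B n \<sigma> x \<and> t \<in> standard_simplex n \<and> c = row_point A B n \<sigma> x t"
  then show "c \<in> topspace (row_space A B)"
    using chain_simplex_in_nerve
    by (fastforce simp: classifying_space_def topspace_realization realization_sum_def row_point_def)
qed

lemma glue_row_category_cases:
  assumes "glue (nerve (row_category A B)) p p'"
  obtains m \<theta> n \<sigma> x t where "mono_on {..m} \<theta>" "\<theta> \<in> {..m} \<rightarrow> {..n}" "row_chain A B n \<sigma> x"
    "t \<in> standard_simplex m" "p = (m, chain_simplex m (\<sigma> \<circ> \<theta>) x, t)"
    "p' = (n, chain_simplex n \<sigma> x, pushforward \<theta> t)"
  using assms
proof cases
  case (1 m \<theta> n y t)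
  then show thesis
    using nerve_row_category_cases[of y A B n] that operator_chain_simplex by metis
qed

lemma row_point_glue:
  assumes "mono_on {..m} \<theta>" "\<theta> \<in> {..m} \<rightarrow> {..n}" "row_chain A B n \<sigma> x" "t \<in> standard_simplex m"
  shows "row_point A B m (\<sigma> \<circ> \<theta>) x t = row_point A B n \<sigma> x (pushforward \<theta> t)"
  unfolding row_point_def
  using glue_class_eq_glue[OF glue.intros[OF assms(1,2) chain_simplex_in_nerve[OF assms(3)] assms(4)]]
  by (simp add: operator_chain_simplex[OF assms(1,2)])

lemma row_chain_compose:
  assumes "mono_on {..m} \<theta>" "\<theta> \<in> {..m} \<rightarrow> {..n}" "row_chain A B n \<sigma> x"
  shows "row_chain A B m (\<sigma> \<circ> \<theta>) x"
proof -
  have "\<theta> i \<le> n" if "i \<le> m" for i using assms(2) that by auto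
  moreover have "\<theta> i \<le> \<theta> j" if "i \<le> j" "j \<le> m" for i j
    by (rule mono_onD[OF assms(1)]) (use that in auto)
  ultimately show ?thesis
    using assms(3) row_chain_holds[OF assms(3)] unfolding row_chain_def o_apply by (meson le0)
qed

section \<open>Continuous coordinates on the classifying space\<close>

definition col_coord :: "('i set \<times> ('j \<Rightarrow> real), ('i set \<times> 'i set) \<times> ('j \<Rightarrow> real)) classifying_point \<Rightarrow> 'j \<Rightarrow> real" where
  "col_coord = class_lift (\<lambda>(n, y, t). snd (fst y 0))"

text \<open>The affine extension along chains of an arbitrary function \<open>g\<close> on row
  simplices. Indicators give the row coordinates, sums over a simplex give the bounds in the
  compactness argument.\<close>

definition row_sum :: "('i set \<Rightarrow> real) \<Rightarrow> ('i set \<times> ('j \<Rightarrow> real), ('i set \<times> 'i set) \<times> ('j \<Rightarrow> real)) classifying_point \<Rightarrow> real" where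
  "row_sum g = class_lift (\<lambda>(n, y, t). \<Sum>q\<le>n. t q * g (fst (fst y q)))"

lemma col_coord_invariant:
  assumes "glue (nerve (row_category A B)) p p'"
  shows "(case p of (n, y, t) \<Rightarrow> snd (fst y 0)) = (case p' of (n, y, t) \<Rightarrow> snd (fst y 0))"
  using assms by (rule glue_row_category_cases) (auto simp: chain_simplex_def)

lemma row_sum_invariant:
  assumes "glue (nerve (row_category A B)) p p'"
  shows "(case p of (n, y, t) \<Rightarrow> \<Sum>q\<le>n. t q * g (fst (fst y q))) =
    (case p' of (n, y, t) \<Rightarrow> \<Sum>q\<le>n. (t q * g (fst (fst y q)) :: real))"
  using assms
proof (rule glue_row_category_cases)
  fix m n \<theta> \<sigma> x t assume "\<theta> \<in> {..m} \<rightarrow> {..n}" "t \<in> standard_simplex m"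
    "p = (m, chain_simplex m (\<sigma> \<circ> \<theta>) x, t)" "p' = (n, chain_simplex n \<sigma> x, pushforward \<theta> t)"
  then show ?thesis
    using sum_pushforward_simplex[of t m \<theta> n "\<lambda>q. g (\<sigma> q)"] by (simp add: chain_simplex_def)
qed

lemma col_coord_row_point: "col_coord (row_point A B n \<sigma> x t) = x"
  unfolding col_coord_def row_point_def
  by (subst class_lift_glue_class, erule col_coord_invariant) (simp add: chain_simplex_def)

lemma row_sum_row_point: "row_sum g (row_point A B n \<sigma> x t) = (\<Sum>q\<le>n. t q * g (\<sigma> q))"
  unfolding row_sum_def row_point_def
  by (subst class_lift_glue_class, erule row_sum_invariant) (simp add: chain_simplex_def)

text \<open>Each fibre complex is a subcomplex of the middle complex, so its inclusion is continuous
  for the weak topologies.\<close>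

lemma continuous_map_col_coord: "continuous_map (row_space A B) (mid_space A B) col_coord"
  unfolding classifying_space_def col_coord_def
proof (rule continuous_map_class_lift, erule col_coord_invariant)
  fix n
  let ?D = "subtopology (powertop_real UNIV) (standard_simplex n)"
  have "continuous_map (fibre_space A B \<sigma>) (mid_space A B) (\<lambda>x. x)" if "\<sigma> \<in> row_complex A" for \<sigma>
  proof (rule continuous_map_complex)
    fix \<tau> assume "\<tau> \<in> row_complex (B\<lparr>row_set := common_cols A \<sigma>\<rparr>)"
    then have "\<tau> \<in> mid_complex A B"
      using fibre_complex_subset[OF that] by blast
    then show "continuous_map (subtopology (powertop_real UNIV) (closed_simplex \<tau>)) (mid_space A B) (\<lambda>x. x)"
      by (rule continuous_map_closed_simplex[unfolded id_def])
  qed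
  then have "continuous_map (Ob (row_category A B)) (mid_space A B) snd"
    unfolding row_category_def top_category.simps by (intro continuous_map_from_sum) simp
  from continuous_map_compose[OF continuous_map_nerve_object this]
  have "continuous_map (level (nerve (row_category A B)) n) (mid_space A B) (\<lambda>y. snd (fst y 0))"
    by (simp add: o_def)
  from continuous_map_compose[OF continuous_map_fst this]
  show "continuous_map (prod_topology (level (nerve (row_category A B)) n) ?D) (mid_space A B)
     (\<lambda>(y, t). case (n, y, t) of (n, y, t) \<Rightarrow> snd (fst y 0))"
    by (simp add: o_def case_prod_unfold)
qed

text \<open>The function \<open>g\<close> may be arbitrary because it sees only the index of a
  summand of the object space, and the summands are open.\<close>

lemma continuous_map_row_sum: "continuous_map (row_space A B) euclideanreal (row_sum g)"
  unfolding classifying_space_def row_sum_def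
proof (rule continuous_map_class_lift, erule row_sum_invariant)
  fix n
  let ?D = "subtopology (powertop_real UNIV) (standard_simplex n)"
  let ?P = "prod_topology (level (nerve (row_category A B)) n) ?D"
  have "continuous_map (Ob (row_category A B)) euclideanreal (\<lambda>p. g (fst p))"
    unfolding row_category_def top_category.simps by (intro continuous_map_from_sum) simp
  from continuous_map_compose[OF continuous_map_compose[OF continuous_map_fst continuous_map_nerve_object] this]
  have "continuous_map ?P euclideanreal (\<lambda>p. g (fst (fst (fst p) q)))" if "q \<le> n" for q
    using that by (simp add: o_def)
  moreover have "continuous_map ?P euclideanreal (\<lambda>p. snd p q)" for q
  proof -
    have "continuous_map ?D euclideanreal (\<lambda>t. t q)"
      by (intro continuous_map_from_subtopology continuous_map_product_projection) simp
    from continuous_map_compose[OF continuous_map_snd this] show ?thesis by (simp add: o_def)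
  qed
  ultimately have "continuous_map ?P euclideanreal (\<lambda>p. \<Sum>q\<le>n. snd p q * g (fst (fst (fst p) q)))"
    by (intro continuous_map_sum continuous_map_real_mult) auto
  then show "continuous_map ?P euclideanreal
     (\<lambda>(y, t). case (n, y, t) of (n, y, t) \<Rightarrow> \<Sum>q\<le>n. t q * g (fst (fst y q)))"
    by (simp add: case_prod_unfold)
qed

definition row_weight :: "nat \<Rightarrow> (nat \<Rightarrow> 'i set) \<Rightarrow> (nat \<Rightarrow> real) \<Rightarrow> 'i \<Rightarrow> real" where
  "row_weight n \<sigma> t i = (\<Sum>q\<le>n. t q * of_bool (i \<in> \<sigma> q))"

definition row_coord :: "('i set \<times> ('j \<Rightarrow> real), ('i set \<times> 'i set) \<times> ('j \<Rightarrow> real)) classifying_point \<Rightarrow> 'i \<Rightarrow> real" where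
  "row_coord c i = row_sum (\<lambda>\<sigma>. of_bool (i \<in> \<sigma>)) c"

lemma row_coord_row_point: "row_coord (row_point A B n \<sigma> x t) = row_weight n \<sigma> t"
  by (simp add: row_coord_def row_weight_def row_sum_row_point fun_eq_iff)

lemma row_weight_nonneg: "t \<in> standard_simplex n \<Longrightarrow> 0 \<le> row_weight n \<sigma> t i"
  unfolding row_weight_def by (intro sum_nonneg mult_nonneg_nonneg) (auto simp: standard_simplexD)

lemma row_weight_pushforward:
  assumes "t \<in> standard_simplex m" "\<theta> \<in> {..m} \<rightarrow> {..n}"
  shows "row_weight m (\<sigma> \<circ> \<theta>) t = row_weight n \<sigma> (pushforward \<theta> t)"
  using sum_pushforward_simplex[OF assms] by (simp add: row_weight_def fun_eq_iff)

text \<open>A list of rows in the order of increasing weight \<open>z\<close> recovers the chain as its final segments, and the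
  barycentric coordinates as the increments of \<open>z\<close> along the list.\<close>

definition adapted :: "('i, 'j) bin_rel \<Rightarrow> ('j \<Rightarrow> real) \<Rightarrow> ('i \<Rightarrow> real) \<Rightarrow> 'i list \<Rightarrow> bool" where
  "adapted A x z es \<longleftrightarrow> es \<noteq> [] \<and> distinct es \<and> sorted (map z es) \<and> set es \<subseteq> row_set A \<and>
     (\<forall>i. i \<notin> set es \<longrightarrow> z i = 0) \<and> (\<forall>i\<in>set es. \<forall>j\<in>supp x. holds A i j)"

definition flag :: "'i list \<Rightarrow> nat \<Rightarrow> 'i set" where
  "flag es q = set (drop q es)"

definition steps :: "'i list \<Rightarrow> ('i \<Rightarrow> real) \<Rightarrow> nat \<Rightarrow> real" where
  "steps es z q = (if q < length es then z (es ! q) - (if q = 0 then 0 else z (es ! (q - 1))) else 0)"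

lemma nth_mem_flag:
  assumes "distinct es" "b < length es"
  shows "es ! b \<in> flag es q \<longleftrightarrow> q \<le> b"
proof
  assume "es ! b \<in> flag es q"
  then obtain a where "a < length es - q" "es ! b = es ! (q + a)"
    by (auto simp: flag_def in_set_conv_nth)
  then show "q \<le> b"
    using assms by (auto simp: nth_eq_iff_index_eq)
next
  assume "q \<le> b"
  then have "drop q es ! (b - q) = es ! b" "b - q < length (drop q es)"
    using assms by auto
  then show "es ! b \<in> flag es q"
    unfolding flag_def by (metis nth_mem)
qed

lemma flag_subset: "flag es q \<subseteq> set es"
  by (simp add: flag_def set_drop_subset)

lemma row_chain_flag:
  assumes x: "x \<in> topspace (mid_space A B)" and es: "adapted A x z es"
  shows "row_chain A B (length es - 1) (flag es) x"
proof -
  obtain j where j: "j \<in> supp x" "j \<in> col_set A"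
    using mid_spaceD(3,4)[OF x] by blast
  have "flag es q \<in> row_complex A" if "q \<le> length es - 1" for q
  proof -
    have "flag es q \<noteq> {}"
      using that es by (cases es) (auto simp: flag_def adapted_def)
    then show ?thesis
      using flag_subset[of es q] es j by (auto simp: row_complex_def adapted_def flag_def intro!: bexI[of _ j])
  qed
  moreover have "flag es q \<subseteq> flag es p" if "p \<le> q" for p q
    using that by (simp add: flag_def set_drop_subset_set_drop)
  ultimately show ?thesis
    unfolding row_chain_def using es x by (auto simp: adapted_def flag_def)
qed

lemma sum_steps:
  assumes "b < length es"
  shows "(\<Sum>q\<le>b. steps es z q) = z (es ! b)"
  using assms
proof (induction b)
  case 0
  then show ?case by (simp add: steps_def)
next
  case (Suc b)
  then show ?case by (simp add: steps_def)
qed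

text \<open>The entry at position \<open>b\<close> lies in exactly the members of the flag up to
  \<open>b\<close>, so its weight is a telescoping sum of increments.\<close>

lemma row_weight_flag:
  assumes "distinct es" "\<And>i. i \<notin> set es \<Longrightarrow> z i = 0" "es \<noteq> []"
  shows "row_weight (length es - 1) (flag es) (steps es z) = z"
proof
  fix i
  show "row_weight (length es - 1) (flag es) (steps es z) i = z i"
  proof (cases "i \<in> set es")
    case True
    then obtain b where b: "b < length es" "i = es ! b"
      by (auto simp: in_set_conv_nth)
    have "row_weight (length es - 1) (flag es) (steps es z) i
        = (\<Sum>q\<le>length es - 1. steps es z q * of_bool (q \<le> b))"
      by (simp add: row_weight_def b nth_mem_flag[OF assms(1) b(1)])
    also have "\<dots> = (\<Sum>q\<le>b. steps es z q)"
      by (rule sum.mono_neutral_cong_right) (use b in auto)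
    finally show ?thesis
      using sum_steps[OF b(1)] b(2) by simp
  next
    case False
    then show ?thesis
      using flag_subset assms(2) by (fastforce simp: row_weight_def intro!: sum.neutral)
  qed
qed

lemma steps_in_simplex:
  assumes "adapted A x z es" "\<And>i. 0 \<le> z i" "z (last es) = 1"
  shows "steps es z \<in> standard_simplex (length es - 1)"
proof (rule standard_simplexI)
  have es: "es \<noteq> []" "sorted (map z es)"
    using assms(1) by (auto simp: adapted_def)
  show "0 \<le> steps es z q" for q
    using assms(2) sorted_nth_mono[OF es(2), of "q - 1" q] by (auto simp: steps_def)
  show "steps es z q = 0" if "length es - 1 < q" for q
  proof -
    have "\<not> q < length es" using that by linarith
    then show ?thesis by (simp add: steps_def)
  qed
  show "(\<Sum>q\<le>length es - 1. steps es z q) = 1"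
    using sum_steps[of "length es - 1" es z] es(1) assms(3) by (simp add: last_conv_nth)
qed

section \<open>Recovering a point from its coordinates\<close>

lemma row_point_cong:
  "(\<And>q. q \<le> n \<Longrightarrow> \<sigma> q = \<sigma>' q) \<Longrightarrow> row_point A B n \<sigma> x t = row_point A B n \<sigma>' x t"
  unfolding row_point_def using chain_simplex_cong[of n \<sigma> \<sigma>' x] by simp

lemma row_point_positive:
  assumes c: "row_chain A B n \<sigma> x" and t: "t \<in> standard_simplex n"
  obtains m \<sigma>' t' where "row_chain A B m \<sigma>' x" "t' \<in> standard_simplex m" "\<And>q. q \<le> m \<Longrightarrow> 0 < t' q"
    "row_weight m \<sigma>' t' = row_weight n \<sigma> t" "row_point A B m \<sigma>' x t' = row_point A B n \<sigma> x t"
proof -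
  define S where "S = {q. q \<le> n \<and> t q \<noteq> 0}"
  have fin: "finite S" by (simp add: S_def)
  have sumS: "(\<Sum>q\<in>S. t q) = 1"
  proof -
    have "(\<Sum>q\<in>S. t q) = (\<Sum>q\<le>n. t q)"
      by (rule sum.mono_neutral_left) (auto simp: S_def)
    then show ?thesis using standard_simplexD(3)[OF t] by simp
  qed
  then have "S \<noteq> {}" by auto
  then have card: "card S > 0" using fin by (simp add: card_gt_0_iff)
  obtain h where h: "bij_betw h {..<card S} S" "strict_mono_on {..<card S} h"
    using ex_bij_betw_strict_mono_card[OF fin] by blast
  define m where "m = card S - 1"
  have m: "{..<card S} = {..m}" using card by (auto simp: m_def)
  define t' where "t' q = (if q \<le> m then t (h q) else 0)" for q
  have hS: "h q \<in> S" if "q \<le> m" for q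
    using bij_betwE[OF h(1)] that by (auto simp: m)
  have hmap: "h \<in> {..m} \<rightarrow> {..n}" using hS by (auto simp: S_def)
  have hmono: "mono_on {..m} h"
    using strict_mono_on_imp_mono_on[OF h(2)] by (simp add: m)
  have t': "t' \<in> standard_simplex m"
  proof (rule standard_simplexI)
    show "0 \<le> t' i" for i using standard_simplexD(1)[OF t] by (simp add: t'_def)
    show "t' i = 0" if "m < i" for i using that by (simp add: t'_def)
    have "(\<Sum>i\<le>m. t' i) = (\<Sum>i\<in>{..m}. t (h i))" by (simp add: t'_def)
    also have "\<dots> = (\<Sum>q\<in>S. t q)"
      using sum.reindex_bij_betw[OF h(1), of t] by (simp add: m)
    finally show "(\<Sum>i\<le>m. t' i) = 1" using sumS by simp
  qed
  have push: "pushforward h t' = t"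
  proof
    fix p
    have inj: "inj_on h {..m}" using h(1) by (simp add: bij_betw_def m)
    show "pushforward h t' p = t p"
    proof (cases "p \<in> S")
      case True
      then obtain q where q: "q \<le> m" "h q = p"
        using h(1) by (force simp: bij_betw_def m)
      then have "{q'. q' \<le> m \<and> h q' = p} = {q}"
        using inj by (auto simp: inj_on_def)
      then show ?thesis
        using q by (simp add: pushforward_simplex_eq[OF t'] t'_def)
    next
      case False
      then have "{q'. q' \<le> m \<and> h q' = p} = {}" using hS by auto
      moreover have "t p = 0" using False standard_simplexD(2)[OF t] by (force simp: S_def)
      ultimately show ?thesis
        by (simp only: pushforward_simplex_eq[OF t'] sum.empty)
    qed
  qed
  show thesis
  proof (rule that)
    show "row_chain A B m (\<sigma> \<circ> h) x" by (rule row_chain_compose[OF hmono hmap c])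
    show "t' \<in> standard_simplex m" by (rule t')
    show "0 < t' q" if "q \<le> m" for q
      using hS[OF that] that standard_simplexD(1)[OF t] by (auto simp: t'_def S_def less_le)
    show "row_weight m (\<sigma> \<circ> h) t' = row_weight n \<sigma> t"
      using row_weight_pushforward[OF t' hmap] push by simp
    show "row_point A B m (\<sigma> \<circ> h) x t' = row_point A B n \<sigma> x t"
      using row_point_glue[OF hmono hmap c t'] push by simp
  qed
qed

text \<open>A chain with positive weights consists of superlevel sets of the row weight, hence of
  terms of the flag of any adapted list.\<close>

lemma chain_superlevel:
  assumes c: "row_chain A B n \<sigma> x" and t: "t \<in> standard_simplex n" "\<And>q. q \<le> n \<Longrightarrow> 0 < t q"
    and q: "q \<le> n" "i \<in> \<sigma> q" and le: "row_weight n \<sigma> t i \<le> row_weight n \<sigma> t i'"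
  shows "i' \<in> \<sigma> q"
proof (rule ccontr)
  assume i': "i' \<notin> \<sigma> q"
  have sub: "\<sigma> b \<subseteq> \<sigma> a" if "a \<le> b" "b \<le> n" for a b
    using c that unfolding row_chain_def by blast
  have "row_weight n \<sigma> t i' < row_weight n \<sigma> t i"
    unfolding row_weight_def
  proof (rule sum_strict_mono_ex1)
    have "of_bool (i' \<in> \<sigma> p) \<le> (of_bool (i \<in> \<sigma> p) :: real)" if "p \<le> n" for p
      using sub[of p q] sub[of q p] that i' q by (cases "p \<le> q") auto
    then show "\<forall>p\<in>{..n}. t p * of_bool (i' \<in> \<sigma> p) \<le> t p * of_bool (i \<in> \<sigma> p)"
      using standard_simplexD(1)[OF t(1)] by (auto intro: mult_left_mono)
    show "\<exists>p\<in>{..n}. t p * of_bool (i' \<in> \<sigma> p) < t p * of_bool (i \<in> \<sigma> p)"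
      using q i' t(2)[OF q(1)] by (intro bexI[of _ q]) auto
  qed simp
  with le show False by simp
qed

text \<open>The class depends only on \<open>x\<close> and the row weights. Once zero weights are
  dropped, each member is a superlevel set, hence a final segment of any list sorted by weight. So
  the chain is the flag reindexed by a monotone map, and gluing along that map turns the weights
  into increments. Ties, and rows of weight 0 in the list, are allowed.\<close>

lemma row_point_eq_flag:
  assumes c: "row_chain A B n \<sigma> x" and t: "t \<in> standard_simplex n"
    and es: "adapted A x (row_weight n \<sigma> t) es"
  shows "row_point A B n \<sigma> x t = row_point A B (length es - 1) (flag es) x (steps es (row_weight n \<sigma> t))"
proof -
  obtain m \<sigma>' t' where c': "row_chain A B m \<sigma>' x" and t': "t' \<in> standard_simplex m" "\<And>q. q \<le> m \<Longrightarrow> 0 < t' q"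
    and w: "row_weight m \<sigma>' t' = row_weight n \<sigma> t" and p: "row_point A B m \<sigma>' x t' = row_point A B n \<sigma> x t"
    using row_point_positive[OF c t] by metis
  let ?z = "row_weight n \<sigma> t"
  let ?N = "length es"
  have es': "es \<noteq> []" "distinct es" "sorted (map ?z es)" "\<And>i. i \<notin> set es \<Longrightarrow> ?z i = 0"
    using es by (auto simp: adapted_def)
  have x: "x \<in> topspace (mid_space A B)"
    using c unfolding row_chain_def by blast
  have sub: "\<sigma>' b \<subseteq> \<sigma>' a" if "a \<le> b" "b \<le> m" for a b
    using c' that unfolding row_chain_def by blast
  have in_es: "i \<in> set es" if "i \<in> \<sigma>' q" "q \<le> m" for i q
  proof (rule ccontr)
    assume "i \<notin> set es"
    then have "?z i = 0" by (rule es')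
    moreover have "t' q * of_bool (i \<in> \<sigma>' q) \<le> row_weight m \<sigma>' t' i"
      unfolding row_weight_def using that standard_simplexD(1)[OF t'(1)]
      by (intro member_le_sum) auto
    ultimately show False
      using that t'(2)[OF that(2)] by (simp add: w)
  qed
  \<comment> \<open>The position where the final segment equal to \<open>\<sigma>' q\<close>
    begins.\<close>
  define \<theta> where "\<theta> q = (LEAST a. a < ?N \<and> es ! a \<in> \<sigma>' q)" for q
  have ex: "\<exists>a. a < ?N \<and> es ! a \<in> \<sigma>' q" if "q \<le> m" for q
  proof -
    have "\<sigma>' q \<noteq> {}"
      using c' that by (auto simp: row_chain_def row_complex_def)
    then show ?thesis
      using in_es[OF _ that] by (metis in_set_conv_nth ex_in_conv)
  qed
  have \<theta>: "\<theta> q < ?N \<and> es ! \<theta> q \<in> \<sigma>' q" if "q \<le> m" for q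
    unfolding \<theta>_def by (rule LeastI_ex[OF ex[OF that]])
  have mem: "es ! b \<in> \<sigma>' q \<longleftrightarrow> \<theta> q \<le> b" if "q \<le> m" "b < ?N" for q b
  proof
    assume "es ! b \<in> \<sigma>' q"
    then show "\<theta> q \<le> b"
      unfolding \<theta>_def using that by (intro Least_le) auto
  next
    assume "\<theta> q \<le> b"
    then have "row_weight m \<sigma>' t' (es ! \<theta> q) \<le> row_weight m \<sigma>' t' (es ! b)"
      using sorted_nth_mono[OF es'(3), of "\<theta> q" b] that by (simp add: w)
    then show "es ! b \<in> \<sigma>' q"
      using chain_superlevel[OF c' t' that(1)] \<theta>[OF that(1)] by blast
  qed
  have flag: "flag es (\<theta> q) = \<sigma>' q" if "q \<le> m" for q
  proof -
    have "i \<in> flag es (\<theta> q) \<longleftrightarrow> i \<in> \<sigma>' q" for i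
    proof (cases "i \<in> set es")
      case True
      then obtain b where b: "b < ?N" "i = es ! b"
        by (auto simp: in_set_conv_nth)
      then show ?thesis
        using mem[OF that b(1)] nth_mem_flag[OF es'(2) b(1)] by simp
    next
      case False
      then show ?thesis
        using flag_subset in_es[OF _ that] by fast
    qed
    then show ?thesis by blast
  qed
  have \<theta>map: "\<theta> \<in> {..m} \<rightarrow> {..?N - 1}"
  proof (rule Pi_I)
    fix q assume "q \<in> {..m}"
    then have "\<theta> q < ?N" using \<theta> by blast
    then show "\<theta> q \<in> {..?N - 1}" by (simp add: le_diff_conv2 Suc_le_eq)
  qed
  have \<theta>mono: "mono_on {..m} \<theta>"
  proof (rule mono_onI)
    fix a b assume "a \<in> {..m}" "b \<in> {..m}" "a \<le> b"
    then show "\<theta> a \<le> \<theta> b"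
      using sub[of a b] mem[of a "\<theta> b"] \<theta>[of b] by auto
  qed
  have push: "pushforward \<theta> t' = steps es ?z"
  proof
    fix p
    show "pushforward \<theta> t' p = steps es ?z p"
    proof (cases "p < ?N")
      case True
      \<comment> \<open>\<open>es ! b\<close> lies in the members whose segment begins at or before
        \<open>b\<close>, so the increment of the weights at \<open>p\<close> is the total weight of
        the members beginning exactly at \<open>p\<close>.\<close>
      have z: "?z (es ! b) = (\<Sum>q\<le>m. t' q * of_bool (\<theta> q \<le> b))" if "b < ?N" for b
        unfolding w[symmetric] row_weight_def using mem that by simp
      have "pushforward \<theta> t' p = (\<Sum>q\<le>m. t' q * of_bool (\<theta> q = p))"
        unfolding pushforward_simplex_eq[OF t'(1)] by (rule sum.mono_neutral_cong_left) auto
      also have "\<dots> = steps es ?z p"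
      proof (cases p)
        case 0
        then show ?thesis using z[OF True] True by (simp add: steps_def)
      next
        case (Suc p')
        then have "steps es ?z p = (\<Sum>q\<le>m. t' q * of_bool (\<theta> q \<le> p) - t' q * of_bool (\<theta> q \<le> p'))"
          using True z[OF True] z[of p'] by (simp add: steps_def sum_subtractf)
        also have "\<dots> = (\<Sum>q\<le>m. t' q * of_bool (\<theta> q = p))"
          by (rule sum.cong) (auto simp: Suc of_bool_def)
        finally show ?thesis by simp
      qed
      finally show ?thesis .
    next
      case False
      then have "{q. q \<le> m \<and> \<theta> q = p} = {}" using \<theta> by auto
      then show ?thesis
        using False by (simp only: pushforward_simplex_eq[OF t'(1)] sum.empty steps_def if_False)
    qed
  qed
  have "row_point A B m \<sigma>' x t' = row_point A B m (flag es \<circ> \<theta>) x t'"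
    by (rule row_point_cong) (simp add: flag)
  also have "\<dots> = row_point A B (?N - 1) (flag es) x (steps es ?z)"
    using row_point_glue[OF \<theta>mono \<theta>map row_chain_flag[OF x es] t'(1)] push by simp
  finally show ?thesis using p by simp
qed

lemma ex_adapted:
  assumes "finite {i. z i \<noteq> 0}" "{i. z i \<noteq> 0} \<noteq> {}" "{i. z i \<noteq> 0} \<subseteq> row_set A"
    "\<And>i j. z i \<noteq> 0 \<Longrightarrow> j \<in> supp x \<Longrightarrow> holds A i j"
  obtains es where "adapted A x z es" "set es = {i. z i \<noteq> 0}"
proof -
  obtain xs where xs: "set xs = {i. z i \<noteq> 0}" "distinct xs"
    using finite_distinct_list[OF assms(1)] by blast
  have "adapted A x z (sort_key z xs)"
    unfolding adapted_def
  proof (intro conjI)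
    have "set (sort_key z xs) \<noteq> {}" using xs assms(2) by simp
    then show "sort_key z xs \<noteq> []" by (metis set_empty)
  qed (use assms xs in auto)
  then show thesis
    by (rule that) (simp add: xs)
qed

text \<open>Meaningful only if an adapted list exists; the result does not depend on its choice.\<close>

definition row_assemble :: "('i, 'j) bin_rel \<Rightarrow> ('j, 'k) bin_rel \<Rightarrow> ('j \<Rightarrow> real) \<Rightarrow> ('i \<Rightarrow> real) \<Rightarrow>
    ('i set \<times> ('j \<Rightarrow> real), ('i set \<times> 'i set) \<times> ('j \<Rightarrow> real)) classifying_point" where
  "row_assemble A B x z = (let es = (SOME es. adapted A x z es) in
     row_point A B (length es - 1) (flag es) x (steps es z))"

lemma row_weight_support:
  assumes c: "row_chain A B n \<sigma> x" and t: "t \<in> standard_simplex n"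
  shows "{i. row_weight n \<sigma> t i \<noteq> 0} \<subseteq> \<sigma> 0" "{i. row_weight n \<sigma> t i \<noteq> 0} \<noteq> {}" "finite (\<sigma> 0)"
    "\<sigma> 0 \<subseteq> row_set A"
proof -
  have sub: "\<sigma> q \<subseteq> \<sigma> 0" "\<sigma> q \<in> row_complex A" if "q \<le> n" for q
    using c that unfolding row_chain_def by auto
  show "{i. row_weight n \<sigma> t i \<noteq> 0} \<subseteq> \<sigma> 0"
  proof (rule subsetI, rule ccontr)
    fix i assume "i \<in> {i. row_weight n \<sigma> t i \<noteq> 0}" "i \<notin> \<sigma> 0"
    then show False
      using sub(1) by (auto simp: row_weight_def intro!: sum.neutral)
  qed
  show "finite (\<sigma> 0)" "\<sigma> 0 \<subseteq> row_set A"
    using sub(2)[of 0] by (auto simp: row_complex_def)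
  obtain i where "i \<in> \<sigma> n"
    using sub(2)[of n] by (auto simp: row_complex_def)
  moreover have "\<sigma> n \<subseteq> \<sigma> q" if "q \<le> n" for q
    using c that unfolding row_chain_def by auto
  ultimately have "row_weight n \<sigma> t i = (\<Sum>q\<le>n. t q)"
    unfolding row_weight_def by (intro sum.cong) auto
  then have "row_weight n \<sigma> t i \<noteq> 0"
    using standard_simplexD(3)[OF t] by simp
  then show "{i. row_weight n \<sigma> t i \<noteq> 0} \<noteq> {}" by blast
qed

text \<open>Whichever adapted list the choice operator returns, its flag represents the given
  point.\<close>

lemma row_assemble_row_weight:
  assumes c: "row_chain A B n \<sigma> x" and t: "t \<in> standard_simplex n"
  shows "row_assemble A B x (row_weight n \<sigma> t) = row_point A B n \<sigma> x t"
proof -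
  note s = row_weight_support[OF assms]
  have "\<exists>es. adapted A x (row_weight n \<sigma> t) es"
    by (rule ex_adapted[of "row_weight n \<sigma> t" A x])
      (use s finite_subset[OF s(1,3)] c in \<open>auto simp: row_chain_def\<close>)
  then have "adapted A x (row_weight n \<sigma> t) (SOME es. adapted A x (row_weight n \<sigma> t) es)"
    by (rule someI_ex)
  from row_point_eq_flag[OF assms this] show ?thesis
    by (simp add: row_assemble_def Let_def)
qed

text \<open>Points are thus determined by their coordinates; this identifies the constructed lift
  with \<open>u\<close> on the boundary.\<close>

lemma row_assemble_coords:
  assumes "c \<in> topspace (row_space A B)"
  shows "row_assemble A B (col_coord c) (row_coord c) = c"
  using assms unfolding topspace_row_space
  by (auto simp: col_coord_row_point row_coord_row_point row_assemble_row_weight)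

lemma row_assemble_adapted:
  assumes x: "x \<in> topspace (mid_space A B)" and es: "adapted A x z es" and z: "\<And>i. 0 \<le> z i" "z (last es) = 1"
  shows "row_assemble A B x z = row_point A B (length es - 1) (flag es) x (steps es z)"
    "row_chain A B (length es - 1) (flag es) x" "steps es z \<in> standard_simplex (length es - 1)"
proof -
  show 1: "row_chain A B (length es - 1) (flag es) x" "steps es z \<in> standard_simplex (length es - 1)"
    using row_chain_flag[OF x es] steps_in_simplex[OF es z] .
  have "row_weight (length es - 1) (flag es) (steps es z) = z"
    using es by (intro row_weight_flag) (auto simp: adapted_def)
  then show "row_assemble A B x z = row_point A B (length es - 1) (flag es) x (steps es z)"
    using row_assemble_row_weight[OF 1] by simp
qed

section \<open>Continuity by pasting finitely many closed pieces\<close>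

lemma closedin_Collect_le:
  fixes f g :: "'a \<Rightarrow> real"
  assumes "continuous_map X euclideanreal f" "continuous_map X euclideanreal g"
  shows "closedin X {p \<in> topspace X. f p \<le> g p}"
proof -
  have "closedin X {p \<in> topspace X. f p - g p \<in> {..0}}"
    by (intro closedin_continuous_map_preimage[where Y = euclideanreal] continuous_map_diff assms) simp
  then show ?thesis by simp
qed

lemma closedin_Collect_eq0:
  fixes f :: "'a \<Rightarrow> real"
  assumes "continuous_map X euclideanreal f"
  shows "closedin X {p \<in> topspace X. f p = 0}"
proof -
  have "closedin X {p \<in> topspace X. f p \<in> {0}}"
    by (intro closedin_continuous_map_preimage[where Y = euclideanreal] assms) simp
  then show ?thesis by simp
qed

lemma closedin_Collect_all:
  assumes "\<And>a. closedin X {p \<in> topspace X. P a p}"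
  shows "closedin X {p \<in> topspace X. \<forall>a. P a p}"
proof -
  have "{p \<in> topspace X. \<forall>a. P a p} = (\<Inter>a. {p \<in> topspace X. P a p})" by auto
  then show ?thesis using assms by (auto intro!: closedin_Inter)
qed

lemma closedin_Collect_imp:
  assumes "C \<Longrightarrow> closedin X {p \<in> topspace X. P p}"
  shows "closedin X {p \<in> topspace X. C \<longrightarrow> P p}"
  using assms by (cases C) auto

lemma closedin_Collect_conj:
  assumes "closedin X {p \<in> topspace X. P p}" "closedin X {p \<in> topspace X. Q p}"
  shows "closedin X {p \<in> topspace X. P p \<and> Q p}"
proof -
  have "{p \<in> topspace X. P p \<and> Q p} = {p \<in> topspace X. P p} \<inter> {p \<in> topspace X. Q p}" by auto
  then show ?thesis using assms by auto
qed

lemma continuous_map_into_closed_simplex: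
  assumes "\<And>j. continuous_map X euclideanreal (\<lambda>p. y p j)" "\<And>p. p \<in> topspace X \<Longrightarrow> y p \<in> closed_simplex \<tau>"
  shows "continuous_map X (subtopology (powertop_real UNIV) (closed_simplex \<tau>)) y"
  by (rule continuous_map_into_subtopology) (use assms in \<open>auto simp: continuous_map_componentwise_UNIV\<close>)

text \<open>On finitely many vertices the weak topology is glued from finitely many closed simplices, so that
  continuity can be checked on coordinates.\<close>

lemma continuous_map_into_complex:
  assumes y: "\<And>j. continuous_map X euclideanreal (\<lambda>p. y p j)"
    and K: "\<And>p. p \<in> topspace X \<Longrightarrow> supp (y p) \<in> K \<and> y p \<in> closed_simplex (supp (y p)) \<and> supp (y p) \<subseteq> J"
    and fin: "finite J"
  shows "continuous_map X (complex_realization K) y"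
proof (rule pasting_lemma_closed[where I = "{\<tau> \<in> K. \<tau> \<subseteq> J}" and T = "\<lambda>\<tau>. {p \<in> topspace X. \<forall>j. j \<notin> \<tau> \<longrightarrow> y p j = 0}" and f = "\<lambda>_. y"])
  show "finite {\<tau> \<in> K. \<tau> \<subseteq> J}"
    using fin by (auto intro: finite_subset[of _ "Pow J"])
  fix \<tau>
  show "closedin X {p \<in> topspace X. \<forall>j. j \<notin> \<tau> \<longrightarrow> y p j = 0}"
    by (intro closedin_Collect_all closedin_Collect_imp closedin_Collect_eq0 y)
  assume \<tau>: "\<tau> \<in> {\<tau> \<in> K. \<tau> \<subseteq> J}"
  then have "finite \<tau>" using fin finite_subset by blast
  let ?X = "subtopology X {p \<in> topspace X. \<forall>j. j \<notin> \<tau> \<longrightarrow> y p j = 0}"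
  have "continuous_map ?X (subtopology (powertop_real UNIV) (closed_simplex \<tau>)) y"
  proof (rule continuous_map_into_closed_simplex)
    show "continuous_map ?X euclideanreal (\<lambda>p. y p j)" for j
      by (rule continuous_map_from_subtopology[OF y])
    fix p assume p: "p \<in> topspace ?X"
    then have "supp (y p) \<subseteq> \<tau>" by (auto simp: supp_def)
    then show "y p \<in> closed_simplex \<tau>"
      using closed_simplex_mono[OF \<open>finite \<tau>\<close>] K[of p] p by auto
  qed
  from continuous_map_compose[OF this continuous_map_closed_simplex[of \<tau> K]] \<tau>
  show "continuous_map ?X (complex_realization K) y" by simp
next
  fix p assume "p \<in> topspace X"
  then show "\<exists>\<tau>. \<tau> \<in> {\<tau> \<in> K. \<tau> \<subseteq> J} \<and> p \<in> {p \<in> topspace X. \<forall>j. j \<notin> \<tau> \<longrightarrow> y p j = 0} \<and> y p = y p"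
    using K[of p] by (intro exI[of _ "supp (y p)"]) (auto simp: supp_def)
qed auto

lemma continuous_map_complex_coord: "continuous_map (complex_realization K) euclideanreal (\<lambda>x. x j)"
  by (intro continuous_map_complex continuous_map_from_subtopology continuous_map_product_projection) simp

lemma mid_complex_fibre:
  assumes "\<tau> \<in> mid_complex A B" "\<And>i j. i \<in> \<sigma> \<Longrightarrow> j \<in> \<tau> \<Longrightarrow> holds A i j"
  shows "\<tau> \<in> row_complex (B\<lparr>row_set := common_cols A \<sigma>\<rparr>)"
  using assms by (auto simp: mid_complex_def row_complex_def common_cols_def)

text \<open>With the chain fixed, only the point and the weights vary. All \<open>y p\<close> lie in
  one closed simplex \<open>\<tau>\<close> that belongs to every fibre along the chain, so
  continuity into the fibres, and from there into the nerve, reduces to continuity into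
  \<open>\<tau>\<close>.\<close>

lemma continuous_map_flag_point:
  assumes y: "continuous_map X (subtopology (powertop_real UNIV) (closed_simplex \<tau>)) y"
    and \<tau>: "\<tau> \<in> mid_complex A B" "\<And>i j. i \<in> \<sigma> 0 \<Longrightarrow> j \<in> \<tau> \<Longrightarrow> holds A i j"
    and c: "\<And>p. p \<in> topspace X \<Longrightarrow> row_chain A B n \<sigma> (y p)"
    and t: "\<And>q. continuous_map X euclideanreal (\<lambda>p. t p q)" "\<And>p. p \<in> topspace X \<Longrightarrow> t p \<in> standard_simplex n"
  shows "continuous_map X (row_space A B) (\<lambda>p. row_point A B n \<sigma> (y p) (t p))"
\<comment> \<open>The properties of the chain are available only at a point of \<open>X\<close>, so
  an empty \<open>X\<close> is split off.\<close>
proof (cases "topspace X = {}")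
  case True
  then show ?thesis by (simp add: continuous_map_def)
next
  case False
  then obtain p0 where "p0 \<in> topspace X" by blast
  then have \<sigma>: "\<And>q. q \<le> n \<Longrightarrow> \<sigma> q \<in> row_complex A" "\<And>p q. p \<le> q \<Longrightarrow> q \<le> n \<Longrightarrow> \<sigma> q \<subseteq> \<sigma> p"
    using c unfolding row_chain_def by blast+
  have fibre: "continuous_map X (fibre_space A B (\<sigma> q)) y" if "q \<le> n" for q
  proof -
    have "\<tau> \<in> row_complex (B\<lparr>row_set := common_cols A (\<sigma> q)\<rparr>)"
      using \<tau> \<sigma>(2)[of 0 q] that by (intro mid_complex_fibre) auto
    from continuous_map_compose[OF y continuous_map_closed_simplex[OF this]] show ?thesis by simp
  qed
  have "continuous_map X (level (nerve (row_category A B)) n) (\<lambda>p. chain_simplex n \<sigma> (y p))"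
    unfolding chain_simplex_def
  proof (rule continuous_map_into_nerve)
    fix q assume q: "q \<le> n"
    have "continuous_map (fibre_space A B (\<sigma> q)) (Ob (row_category A B)) (\<lambda>x. (\<sigma> q, x))"
      unfolding row_category_def top_category.simps
      using continuous_map_component_injection[of "\<sigma> q" "row_complex A" "fibre_space A B"] \<sigma>(1)[OF q] by simp
    from continuous_map_compose[OF fibre[OF q] this] q
    show "continuous_map X (Ob (row_category A B)) (\<lambda>p. (\<lambda>q\<in>{..n}. (\<sigma> q, y p)) q)"
      by (simp add: o_def)
  next
    fix q r assume qr: "q \<le> r" "r \<le> n"
    then have q: "q \<le> n" by simp
    have "continuous_map (fibre_space A B (\<sigma> q)) (Mor (row_category A B)) (\<lambda>x. ((\<sigma> q, \<sigma> r), x))"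
      unfolding row_category_def top_category.simps
      using continuous_map_component_injection[of "(\<sigma> q, \<sigma> r)"
          "{(\<sigma>0, \<sigma>1). \<sigma>0 \<in> row_complex A \<and> \<sigma>1 \<in> row_complex A \<and> \<sigma>1 \<subseteq> \<sigma>0}" "\<lambda>(\<sigma>0, \<sigma>1). fibre_space A B \<sigma>0"]
        \<sigma>(1)[OF q] \<sigma>(1)[OF qr(2)] \<sigma>(2)[OF qr] by simp
    from continuous_map_compose[OF fibre[OF q] this] qr
    show "continuous_map X (Mor (row_category A B)) (\<lambda>p. (\<lambda>(q, r)\<in>poset_arrows n. ((\<sigma> q, \<sigma> r), y p)) (q, r))"
      by (simp add: o_def)
  qed (use chain_simplex_in_nerve[OF c] in \<open>simp add: chain_simplex_def\<close>)
  moreover have "continuous_map X (subtopology (powertop_real UNIV) (standard_simplex n)) t"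
    by (rule continuous_map_into_subtopology) (use t in \<open>auto simp: continuous_map_componentwise_UNIV\<close>)
  ultimately have "continuous_map X (prod_topology (level (nerve (row_category A B)) n)
      (subtopology (powertop_real UNIV) (standard_simplex n))) (\<lambda>p. (chain_simplex n \<sigma> (y p), t p))"
    by (rule continuous_map_pairedI)
  from continuous_map_compose[OF this continuous_map_component_injection[of n UNIV
    "\<lambda>n. prod_topology (level (nerve (row_category A B)) n) (subtopology (powertop_real UNIV) (standard_simplex n))"]]
  have "continuous_map X (realization_sum (nerve (row_category A B))) (\<lambda>p. (n, chain_simplex n \<sigma> (y p), t p))"
    by (simp add: realization_sum_def o_def)
  from continuous_map_compose[OF this continuous_map_glue_class]
  show ?thesis
    by (simp add: o_def row_point_def classifying_space_def)
qed

text \<open>An ordering \<open>es\<close> of rows and a simplex \<open>\<tau>\<close> of columns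
  single out the closed set where the weights increase along \<open>es\<close> and the support lies
  in \<open>\<tau>\<close>; there the chain is the flag of \<open>es\<close>. Finiteness of
  \<open>I\<close> and \<open>J\<close> leaves finitely many such sets, and they agree on overlaps
  because \<open>row_assemble\<close> is one function.\<close>

lemma continuous_map_row_assemble:
  assumes fin: "finite I" "finite J" and I: "I \<subseteq> row_set A"
    and cy: "\<And>j. continuous_map X euclideanreal (\<lambda>p. y p j)"
    and cz: "\<And>i. continuous_map X euclideanreal (\<lambda>p. z p i)"
    and y: "\<And>p. p \<in> topspace X \<Longrightarrow> y p \<in> topspace (mid_space A B) \<and> supp (y p) \<subseteq> J"
    and z: "\<And>p i. p \<in> topspace X \<Longrightarrow> 0 \<le> z p i \<and> z p i \<le> 1"
      "\<And>p. p \<in> topspace X \<Longrightarrow> supp (z p) \<subseteq> I" "\<And>p. p \<in> topspace X \<Longrightarrow> \<exists>i. z p i = 1"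
    and h: "\<And>p i j. p \<in> topspace X \<Longrightarrow> i \<in> supp (z p) \<Longrightarrow> j \<in> supp (y p) \<Longrightarrow> holds A i j"
  shows "continuous_map X (row_space A B) (\<lambda>p. row_assemble A B (y p) (z p))"
proof -
  define E where "E = {(es, \<tau>). set es \<subseteq> I \<and> distinct es \<and> es \<noteq> [] \<and> \<tau> \<subseteq> J \<and> \<tau> \<in> mid_complex A B \<and>
    (\<forall>i\<in>set es. \<forall>j\<in>\<tau>. holds A i j)}"
  define T where "T = (\<lambda>(es, \<tau>). {p \<in> topspace X.
    (\<forall>a b. a \<le> b \<and> b < length es \<longrightarrow> z p (es ! a) \<le> z p (es ! b)) \<and>
    (\<forall>i. i \<notin> set es \<longrightarrow> z p i = 0) \<and> (\<forall>j. j \<notin> \<tau> \<longrightarrow> y p j = 0)})"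
  have "E \<subseteq> {es. set es \<subseteq> I \<and> distinct es} \<times> Pow J"
    by (auto simp: E_def)
  then have finE: "finite E"
    by (rule finite_subset) (simp add: finite_subset_distinct fin)
  show ?thesis
  proof (rule pasting_lemma_closed[OF finE, where T = T and f = "\<lambda>_ p. row_assemble A B (y p) (z p)"])
    fix e assume "e \<in> E"
    then obtain es \<tau> where e: "e = (es, \<tau>)" and es: "set es \<subseteq> I" "distinct es" "es \<noteq> []" and \<tau>: "\<tau> \<subseteq> J" "\<tau> \<in> mid_complex A B"
      and hol: "\<forall>i\<in>set es. \<forall>j\<in>\<tau>. holds A i j"
      by (auto simp: E_def)
    have fin\<tau>: "finite \<tau>" using \<tau>(1) fin finite_subset by blast
    show "closedin X (T e)"
      unfolding T_def e prod.case
      by (intro closedin_Collect_conj closedin_Collect_all closedin_Collect_imp closedin_Collect_eq0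
          closedin_Collect_le cy cz)
    let ?X = "subtopology X (T e)"
    have T: "p \<in> topspace X" "supp (y p) \<subseteq> \<tau>" "adapted A (y p) (z p) es" "z p (last es) = 1"
      if "p \<in> topspace ?X" for p
    proof -
      show p: "p \<in> topspace X" using that by simp
      have m: "\<And>a b. a \<le> b \<Longrightarrow> b < length es \<Longrightarrow> z p (es ! a) \<le> z p (es ! b)"
        "\<And>i. i \<notin> set es \<Longrightarrow> z p i = 0"
        using that by (auto simp: T_def e)
      show s: "supp (y p) \<subseteq> \<tau>"
        using that by (auto simp: T_def e supp_def)
      have "sorted (map (z p) es)"
        unfolding sorted_iff_nth_mono using m(1) by simp
      then show "adapted A (y p) (z p) es"
        unfolding adapted_def using m(2) es s hol I by blast
      \<comment> \<open>The largest weight sits at the end of the list, and it is 1 because some row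
        has weight 1 and none has more.\<close>
      obtain i where i: "z p i = 1" using z(3)[OF p] by blast
      then have "i \<in> set es" using m(2)[of i] by fastforce
      then obtain a where "a < length es" "i = es ! a" by (auto simp: in_set_conv_nth)
      then have "1 \<le> z p (last es)"
        using m(1)[of a "length es - 1"] i es(3) by (simp add: last_conv_nth)
      then show "z p (last es) = 1" using z(1)[OF p, of "last es"] by simp
    qed
    have cont: "continuous_map ?X (row_space A B)
        (\<lambda>p. row_point A B (length es - 1) (flag es) (y p) (steps es (z p)))"
    proof (rule continuous_map_flag_point)
      show "continuous_map ?X (subtopology (powertop_real UNIV) (closed_simplex \<tau>)) y"
      proof (rule continuous_map_into_closed_simplex)
        show "continuous_map ?X euclideanreal (\<lambda>p. y p j)" for j
          by (rule continuous_map_from_subtopology[OF cy])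
        fix p assume p: "p \<in> topspace ?X"
        then show "y p \<in> closed_simplex \<tau>"
          using y[OF T(1)[OF p]] closed_simplex_mono[OF fin\<tau> T(2)[OF p]] unfolding in_mid_space by blast
      qed
      show "\<tau> \<in> mid_complex A B" by (rule \<tau>)
      show "holds A i j" if "i \<in> flag es 0" "j \<in> \<tau>" for i j
        using hol subsetD[OF flag_subset that(1)] that(2) by simp
      show "continuous_map ?X euclideanreal (\<lambda>p. steps es (z p) q)" for q
        unfolding steps_def
        by (cases "q < length es"; cases "q = 0")
          (auto intro!: continuous_map_from_subtopology[OF cz] continuous_map_diff)
      fix p assume p: "p \<in> topspace ?X"
      note a = row_assemble_adapted(2,3)[OF _ T(3)[OF p] _ T(4)[OF p]]
      show "row_chain A B (length es - 1) (flag es) (y p)"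
        by (rule a) (use y[OF T(1)[OF p]] z(1)[OF T(1)[OF p]] in blast)+
      show "steps es (z p) \<in> standard_simplex (length es - 1)"
        by (rule a) (use y[OF T(1)[OF p]] z(1)[OF T(1)[OF p]] in blast)+
    qed
    show "continuous_map ?X (row_space A B) (\<lambda>p. row_assemble A B (y p) (z p))"
    proof (rule continuous_map_eq[OF cont])
      fix p assume p: "p \<in> topspace ?X"
      show "row_point A B (length es - 1) (flag es) (y p) (steps es (z p)) = row_assemble A B (y p) (z p)"
        using row_assemble_adapted(1)[of _ A B, OF conjunct1[OF y[OF T(1)[OF p]]] T(3)[OF p] _ T(4)[OF p]]
          z(1)[OF T(1)[OF p]] by simp
    qed
  next
    fix p assume p: "p \<in> topspace X"
    have yp: "supp (y p) \<in> mid_complex A B" "supp (y p) \<subseteq> J"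
      using y[OF p] mid_spaceD(6) by blast+
    have zp: "{i. z p i \<noteq> 0} \<subseteq> I" using z(2)[OF p] by (simp add: supp_def)
    obtain es where es: "adapted A (y p) (z p) es" "set es = {i. z p i \<noteq> 0}"
    proof (rule ex_adapted[of "z p" A "y p"])
      show "finite {i. z p i \<noteq> 0}" using zp fin finite_subset by blast
      show "{i. z p i \<noteq> 0} \<noteq> {}" using z(3)[OF p] by force
      show "{i. z p i \<noteq> 0} \<subseteq> row_set A" using zp I by blast
      show "holds A i j" if "z p i \<noteq> 0" "j \<in> supp (y p)" for i j
        using h[OF p _ that(2)] that(1) by (simp add: supp_def)
    qed blast
    have "(es, supp (y p)) \<in> E"
    proof -
      have "set es \<subseteq> I" using zp es(2) by simp
      then show ?thesis
        using es(1) yp unfolding E_def adapted_def by blast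
    qed
    moreover have "p \<in> T (es, supp (y p))"
    proof -
      have "z p (es ! a) \<le> z p (es ! b)" if "a \<le> b" "b < length es" for a b
        using es(1) that sorted_nth_mono[of "map (z p) es" a b] by (simp add: adapted_def)
      moreover have "z p i = 0" if "i \<notin> set es" for i
        using that by (simp add: es(2))
      ultimately show ?thesis
        using p unfolding T_def by (simp add: supp_def)
    qed
    ultimately show "\<exists>e. e \<in> E \<and> p \<in> T e \<and> row_assemble A B (y p) (z p) = row_assemble A B (y p) (z p)"
      by blast
  qed auto
qed

section \<open>Compactness\<close>

text \<open>If infinitely many \<open>v\<close> occurred, weights \<open>c v\<close> growing fast enough would violate the bound.\<close>

lemma finite_support_bounded:
  fixes f :: "'p \<Rightarrow> 'v \<Rightarrow> real"
  assumes nonneg: "\<And>p v. p \<in> C \<Longrightarrow> 0 \<le> f p v"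
    and bdd: "\<And>c. (\<And>v. 0 \<le> c v) \<Longrightarrow> \<exists>M. \<forall>p\<in>C. \<forall>v. c v * f p v \<le> M"
  shows "finite (\<Union>p\<in>C. supp (f p))"
proof (rule ccontr)
  assume "infinite (\<Union>p\<in>C. supp (f p))"
  then obtain e :: "nat \<Rightarrow> 'v" where e: "inj e" "range e \<subseteq> (\<Union>p\<in>C. supp (f p))"
    using infinite_countable_subset by blast
  then have "\<forall>m. \<exists>p\<in>C. f p (e m) \<noteq> 0"
    by (auto simp: supp_def subset_iff)
  then obtain p where p: "\<And>m. p m \<in> C" "\<And>m. f (p m) (e m) \<noteq> 0" by metis
  define c where "c v = (if v \<in> range e then real (inv_into UNIV e v) / f (p (inv_into UNIV e v)) v else 0)" for v
  have "0 \<le> c v" for v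
    using nonneg[OF p(1)] by (simp add: c_def)
  then obtain M where M: "\<forall>p\<in>C. \<forall>v. c v * f p v \<le> M"
    using bdd[of c] by blast
  have "real m \<le> M" for m
  proof -
    have "c (e m) * f (p m) (e m) = real m"
      using p(2)[of m] by (simp add: c_def inv_f_f[OF e(1)])
    then show ?thesis using M p(1)[of m] by metis
  qed
  then show False
    using reals_Archimedean2[of M] by (metis linorder_not_le)
qed

lemma compact_space_cube: "compact_space (cube n)"
  unfolding cube_def compact_space_product_topology by (simp add: compact_space_subtopology)

lemma compact_space_bounded_above:
  fixes g :: "'a \<Rightarrow> real"
  assumes "compact_space X" "continuous_map X euclideanreal g"
  shows "\<exists>M. \<forall>p\<in>topspace X. g p \<le> M"
proof -
  have "compact (g ` topspace X)"
    using image_compactin[of X "topspace X" euclideanreal g] assms by (simp add: compact_space_def)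
  then have "bdd_above (g ` topspace X)"
    by (intro bounded_imp_bdd_above compact_imp_bounded)
  then show ?thesis by (auto simp: bdd_above_def)
qed

text \<open>The coefficients are unrestricted because each closed simplex involves only finitely
  many of them; the growth argument for finite supports relies on this freedom.\<close>

lemma continuous_map_complex_sum:
  assumes "\<And>\<tau>. \<tau> \<in> K \<Longrightarrow> finite \<tau>"
  shows "continuous_map (complex_realization K) euclideanreal (\<lambda>x. \<Sum>v\<in>supp x. c v * x v)"
proof (rule continuous_map_complex)
  fix \<tau> assume "\<tau> \<in> K"
  then have fin: "finite \<tau>" using assms by blast
  have "continuous_map (subtopology (powertop_real UNIV) (closed_simplex \<tau>)) euclideanreal (\<lambda>x. \<Sum>v\<in>\<tau>. c v * x v)"
    by (intro continuous_map_sum fin continuous_map_real_mult_left continuous_map_from_subtopology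
        continuous_map_product_projection) simp
  then show "continuous_map (subtopology (powertop_real UNIV) (closed_simplex \<tau>)) euclideanreal
      (\<lambda>x. \<Sum>v\<in>supp x. c v * x v)"
  proof (rule continuous_map_eq)
    fix x assume "x \<in> topspace (subtopology (powertop_real UNIV) (closed_simplex \<tau>))"
    then have "x \<in> closed_simplex \<tau>" by simp
    from closed_simplex_supp(1)[OF this fin] fin
    show "(\<Sum>v\<in>\<tau>. c v * x v) = (\<Sum>v\<in>supp x. c v * x v)"
      by (intro sum.mono_neutral_right) (auto simp: supp_def)
  qed
qed

lemma finite_mid_support:
  fixes A :: "('i, 'j) bin_rel" and B :: "('j, 'k) bin_rel"
  assumes X: "compact_space X" and v: "continuous_map X (mid_space A B) v"
  shows "finite (\<Union>p\<in>topspace X. supp (v p))"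
proof (rule finite_support_bounded)
  have vp: "v p \<in> topspace (mid_space A B)" if "p \<in> topspace X" for p
    using continuous_map_image_subset_topspace[OF v] that by blast
  show "0 \<le> v p j" if "p \<in> topspace X" for p j
    by (rule mid_spaceD[OF vp[OF that]])
  fix c :: "'j \<Rightarrow> real" assume c: "\<And>j. 0 \<le> c j"
  have "continuous_map (mid_space A B) euclideanreal (\<lambda>x. \<Sum>j\<in>supp x. c j * x j)"
    by (rule continuous_map_complex_sum) (auto simp: mid_complex_def)
  from compact_space_bounded_above[OF X continuous_map_compose[OF v this]]
  obtain M where M: "\<And>p. p \<in> topspace X \<Longrightarrow> (\<Sum>j\<in>supp (v p). c j * v p j) \<le> M"
    by auto
  have "c j * v p j \<le> max M 0" if p: "p \<in> topspace X" for p j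
  proof (cases "j \<in> supp (v p)")
    case True
    then have "c j * v p j \<le> (\<Sum>j\<in>supp (v p). c j * v p j)"
      using mid_spaceD[OF vp[OF p]] c by (intro member_le_sum) auto
    then show ?thesis using M[OF p] by simp
  qed (simp add: supp_def)
  then show "\<exists>M. \<forall>p\<in>topspace X. \<forall>j. c j * v p j \<le> M" by blast
qed

text \<open>Rows in the smallest member \<open>\<sigma> n\<close> lie in all members and have weight
  1; rows of positive weight lie in \<open>\<sigma> 0\<close> and are related to the whole support.
  The last part bounds a weighted coordinate by a continuous function.\<close>

lemma row_coordD:
  assumes "c \<in> topspace (row_space A B)"
  shows "0 \<le> row_coord c i" "row_coord c i \<le> 1" "\<exists>i. row_coord c i = 1" "supp (row_coord c) \<subseteq> row_set A"
    "i \<in> supp (row_coord c) \<Longrightarrow> j \<in> supp (col_coord c) \<Longrightarrow> holds A i j"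
    "(\<And>i. 0 \<le> a i) \<Longrightarrow> a i * row_coord c i \<le> row_sum (\<lambda>\<sigma>. \<Sum>i\<in>\<sigma>. a i) c"
proof -
  obtain n \<sigma> x t where ch: "row_chain A B n \<sigma> x" and t: "t \<in> standard_simplex n" and c: "c = row_point A B n \<sigma> x t"
    using assms unfolding topspace_row_space by blast
  note s = row_weight_support[OF ch t]
  have z: "row_coord c = row_weight n \<sigma> t" and x: "col_coord c = x"
    by (simp_all add: c row_coord_row_point col_coord_row_point)
  show "0 \<le> row_coord c i"
    by (simp add: z row_weight_nonneg[OF t])
  have "row_weight n \<sigma> t i \<le> (\<Sum>q\<le>n. t q)"
    unfolding row_weight_def using standard_simplexD(1)[OF t] by (intro sum_mono) (simp add: of_bool_def)
  then show "row_coord c i \<le> 1"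
    using standard_simplexD(3)[OF t] by (simp add: z)
  show "supp (row_coord c) \<subseteq> row_set A"
    using s by (auto simp: z supp_def)
  show "holds A i j" if "i \<in> supp (row_coord c)" "j \<in> supp (col_coord c)"
    using that s(1) row_chain_holds[OF ch, of 0] by (auto simp: z x supp_def)
  have rc: "\<sigma> q \<in> row_complex A" "\<sigma> n \<subseteq> \<sigma> q" if "q \<le> n" for q
    using ch that unfolding row_chain_def by auto
  have "\<sigma> n \<noteq> {}" using rc(1)[of n] by (simp add: row_complex_def)
  then obtain i' where "i' \<in> \<sigma> n" by blast
  then have "row_weight n \<sigma> t i' = (\<Sum>q\<le>n. t q)"
    unfolding row_weight_def using rc(2) by (intro sum.cong) auto
  then show "\<exists>i. row_coord c i = 1"
    using standard_simplexD(3)[OF t] by (auto simp: z)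
  assume a: "\<And>i. 0 \<le> a i"
  have "a i * row_weight n \<sigma> t i = (\<Sum>q\<le>n. t q * (a i * of_bool (i \<in> \<sigma> q)))"
    unfolding row_weight_def sum_distrib_left by (simp only: mult.left_commute)
  also have "\<dots> \<le> (\<Sum>q\<le>n. t q * (\<Sum>i\<in>\<sigma> q. a i))"
  proof (intro sum_mono mult_left_mono standard_simplexD(1)[OF t])
    fix q assume "q \<in> {..n}"
    then have "finite (\<sigma> q)" using rc(1)[of q] by (simp add: row_complex_def)
    then show "a i * of_bool (i \<in> \<sigma> q) \<le> (\<Sum>i\<in>\<sigma> q. a i)"
      using a by (cases "i \<in> \<sigma> q") (auto intro: member_le_sum sum_nonneg)
  qed
  finally show "a i * row_coord c i \<le> row_sum (\<lambda>\<sigma>. \<Sum>i\<in>\<sigma>. a i) c"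
    by (simp add: z c row_sum_row_point row_coord_row_point)
qed

lemma finite_row_support:
  fixes A :: "('i, 'j) bin_rel" and B :: "('j, 'k) bin_rel"
  assumes X: "compact_space X" and u: "continuous_map X (row_space A B) u"
  shows "finite (\<Union>p\<in>topspace X. supp (row_coord (u p)))"
proof (rule finite_support_bounded)
  have up: "u p \<in> topspace (row_space A B)" if "p \<in> topspace X" for p
    using continuous_map_image_subset_topspace[OF u] that by blast
  show "0 \<le> row_coord (u p) i" if "p \<in> topspace X" for p i
    by (rule row_coordD[OF up[OF that]])
  fix a :: "'i \<Rightarrow> real" assume a: "\<And>i. 0 \<le> a i"
  from compact_space_bounded_above[OF X continuous_map_compose[OF u continuous_map_row_sum[of A B "\<lambda>\<sigma>. \<Sum>i\<in>\<sigma>. a i"]]]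
  obtain M where M: "\<And>p. p \<in> topspace X \<Longrightarrow> row_sum (\<lambda>\<sigma>. \<Sum>i\<in>\<sigma>. a i) (u p) \<le> M"
    by auto
  have "a i * row_coord (u p) i \<le> M" if p: "p \<in> topspace X" for p i
    using row_coordD(6)[OF up[OF p], of a i, OF a] M[OF p] by linarith
  then show "\<exists>M. \<forall>p\<in>topspace X. \<forall>i. a i * row_coord (u p) i \<le> M" by blast
qed

text \<open>Inserting 0 gives the maximum a value on the empty set, as occurs for the cube of
  dimension 0.\<close>

definition max0 :: "('a \<Rightarrow> real) \<Rightarrow> 'a set \<Rightarrow> real" where
  "max0 f S = Max (insert 0 (f ` S))"

lemma max0_ge: "finite S \<Longrightarrow> a \<in> S \<Longrightarrow> f a \<le> max0 f S"
  by (simp add: max0_def)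

lemma max0_attained:
  assumes "finite S" "0 < max0 f S"
  obtains a where "a \<in> S" "f a = max0 f S"
proof -
  have "max0 f S \<in> insert 0 (f ` S)"
    unfolding max0_def by (rule Max_in) (use assms in auto)
  then show thesis using assms(2) that by auto
qed

lemma continuous_map_max0:
  assumes "finite S" "\<And>a. a \<in> S \<Longrightarrow> continuous_map X euclideanreal (\<lambda>p. f p a)"
  shows "continuous_map X euclideanreal (\<lambda>p. max0 (f p) S)"
  using assms
proof (induction S rule: finite_induct)
  case empty
  then show ?case by (simp add: max0_def)
next
  case (insert a S)
  have "max0 (f p) (insert a S) = max (f p a) (max0 (f p) S)" for p
    using insert.hyps by (simp add: max0_def insert_commute[of 0])
  then show ?case
    using insert by (auto intro: continuous_map_real_max)
qed

section \<open>Retracting the cube from its boundary\<close>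

text \<open>Distance from the centre in the maximum norm, scaled so that the boundary has radius
  1.\<close>

definition cube_radius :: "nat \<Rightarrow> (nat \<Rightarrow> real) \<Rightarrow> real" where
  "cube_radius n p = max0 (\<lambda>i. \<bar>2 * p i - 1\<bar>) {..<n}"

text \<open>At time 1 the outer half of the cube is projected radially to the boundary, and the inner half
  expanded to the whole cube.\<close>

definition push_out :: "nat \<Rightarrow> real \<Rightarrow> (nat \<Rightarrow> real) \<Rightarrow> nat \<Rightarrow> real" where
  "push_out n s p = (\<lambda>i\<in>{..<n}. (1 - s) * p i + s * (1 / 2 + (p i - 1 / 2) / max (cube_radius n p) (1 / 2)))"

lemma cubeD:
  assumes "p \<in> topspace (cube n)"
  shows "i < n \<Longrightarrow> 0 \<le> p i" "i < n \<Longrightarrow> p i \<le> 1" "p \<in> extensional {..<n}"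
  using assms by (auto simp: topspace_cube PiE_iff)

lemma continuous_map_cube_radius: "continuous_map (cube n) euclideanreal (cube_radius n)"
  unfolding cube_radius_def
  by (intro continuous_map_max0 continuous_map_real_abs continuous_map_diff continuous_map_real_mult_left
      continuous_map_cube_coord) auto

lemma cube_radius_le: "p \<in> topspace (cube n) \<Longrightarrow> cube_radius n p \<le> 1"
  unfolding cube_radius_def max0_def using cubeD by (fastforce simp: abs_le_iff)

lemma push_out_in_cube:
  assumes p: "p \<in> topspace (cube n)" and s: "0 \<le> s" "s \<le> 1"
  shows "push_out n s p \<in> topspace (cube n)"
proof -
  let ?r = "max (cube_radius n p) (1 / 2)"
  have "(1 - s) * p i + s * (1 / 2 + (p i - 1 / 2) / ?r) \<in> {0..1}" if i: "i < n" for i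
  proof -
    have "\<bar>2 * p i - 1\<bar> \<le> cube_radius n p"
      unfolding cube_radius_def by (rule max0_ge[of "{..<n}" i "\<lambda>i. \<bar>2 * p i - 1\<bar>"]) (use i in auto)
    then have "- (1 / 2) \<le> (p i - 1 / 2) / ?r" "(p i - 1 / 2) / ?r \<le> 1 / 2"
      by (auto simp: field_simps)
    then have "1 / 2 + (p i - 1 / 2) / ?r \<in> {0..1}"
      unfolding atLeastAtMost_iff by linarith
    then have "(1 - s) *\<^sub>R p i + s *\<^sub>R (1 / 2 + (p i - 1 / 2) / ?r) \<in> {0..1}"
      using cubeD[OF p] i s by (intro convexD_alt) auto
    then show ?thesis by simp
  qed
  then show ?thesis
    unfolding topspace_cube push_out_def by (intro restrict_PiE_iff[THEN iffD2] ballI) auto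
qed

lemma push_out_0: "p \<in> topspace (cube n) \<Longrightarrow> push_out n 0 p = p"
  using cubeD(3)[of p n] by (auto simp: push_out_def restrict_def extensional_def fun_eq_iff)

lemma cube_boundary_radius: "p \<in> cube_boundary n \<Longrightarrow> cube_radius n p = 1"
proof -
  assume "p \<in> cube_boundary n"
  then obtain i where p: "p \<in> topspace (cube n)" and i: "i < n" "p i = 0 \<or> p i = 1"
    by (auto simp: cube_boundary_def)
  have "\<bar>2 * p i - 1\<bar> \<le> cube_radius n p"
    unfolding cube_radius_def by (rule max0_ge[of "{..<n}" i "\<lambda>i. \<bar>2 * p i - 1\<bar>"]) (use i in auto)
  then show ?thesis
    using i(2) cube_radius_le[OF p] by auto
qed

lemma push_out_boundary: "p \<in> cube_boundary n \<Longrightarrow> push_out n s p = p"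
proof -
  assume p: "p \<in> cube_boundary n"
  then have "p \<in> extensional {..<n}"
    by (intro cubeD(3)) (simp add: cube_boundary_def)
  then show ?thesis
    using cube_boundary_radius[OF p] by (auto simp: push_out_def restrict_def extensional_def fun_eq_iff algebra_simps)
qed

text \<open>A coordinate that attains the radius is sent to 0 or 1.\<close>

lemma push_out_to_boundary:
  assumes p: "p \<in> topspace (cube n)" and r: "1 / 2 \<le> cube_radius n p"
  shows "push_out n 1 p \<in> cube_boundary n"
proof -
  obtain i where i: "i < n" "\<bar>2 * p i - 1\<bar> = cube_radius n p"
    using max0_attained[of "{..<n}" "\<lambda>i. \<bar>2 * p i - 1\<bar>"] r by (auto simp: cube_radius_def)
  then have "2 * p i - 1 = cube_radius n p \<or> 2 * p i - 1 = - cube_radius n p" by linarith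
  then have "p i - 1 / 2 = cube_radius n p / 2 \<or> p i - 1 / 2 = - cube_radius n p / 2" by linarith
  moreover have "push_out n 1 p i = 1 / 2 + (p i - 1 / 2) / cube_radius n p"
    using i(1) r by (simp add: push_out_def max_def)
  ultimately have "push_out n 1 p i = 0 \<or> push_out n 1 p i = 1"
    using r by (elim disjE) (simp_all add: field_simps)
  then show ?thesis
    using push_out_in_cube[OF p, of 1] i(1) by (auto simp: cube_boundary_def)
qed

lemma continuous_map_push_out:
  "continuous_map (prod_topology (top_of_set {0..1}) (cube n)) (cube n) (\<lambda>(s, p). push_out n s p)"
proof (rule continuous_map_into_cube)
  let ?X = "prod_topology (top_of_set {0..1::real}) (cube n)"
  have s: "continuous_map ?X euclideanreal fst"
    using continuous_map_into_fulltopology[OF continuous_map_fst] .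
  fix i assume i: "i < n"
  have p: "continuous_map ?X euclideanreal (\<lambda>q. snd q i)"
    using continuous_map_compose[OF continuous_map_snd continuous_map_cube_coord[OF i]] by (simp add: o_def)
  have r: "continuous_map ?X euclideanreal (\<lambda>q. max (cube_radius n (snd q)) (1 / 2))"
    using continuous_map_compose[OF continuous_map_snd continuous_map_cube_radius]
    by (intro continuous_map_real_max) (simp_all add: o_def)
  have "continuous_map ?X euclideanreal (\<lambda>q. (1 - fst q) * snd q i + fst q * (1 / 2 + (snd q i - 1 / 2) / max (cube_radius n (snd q)) (1 / 2)))"
    by (intro continuous_map_add continuous_map_diff continuous_map_real_mult continuous_map_real_divide s p r) auto
  then show "continuous_map ?X euclideanreal (\<lambda>q. (case q of (s, p) \<Rightarrow> push_out n s p) i)"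
    using i by (simp add: push_out_def case_prod_unfold)
qed (use push_out_in_cube in \<open>auto simp flip: topspace_cube\<close>)

section \<open>Shrinking supports\<close>

text \<open>Lowers every coordinate by \<open>l\<close>, truncates at 0 and renormalizes. The sum
  runs over a fixed finite \<open>J\<close> rather than over the support, so that it varies
  continuously with \<open>x\<close>.\<close>

definition shrink :: "'j set \<Rightarrow> real \<Rightarrow> ('j \<Rightarrow> real) \<Rightarrow> 'j \<Rightarrow> real" where
  "shrink J l x = (\<lambda>j. max 0 (x j - l) / (\<Sum>j\<in>J. max 0 (x j - l)))"

text \<open>Some barycentric coordinate of a point with support in \<open>J\<close> exceeds this bound.\<close>

definition cutoff :: "'j set \<Rightarrow> real" where
  "cutoff J = 1 / (2 * (real (card J) + 1))"

lemma cutoff_pos: "0 < cutoff J"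
  by (simp add: cutoff_def)

text \<open>If no coordinate exceeded the cutoff, the total mass would be at most
  \<open>card J * cutoff J\<close>, which is below 1.\<close>

lemma shrink_denominator:
  assumes x: "x \<in> topspace (mid_space A B)" and J: "finite J" "supp x \<subseteq> J" and l: "l \<le> cutoff J"
  shows "0 < (\<Sum>j\<in>J. max 0 (x j - l))"
proof -
  have "\<exists>j\<in>J. cutoff J < x j"
  proof (rule ccontr)
    assume "\<not> ?thesis"
    then have "sum x J \<le> real (card J) * cutoff J"
      by (intro sum_bounded_above) (auto simp: not_less)
    also have "\<dots> < 1" by (simp add: cutoff_def field_simps)
    finally have "sum x J < 1" .
    moreover have "sum x J = sum x (supp x)"
      using J by (intro sum.mono_neutral_right) (auto simp: supp_def)
    ultimately show False using mid_spaceD(5)[OF x] by simp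
  qed
  then obtain j where "j \<in> J" "cutoff J < x j" by blast
  then show ?thesis
    using l J by (intro sum_pos2[of J j]) auto
qed

lemma supp_shrink:
  assumes x: "x \<in> topspace (mid_space A B)" and J: "finite J" "supp x \<subseteq> J" and l: "0 \<le> l" "l \<le> cutoff J"
  shows "supp (shrink J l x) = {j. l < x j}"
proof -
  have "(\<Sum>j\<in>J. max 0 (x j - l)) \<noteq> 0"
    using shrink_denominator[OF x J l(2)] by simp
  then have "shrink J l x j \<noteq> 0 \<longleftrightarrow> l < x j" for j
    by (auto simp: shrink_def max_def)
  then show ?thesis by (simp add: supp_def)
qed

lemma supp_shrink_subset:
  assumes "x \<in> topspace (mid_space A B)" "finite J" "supp x \<subseteq> J" "0 \<le> l" "l \<le> cutoff J"
  shows "supp (shrink J l x) \<subseteq> supp x"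
proof
  fix j assume "j \<in> supp (shrink J l x)"
  then have "l < x j"
    unfolding supp_shrink[OF assms] by simp
  then show "j \<in> supp x"
    using assms(4) by (simp add: supp_def)
qed

lemma shrink_in_mid_space:
  assumes x: "x \<in> topspace (mid_space A B)" and J: "finite J" "supp x \<subseteq> J" and l: "0 \<le> l" "l \<le> cutoff J"
  shows "shrink J l x \<in> topspace (mid_space A B)"
proof -
  note den = shrink_denominator[OF x J l(2)]
  have sub: "supp (shrink J l x) \<subseteq> supp x"
    by (rule supp_shrink_subset[OF x J l])
  have "sum (shrink J l x) (supp (shrink J l x)) = sum (shrink J l x) J"
    using J sub by (intro sum.mono_neutral_left) (auto simp: supp_def)
  also have "\<dots> = 1"
    using den by (simp add: shrink_def flip: sum_divide_distrib)
  finally have sum: "sum (shrink J l x) (supp (shrink J l x)) = 1" .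
  then have "supp (shrink J l x) \<noteq> {}" by auto
  then have "supp (shrink J l x) \<in> mid_complex A B"
    using mid_complex_mono[OF mid_spaceD(6)[OF x] sub] by simp
  moreover have "0 \<le> shrink J l x j" for j
    using den by (simp add: shrink_def)
  ultimately show ?thesis
    unfolding in_mid_space closed_simplex_def using sum by (simp add: supp_def)
qed

lemma shrink_0:
  assumes x: "x \<in> topspace (mid_space A B)" and J: "finite J" "supp x \<subseteq> J"
  shows "shrink J 0 x = x"
proof -
  have "sum x J = sum x (supp x)"
    using J by (intro sum.mono_neutral_right) (auto simp: supp_def)
  then show ?thesis
    using mid_spaceD(1,5)[OF x] by (simp add: shrink_def fun_eq_iff max_def)
qed

lemma continuous_map_shrink:
  assumes fin: "finite J" and l: "continuous_map X euclideanreal l" and v: "continuous_map X (mid_space A B) v"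
    and J: "\<And>p. p \<in> topspace X \<Longrightarrow> supp (v p) \<subseteq> J" and le: "\<And>p. p \<in> topspace X \<Longrightarrow> l p \<le> cutoff J"
  shows "continuous_map X euclideanreal (\<lambda>p. shrink J (l p) (v p) j)"
proof -
  have v': "continuous_map X euclideanreal (\<lambda>p. v p j)" for j
    using continuous_map_compose[OF v continuous_map_complex_coord] by (simp add: o_def)
  have vp: "v p \<in> topspace (mid_space A B)" if "p \<in> topspace X" for p
    using continuous_map_image_subset_topspace[OF v] that by blast
  show ?thesis
    unfolding shrink_def
  proof (intro continuous_map_real_divide continuous_map_real_max continuous_map_diff continuous_map_sum fin v' l)
    fix p assume p: "p \<in> topspace X"
    show "(\<Sum>j\<in>J. max 0 (v p j - l p)) \<noteq> 0"
      using shrink_denominator[OF vp[OF p] fin J[OF p] le[OF p]] by simp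
  qed auto
qed

section \<open>The lifting property\<close>

lemma col_coord_row_assemble: "col_coord (row_assemble A B x z) = x"
  by (simp add: row_assemble_def Let_def col_coord_row_point)

text \<open>In the outer half of the cube the weights of \<open>u\<close>, carried inwards radially,
  fade out as \<open>lam\<close> grows, while weights on the rows from \<open>ex\<close> fade in.
  Both kinds of rows are related to all columns that survive the truncation, so the mixture can be
  assembled to a point over \<open>y p\<close>.\<close>

lemma row_space_lift:
  fixes A :: "('i, 'j) bin_rel" and B :: "('j, 'k) bin_rel"
  assumes u: "continuous_map (subtopology (cube n) (cube_boundary n)) (row_space A B) u"
    and v: "continuous_map (cube n) (mid_space A B) v"
    and uv: "\<And>p. p \<in> cube_boundary n \<Longrightarrow> col_coord (u p) = v p"
  shows "\<exists>w. continuous_map (cube n) (row_space A B) w \<and> (\<forall>p\<in>cube_boundary n. w p = u p) \<and>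
    homotopic_with (\<lambda>h. \<forall>p\<in>cube_boundary n. h p = v p) (cube n) (mid_space A B) (col_coord \<circ> w) v"
proof -
  let ?C = "cube n"
  let ?D = "subtopology (cube n) (cube_boundary n)"
  have bd: "cube_boundary n \<subseteq> topspace ?C"
    by (auto simp: cube_boundary_def)
  have topD: "topspace ?D = cube_boundary n"
    using bd by auto
  have vp: "v p \<in> topspace (mid_space A B)" if "p \<in> topspace ?C" for p
    using continuous_map_image_subset_topspace[OF v] that by blast
  have up: "u p \<in> topspace (row_space A B)" if "p \<in> cube_boundary n" for p
    using continuous_map_image_subset_topspace[OF u] that topD by blast
  define J where "J = (\<Union>p\<in>topspace ?C. supp (v p))"
  have finJ: "finite J"
    unfolding J_def by (rule finite_mid_support[OF compact_space_cube v])
  have vJ: "supp (v p) \<subseteq> J" if "p \<in> topspace ?C" for p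
    using that by (auto simp: J_def)
  \<comment> \<open>One chosen row per simplex: as \<open>J\<close> has finitely many subsets, these
    choices contribute only finitely many rows to \<open>I\<close>.\<close>
  obtain r where r: "\<And>\<tau>. \<tau> \<in> mid_complex A B \<Longrightarrow> r \<tau> \<in> row_set A \<and> (\<forall>j\<in>\<tau>. holds A (r \<tau>) j)"
  proof -
    have "\<forall>\<tau>. \<exists>i. \<tau> \<in> mid_complex A B \<longrightarrow> i \<in> row_set A \<and> (\<forall>j\<in>\<tau>. holds A i j)"
      by (auto simp: mid_complex_def)
    then show thesis using that by metis
  qed
  define I where "I = (\<Union>p\<in>cube_boundary n. supp (row_coord (u p))) \<union> r ` {\<tau> \<in> mid_complex A B. \<tau> \<subseteq> J}"
  have finI: "finite I"
  proof -
    have "compact_space ?D"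
      by (intro compact_space_subtopology closedin_compact_space compact_space_cube closedin_cube_boundary)
    from finite_row_support[OF this u] have "finite (\<Union>p\<in>cube_boundary n. supp (row_coord (u p)))"
      unfolding topD .
    moreover have "finite {\<tau> \<in> mid_complex A B. \<tau> \<subseteq> J}"
      using finJ by (auto intro: finite_subset[of _ "Pow J"])
    ultimately show ?thesis by (simp add: I_def)
  qed
  have I: "I \<subseteq> row_set A"
    using row_coordD(4)[OF up] r unfolding I_def by blast
  define c where "c = cutoff J"
  have c: "0 < c" by (simp add: c_def cutoff_pos)
  \<comment> \<open>Zero on the boundary, 1 on the inner half, and linear in the radius on the outer
    half, where \<open>push_out n 1\<close> already lands on the boundary.\<close>
  define lam where "lam p = min 1 (2 - 2 * cube_radius n p)" for p
  have lam: "0 \<le> lam p" "lam p \<le> 1" if "p \<in> topspace ?C" for p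
    using cube_radius_le[OF that] by (auto simp: lam_def)
  have clam: "continuous_map ?C euclideanreal lam"
    unfolding lam_def[abs_def]
    by (intro continuous_map_real_min continuous_map_diff continuous_map_real_mult_left continuous_map_cube_radius) auto
  have lam_bd: "lam p = 0" if "p \<in> cube_boundary n" for p
    using cube_boundary_radius[OF that] by (simp add: lam_def)
  define \<rho> where "\<rho> = push_out n 1"
  have \<rho>: "\<rho> p \<in> topspace ?C" if "p \<in> topspace ?C" for p
    unfolding \<rho>_def by (rule push_out_in_cube[OF that]) auto
  have c\<rho>: "continuous_map ?C ?C \<rho>"
  proof -
    have "continuous_map ?C (prod_topology (top_of_set {0..1}) ?C) (\<lambda>p. (1::real, p))"
      by (intro continuous_map_pairedI) auto
    from continuous_map_compose[OF this continuous_map_push_out] show ?thesis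
      by (simp add: \<rho>_def o_def)
  qed
  define x where "x p = v (\<rho> p)" for p
  have cx: "continuous_map ?C (mid_space A B) x"
    using continuous_map_compose[OF c\<rho> v] by (simp add: x_def[abs_def] o_def)
  have cxj: "continuous_map ?C euclideanreal (\<lambda>p. x p j)" for j
    using continuous_map_compose[OF cx continuous_map_complex_coord] by (simp add: o_def)
  have xp: "x p \<in> topspace (mid_space A B)" "supp (x p) \<subseteq> J" if "p \<in> topspace ?C" for p
    using vp[OF \<rho>[OF that]] vJ[OF \<rho>[OF that]] by (simp_all only: x_def)
  \<comment> \<open>\<open>u\<close> is given only on the boundary, which \<open>\<rho> p\<close>
    reaches once the radius is at least 1/2. At radius 1/2 the factor \<open>1 - lam p\<close>
    vanishes, so the extension by 0 is continuous.\<close>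
  define zz where "zz p i = (if cube_radius n p \<le> 1 / 2 then 0 else (1 - lam p) * row_coord (u (\<rho> p)) i)" for p i
  have czz: "continuous_map ?C euclideanreal (\<lambda>p. zz p i)" for i
    unfolding zz_def
  proof (rule continuous_map_cases_le[OF continuous_map_cube_radius])
    let ?T = "subtopology ?C {p \<in> topspace ?C. 1 / 2 \<le> cube_radius n p}"
    have "continuous_map ?T ?D \<rho>"
      by (rule continuous_map_into_subtopology[OF continuous_map_from_subtopology[OF c\<rho>]])
        (auto simp: \<rho>_def intro: push_out_to_boundary)
    from continuous_map_compose[OF continuous_map_compose[OF this u] continuous_map_row_sum[of A B "\<lambda>\<sigma>. of_bool (i \<in> \<sigma>)"]]
    have "continuous_map ?T euclideanreal (\<lambda>p. row_coord (u (\<rho> p)) i)"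
      by (simp add: o_def row_coord_def)
    then show "continuous_map ?T euclideanreal (\<lambda>p. (1 - lam p) * row_coord (u (\<rho> p)) i)"
      by (intro continuous_map_real_mult continuous_map_diff continuous_map_from_subtopology[OF clam]) auto
  qed (auto simp: lam_def)
  have zz: "0 \<le> zz p i" "zz p i \<noteq> 0 \<Longrightarrow> \<rho> p \<in> cube_boundary n \<and> i \<in> supp (row_coord (u (\<rho> p)))"
    if p: "p \<in> topspace ?C" for p i
  proof -
    have b: "\<rho> p \<in> cube_boundary n" if "\<not> cube_radius n p \<le> 1 / 2"
      unfolding \<rho>_def by (rule push_out_to_boundary[OF p]) (use that in simp)
    then show "0 \<le> zz p i"
      using row_coordD(1)[OF up] lam[OF p] by (simp add: zz_def)
    show "\<rho> p \<in> cube_boundary n \<and> i \<in> supp (row_coord (u (\<rho> p)))" if "zz p i \<noteq> 0"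
      using b that by (auto simp: zz_def supp_def split: if_splits)
  qed
  \<comment> \<open>\<open>ex p i > 0\<close> forces \<open>x p j\<close> below the cutoff for every \<open>j\<close> unrelated to \<open>i\<close>\<close>
  define ex where "ex p i = (if i \<in> I then max 0 (lam p * c - (\<Sum>j | j \<in> J \<and> \<not> holds A i j. x p j)) else 0)" for p i
  have cex: "continuous_map ?C euclideanreal (\<lambda>p. ex p i)" for i
    unfolding ex_def using finJ
    by (cases "i \<in> I")
      (auto intro!: continuous_map_real_max continuous_map_diff continuous_map_real_mult_right continuous_map_sum clam cxj)
  define z where "z p i = zz p i + ex p i" for p i
  have cz: "continuous_map ?C euclideanreal (\<lambda>p. z p i)" for i
    unfolding z_def by (intro continuous_map_add czz cex)
  have ex0: "0 \<le> ex p i" for p i by (simp add: ex_def)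
  have z0: "0 \<le> z p i" if "p \<in> topspace ?C" for p i
    using zz(1)[OF that] ex0[of p i] by (simp add: z_def)
  have zI: "supp (z p) \<subseteq> I" if "p \<in> topspace ?C" for p
  proof
    fix i assume "i \<in> supp (z p)"
    then have "zz p i \<noteq> 0 \<or> ex p i \<noteq> 0" by (auto simp: supp_def z_def)
    then show "i \<in> I"
      using zz(2)[OF that, of i] by (auto simp: ex_def I_def split: if_splits)
  qed
  \<comment> \<open>The truncation level is the bound used in \<open>ex\<close>, so a column that is
    unrelated to a row with positive \<open>ex\<close> is cut off.\<close>
  define y where "y p = shrink J (lam p * c) (x p)" for p
  have lc: "0 \<le> lam p * c" "lam p * c \<le> cutoff J" if "p \<in> topspace ?C" for p
    using lam[OF that] c mult_right_mono[of "lam p" 1 c] by (auto simp: c_def)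
  have yp: "y p \<in> topspace (mid_space A B)" "supp (y p) \<subseteq> supp (x p)" "supp (y p) = {j. lam p * c < x p j}"
    if p: "p \<in> topspace ?C" for p
    unfolding y_def
    using shrink_in_mid_space[OF xp(1)[OF p] finJ xp(2)[OF p] lc[OF p]]
      supp_shrink_subset[OF xp(1)[OF p] finJ xp(2)[OF p] lc[OF p]]
      supp_shrink[OF xp(1)[OF p] finJ xp(2)[OF p] lc[OF p]] by blast+
  have cy: "continuous_map ?C euclideanreal (\<lambda>p. y p j)" for j
    unfolding y_def
    by (rule continuous_map_shrink[OF finJ _ cx xp(2)])
      (use lc in \<open>auto intro!: continuous_map_real_mult_right clam\<close>)
  have hol: "holds A i j" if p: "p \<in> topspace ?C" and i: "i \<in> supp (z p)" and j: "j \<in> supp (y p)" for p i j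
  proof (cases "zz p i = 0")
    case False
    \<comment> \<open>Here \<open>\<rho> p\<close> is a boundary point and
      \<open>u (\<rho> p)\<close> lies over \<open>x p\<close>, so its rows are related to all of
      \<open>supp (x p)\<close>, which contains \<open>supp (y p)\<close>.\<close>
    note b = zz(2)[OF p False]
    have "j \<in> supp (col_coord (u (\<rho> p)))"
      using subsetD[OF yp(2)[OF p] j] uv[OF conjunct1[OF b]] by (simp add: x_def)
    then show ?thesis
      by (rule row_coordD(5)[OF up[OF conjunct1[OF b]] conjunct2[OF b]])
  next
    case True
    then have "ex p i \<noteq> 0" using i by (simp add: supp_def z_def)
    then have less: "(\<Sum>j | j \<in> J \<and> \<not> holds A i j. x p j) < lam p * c"
    proof (rule contrapos_np)
      assume "\<not> (\<Sum>j | j \<in> J \<and> \<not> holds A i j. x p j) < lam p * c"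
      then show "ex p i = 0" by (simp add: ex_def)
    qed
    show ?thesis
    proof (rule ccontr)
      assume "\<not> holds A i j"
      then have "x p j \<le> (\<Sum>j | j \<in> J \<and> \<not> holds A i j. x p j)"
        using yp(2)[OF p] xp[OF p] j finJ mid_spaceD(1)[OF xp(1)[OF p]] by (intro member_le_sum) auto
      then show False using less yp(3)[OF p] j by auto
    qed
  qed
  \<comment> \<open>Where \<open>lam p\<close> is 0, the weights from \<open>u\<close> include a 1.
    Where it is positive, the chosen row of \<open>supp (x p)\<close> has no unrelated column in
    that support and gets weight at least \<open>lam p * c\<close>.\<close>
  have pos: "0 < max0 (z p) I" if p: "p \<in> topspace ?C" for p
  proof -
    have "\<exists>i. 0 < z p i"
    proof (cases "lam p = 0")
      case True
      then have "1 / 2 < cube_radius n p" by (auto simp: lam_def min_def split: if_splits)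
      then have nle: "\<not> cube_radius n p \<le> 1 / 2" "\<rho> p \<in> cube_boundary n"
        using push_out_to_boundary[OF p] by (auto simp: \<rho>_def)
      obtain i where "row_coord (u (\<rho> p)) i = 1"
        using row_coordD(3)[OF up[OF nle(2)]] by blast
      then have "zz p i = 1" using nle(1) True by (simp add: zz_def)
      then show ?thesis using ex0[of p i] by (intro exI[of _ i]) (simp add: z_def)
    next
      case False
      then have l: "0 < lam p" using lam(1)[OF p] by simp
      define i where "i = r (supp (x p))"
      note m = mid_spaceD(6)[OF xp(1)[OF p]]
      have "i \<in> I" using m xp(2)[OF p] by (auto simp: I_def i_def)
      moreover have "(\<Sum>j | j \<in> J \<and> \<not> holds A i j. x p j) = 0"
        using r[OF m] by (intro sum.neutral) (auto simp: i_def supp_def)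
      ultimately have "ex p i = lam p * c" using l c by (simp add: ex_def)
      then show ?thesis using zz(1)[OF p, of i] l c by (intro exI[of _ i]) (simp add: z_def add_nonneg_pos)
    qed
    then obtain i where i: "0 < z p i" by blast
    then have "i \<in> I" using zI[OF p] by (auto simp: supp_def)
    then show ?thesis using max0_ge[OF finI, of i "z p"] i by simp
  qed
  \<comment> \<open>Divided by the maximum rather than the sum, because the row coordinates of a
    point have maximum 1.\<close>
  define z' where "z' p i = z p i / max0 (z p) I" for p i
  have suppz': "supp (z' p) = supp (z p)" if "p \<in> topspace ?C" for p
    using pos[OF that] by (auto simp: z'_def supp_def)
  define w where "w p = row_assemble A B (y p) (z' p)" for p
  have cw: "continuous_map ?C (row_space A B) w"
    unfolding w_def
  proof (rule continuous_map_row_assemble[OF finI finJ I cy])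
    show "continuous_map ?C euclideanreal (\<lambda>p. z' p i)" for i
      unfolding z'_def
      by (intro continuous_map_real_divide cz continuous_map_max0 finI) (use pos in fastforce)
    fix p assume p: "p \<in> topspace ?C"
    show "y p \<in> topspace (mid_space A B) \<and> supp (y p) \<subseteq> J"
      using yp[OF p] xp[OF p] by blast
    show "supp (z' p) \<subseteq> I" using zI[OF p] suppz'[OF p] by simp
    show "holds A i j" if "i \<in> supp (z' p)" "j \<in> supp (y p)" for i j
      using hol[OF p] that suppz'[OF p] by simp
    have "z p i \<le> max0 (z p) I" for i
    proof (cases "i \<in> I")
      case True
      then show ?thesis by (rule max0_ge[OF finI])
    next
      case False
      then have "z p i = 0" using zI[OF p] by (auto simp: supp_def)
      then show ?thesis using pos[OF p] by simp
    qed
    then show "0 \<le> z' p i \<and> z' p i \<le> 1" for i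
      using z0[OF p] pos[OF p] by (simp add: z'_def)
    obtain i where "i \<in> I" "z p i = max0 (z p) I"
      using max0_attained[OF finI pos[OF p]] by blast
    then show "\<exists>i. z' p i = 1"
      using pos[OF p] by (intro exI[of _ i]) (simp add: z'_def)
  qed
  have wb: "w p = u p" if p: "p \<in> cube_boundary n" for p
  proof -
    have pC: "p \<in> topspace ?C" using p bd by blast
    have \<rho>p: "\<rho> p = p" by (simp add: \<rho>_def push_out_boundary[OF p])
    have "y p = v p"
      using shrink_0[OF vp[OF pC] finJ vJ[OF pC]] by (simp add: y_def x_def \<rho>p lam_bd[OF p])
    moreover have "z p = row_coord (u p)"
    proof
      fix i
      have "0 \<le> (\<Sum>j | j \<in> J \<and> \<not> holds A i j. x p j)"
        using mid_spaceD(1)[OF xp(1)[OF pC]] by (intro sum_nonneg)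
      then show "z p i = row_coord (u p) i"
        using cube_boundary_radius[OF p] by (simp add: z_def zz_def ex_def lam_bd[OF p] \<rho>p)
    qed
    moreover have "max0 (z p) I = 1"
    proof (rule antisym)
      obtain i where "i \<in> I" "z p i = max0 (z p) I"
        using max0_attained[OF finI pos[OF pC]] by blast
      then show "max0 (z p) I \<le> 1"
        using row_coordD(2)[OF up[OF p], of i] \<open>z p = row_coord (u p)\<close> by simp
      obtain i where i: "row_coord (u p) i = 1"
        using row_coordD(3)[OF up[OF p]] by blast
      then have "i \<in> I" using p by (auto simp: I_def supp_def)
      then show "1 \<le> max0 (z p) I"
        using max0_ge[OF finI, of i "z p"] i \<open>z p = row_coord (u p)\<close> by simp
    qed
    ultimately have "w p = row_assemble A B (col_coord (u p)) (row_coord (u p))"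
      by (simp add: w_def z'_def[abs_def] uv[OF p])
    then show ?thesis
      using row_assemble_coords[OF up[OF p]] by simp
  qed
  have hom: "homotopic_with (\<lambda>h. \<forall>p\<in>cube_boundary n. h p = v p) ?C (mid_space A B) v (col_coord \<circ> w)"
  proof (rule homotopic_with[THEN iffD2])
    show "(\<forall>p\<in>cube_boundary n. h p = v p) = (\<forall>p\<in>cube_boundary n. k p = v p)"
      if "\<And>p. p \<in> topspace ?C \<Longrightarrow> h p = k p" for h k
      using that bd by (metis subsetD)
    let ?P = "prod_topology (top_of_set {0..1::real}) ?C"
    \<comment> \<open>The homotopy performs both motions at once: at time \<open>s\<close> it pushes
      out by \<open>push_out n s\<close> and truncates at \<open>s\<close> times the final level. On
      the boundary it is constant, since \<open>push_out\<close> fixes the point and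
      \<open>lam\<close> vanishes.\<close>
    define X where "X q = v (push_out n (fst q) (snd q))" for q
    define L where "L q = fst q * lam (snd q) * c" for q
    have po: "push_out n (fst q) (snd q) \<in> topspace ?C" if "q \<in> topspace ?P" for q
      using that by (auto intro: push_out_in_cube)
    have cX: "continuous_map ?P (mid_space A B) X"
      using continuous_map_compose[OF continuous_map_push_out v] by (simp add: X_def[abs_def] o_def case_prod_unfold)
    have Xp: "X q \<in> topspace (mid_space A B)" "supp (X q) \<subseteq> J" if "q \<in> topspace ?P" for q
      using vp[OF po[OF that]] vJ[OF po[OF that]] by (simp_all only: X_def)
    have cL: "continuous_map ?P euclideanreal L"
    proof -
      have "continuous_map ?P euclideanreal fst"
        using continuous_map_into_fulltopology[OF continuous_map_fst] .
      moreover have "continuous_map ?P euclideanreal (\<lambda>q. lam (snd q))"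
        using continuous_map_compose[OF continuous_map_snd clam] by (simp add: o_def)
      ultimately show ?thesis
        unfolding L_def[abs_def] by (intro continuous_map_real_mult_right continuous_map_real_mult)
    qed
    have L: "0 \<le> L q" "L q \<le> cutoff J" if q: "q \<in> topspace ?P" for q
    proof -
      have s: "0 \<le> fst q" "fst q \<le> 1" "snd q \<in> topspace ?C" using q by auto
      then show "0 \<le> L q" using lam c by (simp add: L_def)
      have "fst q * lam (snd q) \<le> 1" using s lam[OF s(3)] by (intro mult_le_one)
      then show "L q \<le> cutoff J" using c mult_right_mono[of "fst q * lam (snd q)" 1 c] by (simp add: L_def c_def)
    qed
    have "continuous_map ?P (mid_space A B) (\<lambda>q. shrink J (L q) (X q))"
    proof (rule continuous_map_into_complex[OF _ _ finJ])
      show "continuous_map ?P euclideanreal (\<lambda>q. shrink J (L q) (X q) j)" for j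
        by (rule continuous_map_shrink[OF finJ cL cX Xp(2) L(2)])
      fix q assume q: "q \<in> topspace ?P"
      show "supp (shrink J (L q) (X q)) \<in> mid_complex A B \<and>
        shrink J (L q) (X q) \<in> closed_simplex (supp (shrink J (L q) (X q))) \<and> supp (shrink J (L q) (X q)) \<subseteq> J"
        using shrink_in_mid_space[OF Xp(1)[OF q] finJ Xp(2)[OF q] L[OF q]]
          supp_shrink_subset[OF Xp(1)[OF q] finJ Xp(2)[OF q] L[OF q]] Xp(2)[OF q]
        unfolding in_mid_space by blast
    qed
    moreover have "shrink J (L (0, p)) (X (0, p)) = v p" if p: "p \<in> topspace ?C" for p
      using shrink_0[OF vp[OF p] finJ vJ[OF p]] by (simp add: L_def X_def push_out_0[OF p])
    moreover have "shrink J (L (1, p)) (X (1, p)) = (col_coord \<circ> w) p" for p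
      by (simp add: w_def col_coord_row_assemble L_def X_def y_def x_def \<rho>_def)
    moreover have "shrink J (L (t, p)) (X (t, p)) = v p" if p: "p \<in> cube_boundary n" for t p
    proof -
      have pC: "p \<in> topspace ?C" using p bd by blast
      then show ?thesis
        using shrink_0[OF vp[OF pC] finJ vJ[OF pC]] by (simp add: L_def X_def push_out_boundary[OF p] lam_bd[OF p])
    qed
    ultimately show "\<exists>h. continuous_map ?P (mid_space A B) h \<and> (\<forall>p\<in>topspace ?C. h (0, p) = v p) \<and>
        (\<forall>p\<in>topspace ?C. h (1, p) = (col_coord \<circ> w) p) \<and> (\<forall>t\<in>{0..1}. \<forall>p\<in>cube_boundary n. h (t, p) = v p)"
      by (intro exI[of _ "\<lambda>q. shrink J (L q) (X q)"]) simp
  qed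
  show ?thesis
    using cw wb homotopic_with_symD[OF hom] by blast
qed

lemma lifting_property_col_coord: "lifting_property (row_space A B) (mid_space A B) col_coord"
  unfolding lifting_property_def
  by (intro conjI allI impI continuous_map_col_coord row_space_lift) (assumption+, erule (1) bspec)

section \<open>Functoriality\<close>

lemma pushforward_closed_simplex:
  assumes x: "x \<in> closed_simplex \<tau>" and fin: "finite \<tau>"
  shows "pushforward f x \<in> closed_simplex (f ` \<tau>)"
proof -
  have x': "\<And>v. v \<notin> \<tau> \<Longrightarrow> x v = 0" "\<And>v. 0 \<le> x v" "sum x \<tau> = 1"
    using x by (auto simp: closed_simplex_def)
  have "(\<Sum>w\<in>f ` \<tau>. pushforward f x w) = 1"
    using sum_pushforward[where S = \<tau> and x = x and f = f and T = "f ` \<tau>" and g = "\<lambda>_. 1"] fin x'(1,3) by simp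
  moreover have "pushforward f x w = 0" if "w \<notin> f ` \<tau>" for w
  proof -
    have "pushforward f x w = (\<Sum>u | u \<in> \<tau> \<and> f u = w. x u)"
      by (rule pushforward_eq) (use fin x'(1) in auto)
    also have "\<dots> = 0"
      using that by (intro sum.neutral) auto
    finally show ?thesis .
  qed
  ultimately show ?thesis
    using pushforward_nonneg[of x f, OF x'(2)] by (simp add: closed_simplex_def)
qed

lemma continuous_map_pushforward:
  assumes K: "\<And>\<tau>. \<tau> \<in> K \<Longrightarrow> finite \<tau> \<and> f ` \<tau> \<in> K'"
  shows "continuous_map (complex_realization K) (complex_realization K') (pushforward f)"
proof (rule continuous_map_complex)
  fix \<tau> assume "\<tau> \<in> K"
  with K have fin: "finite \<tau>" and f\<tau>: "f ` \<tau> \<in> K'" by auto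
  let ?S = "subtopology (powertop_real UNIV) (closed_simplex \<tau>)"
  have "continuous_map ?S euclideanreal (\<lambda>x. pushforward f x w)" for w
  proof (rule continuous_map_eq)
    show "continuous_map ?S euclideanreal (\<lambda>x. \<Sum>v | v \<in> \<tau> \<and> f v = w. x v)"
      by (intro continuous_map_sum continuous_map_from_subtopology continuous_map_product_projection) (use fin in auto)
    show "(\<Sum>v | v \<in> \<tau> \<and> f v = w. x v) = pushforward f x w" if "x \<in> topspace ?S" for x
      by (rule pushforward_eq[OF fin, symmetric]) (use that in \<open>auto simp: closed_simplex_def\<close>)
  qed
  then have "continuous_map ?S (subtopology (powertop_real UNIV) (closed_simplex (f ` \<tau>))) (pushforward f)"
    by (rule continuous_map_into_closed_simplex) (use pushforward_closed_simplex[OF _ fin] in auto)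
  from continuous_map_compose[OF this continuous_map_closed_simplex[OF f\<tau>]]
  show "continuous_map ?S (complex_realization K') (pushforward f)" by simp
qed

lemma pushforward_restrict_id:
  assumes "finite (supp x)" "supp x \<subseteq> S"
  shows "pushforward (\<lambda>v\<in>S. v) x = x"
proof
  fix w
  have "pushforward (\<lambda>v\<in>S. v) x w = (\<Sum>v | v \<in> supp x \<and> (\<lambda>v\<in>S. v) v = w. x v)"
    by (rule pushforward_eq[OF assms(1)]) (simp add: supp_def)
  also have "\<dots> = (\<Sum>v\<in>supp x \<inter> {w}. x v)"
    by (rule sum.cong) (use assms(2) in auto)
  also have "\<dots> = x w"
    by (cases "w \<in> supp x") (auto simp: supp_def)
  finally show "pushforward (\<lambda>v\<in>S. v) x w = x w" .
qed

text \<open>\<open>compose S g f\<close> is the actual composite only on \<open>S\<close>, whence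
  the condition on the support.\<close>

lemma pushforward_compose:
  assumes fin: "finite (supp x)" and S: "supp x \<subseteq> S"
  shows "pushforward (compose S g f) x = pushforward g (pushforward f x)"
proof
  fix w
  have x0: "x v = 0" if "v \<notin> supp x" for v using that by (simp add: supp_def)
  have p0: "pushforward f x v = 0" if "v \<notin> f ` supp x" for v
  proof -
    have "pushforward f x v = (\<Sum>u | u \<in> supp x \<and> f u = v. x u)"
      by (rule pushforward_eq) (use fin x0 in auto)
    also have "\<dots> = 0"
      using that by (intro sum.neutral) auto
    finally show ?thesis .
  qed
  have "pushforward g (pushforward f x) w = (\<Sum>v | v \<in> f ` supp x \<and> g v = w. pushforward f x v)"
    by (rule pushforward_eq) (use fin p0 in auto)
  also have "\<dots> = (\<Sum>v\<in>f ` supp x. pushforward f x v * of_bool (g v = w))"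
    by (rule sum.mono_neutral_cong_left) (use fin in auto)
  also have "\<dots> = (\<Sum>u\<in>supp x. x u * of_bool (g (f u) = w))"
    by (rule sum_pushforward) (use fin x0 in auto)
  also have "\<dots> = (\<Sum>u | u \<in> supp x \<and> compose S g f u = w. x u)"
    by (rule sum.mono_neutral_cong_right) (use fin S in \<open>auto simp: compose_def\<close>)
  also have "\<dots> = pushforward (compose S g f) x w"
    by (rule pushforward_eq[symmetric]) (use fin x0 in auto)
  finally show "pushforward (compose S g f) x w = pushforward g (pushforward f x) w" by simp
qed

text \<open>What a morphism of pairs has to satisfy for the row categories only: the map on the last
  index set is replaced by the existence of images of its elements.\<close>

definition row_compatible :: "('i, 'j) bin_rel \<Rightarrow> ('j, 'k) bin_rel \<Rightarrow> ('i, 'j) bin_rel \<Rightarrow> ('j, 'k) bin_rel \<Rightarrow>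
    ('i \<Rightarrow> 'i) \<Rightarrow> ('j \<Rightarrow> 'j) \<Rightarrow> bool" where
  "row_compatible A B A' B' f g \<longleftrightarrow> f \<in> row_set A \<rightarrow> row_set A' \<and> g \<in> col_set A \<rightarrow> col_set A' \<and>
     (\<forall>i\<in>row_set A. \<forall>j\<in>col_set A. holds A i j \<longrightarrow> holds A' (f i) (g j)) \<and>
     (\<forall>k\<in>col_set B. \<exists>k'\<in>col_set B'. \<forall>j\<in>col_set A. holds B j k \<longrightarrow> holds B' (g j) k')"

definition row_map :: "('i, 'j) bin_rel \<Rightarrow> ('j, 'k) bin_rel \<Rightarrow> ('i \<Rightarrow> 'i) \<Rightarrow> ('j \<Rightarrow> 'j) \<Rightarrow>
    ('i set \<times> ('j \<Rightarrow> real), ('i set \<times> 'i set) \<times> ('j \<Rightarrow> real)) classifying_point \<Rightarrow>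
    ('i set \<times> ('j \<Rightarrow> real), ('i set \<times> 'i set) \<times> ('j \<Rightarrow> real)) classifying_point" where
  "row_map A' B' f g = classifying_map (row_category A' B')
     (\<lambda>(\<sigma>, x). (f ` \<sigma>, pushforward g x))
     (\<lambda>((\<sigma>\<^sub>0, \<sigma>\<^sub>1), x). ((f ` \<sigma>\<^sub>0, f ` \<sigma>\<^sub>1), pushforward g x))"

lemma row_compatibleD:
  assumes "row_compatible A B A' B' f g"
  shows "i \<in> row_set A \<Longrightarrow> f i \<in> row_set A'" "j \<in> col_set A \<Longrightarrow> g j \<in> col_set A'"
    "i \<in> row_set A \<Longrightarrow> j \<in> col_set A \<Longrightarrow> holds A i j \<Longrightarrow> holds A' (f i) (g j)"
    "k \<in> col_set B \<Longrightarrow> \<exists>k'\<in>col_set B'. \<forall>j\<in>col_set A. holds B j k \<longrightarrow> holds B' (g j) k'"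
  using assms by (auto simp: row_compatible_def)

lemma row_compatible_row_complex:
  assumes "row_compatible A B A' B' f g" "\<sigma> \<in> row_complex A"
  shows "f ` \<sigma> \<in> row_complex A'"
proof -
  obtain j where j: "j \<in> col_set A" "\<forall>i\<in>\<sigma>. holds A i j" and \<sigma>: "\<sigma> \<noteq> {}" "finite \<sigma>" "\<sigma> \<subseteq> row_set A"
    using assms(2) by (auto simp: row_complex_def)
  note D = row_compatibleD[OF assms(1)]
  have "\<forall>i\<in>f ` \<sigma>. holds A' i (g j)" "f ` \<sigma> \<subseteq> row_set A'"
    using D(1,3) j \<sigma>(3) by auto
  then show ?thesis
    unfolding row_complex_def using D(2)[OF j(1)] \<sigma>(1,2) by blast
qed

lemma row_compatible_common:
  assumes c: "row_compatible A B A' B' f g" and \<sigma>: "\<sigma> \<subseteq> row_set A" and \<tau>: "\<tau> \<subseteq> common_cols A \<sigma>"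
  shows "g ` \<tau> \<subseteq> common_cols A' (f ` \<sigma>)"
proof
  fix j' assume "j' \<in> g ` \<tau>"
  then obtain j where j: "j \<in> \<tau>" "j' = g j" by blast
  then have "j \<in> col_set A" "\<forall>i\<in>\<sigma>. holds A i j" using \<tau> by (auto simp: common_cols_def)
  then show "j' \<in> common_cols A' (f ` \<sigma>)"
    using c \<sigma> j(2) by (auto simp: row_compatible_def common_cols_def)
qed

lemma row_compatible_last:
  assumes c: "row_compatible A B A' B' f g" and \<tau>: "\<tau> \<subseteq> col_set A" "\<exists>k\<in>col_set B. \<forall>j\<in>\<tau>. holds B j k"
  shows "\<exists>k\<in>col_set B'. \<forall>j\<in>g ` \<tau>. holds B' j k"
proof -
  obtain k where k: "k \<in> col_set B" "\<forall>j\<in>\<tau>. holds B j k" using \<tau>(2) by blast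
  obtain k' where "k' \<in> col_set B'" "\<forall>j\<in>col_set A. holds B j k \<longrightarrow> holds B' (g j) k'"
    using row_compatibleD(4)[OF c k(1)] by blast
  then show ?thesis using k(2) \<tau>(1) by blast
qed

lemma row_compatible_fibre:
  assumes c: "row_compatible A B A' B' f g" and \<sigma>: "\<sigma> \<in> row_complex A"
  shows "continuous_map (fibre_space A B \<sigma>) (fibre_space A' B' (f ` \<sigma>)) (pushforward g)"
proof (rule continuous_map_pushforward)
  fix \<tau> assume "\<tau> \<in> row_complex (B\<lparr>row_set := common_cols A \<sigma>\<rparr>)"
  then have \<tau>: "\<tau> \<noteq> {}" "finite \<tau>" "\<tau> \<subseteq> common_cols A \<sigma>" "\<exists>k\<in>col_set B. \<forall>j\<in>\<tau>. holds B j k"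
    by (auto simp: row_complex_def)
  have "\<tau> \<subseteq> col_set A" using \<tau>(3) by (auto simp: common_cols_def)
  from row_compatible_last[OF c this \<tau>(4)] row_compatible_common[OF c _ \<tau>(3)] \<sigma> \<tau>(1,2)
  show "finite \<tau> \<and> g ` \<tau> \<in> row_complex (B'\<lparr>row_set := common_cols A' (f ` \<sigma>)\<rparr>)"
    by (simp add: row_complex_def)
qed

text \<open>A common row \<open>i\<close> goes to a common row of the image, by the statement on
  common columns for the one-element set \<open>{i}\<close>; a common column of the image comes from
  the last clause of \<open>row_compatible\<close>.\<close>

lemma row_compatible_mid:
  assumes c: "row_compatible A B A' B' f g"
  shows "continuous_map (mid_space A B) (mid_space A' B') (pushforward g)"
proof (rule continuous_map_pushforward)
  fix \<tau> assume "\<tau> \<in> mid_complex A B"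
  then have \<tau>: "\<tau> \<noteq> {}" "finite \<tau>" "\<tau> \<subseteq> col_set A" "\<exists>k\<in>col_set B. \<forall>j\<in>\<tau>. holds B j k"
    and i: "\<exists>i\<in>row_set A. \<forall>j\<in>\<tau>. holds A i j"
    by (auto simp: mid_complex_def)
  obtain i where i: "i \<in> row_set A" "\<forall>j\<in>\<tau>. holds A i j" using i by blast
  then have "g ` \<tau> \<subseteq> common_cols A' (f ` {i})"
    using \<tau>(3) by (intro row_compatible_common[OF c]) (auto simp: common_cols_def)
  moreover have "f i \<in> row_set A'" using c i by (auto simp: row_compatible_def)
  ultimately have "\<exists>i\<in>row_set A'. \<forall>j\<in>g ` \<tau>. holds A' i j" "g ` \<tau> \<subseteq> col_set A'"
    by (auto simp: common_cols_def)
  then show "finite \<tau> \<and> g ` \<tau> \<in> mid_complex A' B'"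
    unfolding mid_complex_def using row_compatible_last[OF c \<tau>(3,4)] \<tau>(1,2) by simp
qed

lemma simplicial_map_row_map:
  assumes c: "row_compatible A B A' B' f g"
  shows "simplicial_map (nerve (row_category A B)) (nerve (row_category A' B'))
    (nerve_map (\<lambda>(\<sigma>, x). (f ` \<sigma>, pushforward g x))
       (\<lambda>((\<sigma>\<^sub>0, \<sigma>\<^sub>1), x). ((f ` \<sigma>\<^sub>0, f ` \<sigma>\<^sub>1), pushforward g x)))"
proof (rule simplicial_map_nerve_map)
  show "continuous_map (Ob (row_category A B)) (Ob (row_category A' B')) (\<lambda>(\<sigma>, x). (f ` \<sigma>, pushforward g x))"
    unfolding row_category_def top_category.simps
    by (rule continuous_map_sum_topology) (use row_compatible_row_complex[OF c] row_compatible_fibre[OF c] in auto)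
  have e: "(\<lambda>((\<sigma>\<^sub>0, \<sigma>\<^sub>1), x). ((f ` \<sigma>\<^sub>0, f ` \<sigma>\<^sub>1), pushforward g x)) =
     (\<lambda>(s, x). ((\<lambda>(\<sigma>\<^sub>0, \<sigma>\<^sub>1). (f ` \<sigma>\<^sub>0, f ` \<sigma>\<^sub>1)) s, pushforward g x))"
    by (auto simp: fun_eq_iff)
  show "continuous_map (Mor (row_category A B)) (Mor (row_category A' B'))
     (\<lambda>((\<sigma>\<^sub>0, \<sigma>\<^sub>1), x). ((f ` \<sigma>\<^sub>0, f ` \<sigma>\<^sub>1), pushforward g x))"
    unfolding e row_category_def top_category.simps
    by (rule continuous_map_sum_topology)
      (use row_compatible_row_complex[OF c] row_compatible_fibre[OF c] in \<open>auto intro!: image_mono\<close>)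
qed (auto simp: row_category_structure)

lemma nerve_map_chain_simplex:
  "nerve_map (\<lambda>(\<sigma>, x). (f ` \<sigma>, pushforward g x)) (\<lambda>((\<sigma>\<^sub>0, \<sigma>\<^sub>1), x). ((f ` \<sigma>\<^sub>0, f ` \<sigma>\<^sub>1), pushforward g x)) n
     (chain_simplex n \<sigma> x) = chain_simplex n (\<lambda>q. f ` \<sigma> q) (pushforward g x)"
  by (auto simp: nerve_map_def chain_simplex_def restrict_def fun_eq_iff)

lemma row_map_row_point:
  assumes "row_compatible A B A' B' f g"
  shows "row_map A' B' f g (row_point A B n \<sigma> x t) = row_point A' B' n (\<lambda>q. f ` \<sigma> q) (pushforward g x) t"
  unfolding row_map_def row_point_def classifying_map_glue_class[OF simplicial_map_row_map[OF assms]]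
    nerve_map_chain_simplex ..

lemma continuous_map_row_map:
  assumes "row_compatible A B A' B' f g"
  shows "continuous_map (row_space A B) (row_space A' B') (row_map A' B' f g)"
  unfolding row_map_def by (rule continuous_map_classifying_map[OF simplicial_map_row_map[OF assms]])

lemma row_compatible_id: "row_compatible A B A B (\<lambda>i\<in>row_set A. i) (\<lambda>j\<in>col_set A. j)"
  by (auto simp: row_compatible_def)

lemma row_compatible_compose:
  assumes "row_compatible A B A' B' f g" "row_compatible A' B' A'' B'' f' g'"
  shows "row_compatible A B A'' B'' (compose (row_set A) f' f) (compose (col_set A) g' g)"
proof -
  have "\<exists>k''\<in>col_set B''. \<forall>j\<in>col_set A. holds B j k \<longrightarrow> holds B'' (compose (col_set A) g' g j) k''"
    if k: "k \<in> col_set B" for k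
  proof -
    obtain k' where k': "k' \<in> col_set B'" "\<forall>j\<in>col_set A. holds B j k \<longrightarrow> holds B' (g j) k'"
      using row_compatibleD(4)[OF assms(1) k] by blast
    obtain k'' where k'': "k'' \<in> col_set B''" "\<forall>j\<in>col_set A'. holds B' j k' \<longrightarrow> holds B'' (g' j) k''"
      using row_compatibleD(4)[OF assms(2) k'(1)] by blast
    show ?thesis
      using k' k'' row_compatibleD(2)[OF assms(1)] by (intro bexI[of _ k'']) (auto simp: compose_def)
  qed
  then show ?thesis
    unfolding row_compatible_def using row_compatibleD(1-3)[OF assms(1)] row_compatibleD(1-3)[OF assms(2)]
    by (auto simp: compose_def)
qed

lemma row_map_id:
  assumes "c \<in> topspace (row_space A B)"
  shows "row_map A B (\<lambda>i\<in>row_set A. i) (\<lambda>j\<in>col_set A. j) c = c"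
proof -
  obtain n \<sigma> x t where ch: "row_chain A B n \<sigma> x" and c: "c = row_point A B n \<sigma> x t"
    using assms unfolding topspace_row_space by blast
  have "x \<in> topspace (mid_space A B)"
    using ch unfolding row_chain_def by blast
  then have push: "pushforward (\<lambda>j\<in>col_set A. j) x = x"
    by (intro pushforward_restrict_id) (auto dest: mid_spaceD simp del: topspace_complex_realization)
  have "(\<lambda>i\<in>row_set A. i) ` \<sigma> q = \<sigma> q" if "q \<le> n" for q
  proof -
    have "\<sigma> q \<subseteq> row_set A" using ch that by (auto simp: row_chain_def row_complex_def)
    then have "(\<lambda>i\<in>row_set A. i) ` \<sigma> q = (\<lambda>i. i) ` \<sigma> q"
      by (intro image_cong) auto
    then show ?thesis by simp
  qed
  then show ?thesis
    unfolding c row_map_row_point[OF row_compatible_id] push by (rule row_point_cong)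
qed

lemma row_map_compose:
  assumes f: "row_compatible A B A' B' f g" and f': "row_compatible A' B' A'' B'' f' g'"
    and z: "z \<in> topspace (row_space A B)"
  shows "row_map A'' B'' (compose (row_set A) f' f) (compose (col_set A) g' g) z =
    row_map A'' B'' f' g' (row_map A' B' f g z)"
proof -
  obtain n \<sigma> x t where ch: "row_chain A B n \<sigma> x" and c: "z = row_point A B n \<sigma> x t"
    using z unfolding topspace_row_space by blast
  have "x \<in> topspace (mid_space A B)"
    using ch unfolding row_chain_def by blast
  then have push: "pushforward (compose (col_set A) g' g) x = pushforward g' (pushforward g x)"
    by (intro pushforward_compose) (auto dest: mid_spaceD simp del: topspace_complex_realization)
  have "compose (row_set A) f' f ` \<sigma> q = f' ` f ` \<sigma> q" if "q \<le> n" for q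
  proof -
    have "\<sigma> q \<subseteq> row_set A" using ch that by (auto simp: row_chain_def row_complex_def)
    then show ?thesis
      unfolding image_image by (intro image_cong) (auto simp: compose_def)
  qed
  then show ?thesis
    unfolding c row_map_row_point[OF f] row_map_row_point[OF f'] row_map_row_point[OF row_compatible_compose[OF f f']] push
    by (rule row_point_cong)
qed

text \<open>The naturality square for the projection to the middle complex.\<close>

lemma col_coord_row_map:
  assumes "row_compatible A B A' B' f g" "z \<in> topspace (row_space A B)"
  shows "col_coord (row_map A' B' f g z) = pushforward g (col_coord z)"
  using assms(2) unfolding topspace_row_space
  by (auto simp: row_map_row_point[OF assms(1)] col_coord_row_point)

section \<open>The zigzag\<close>

text \<open>The type of intermediate points is fixed, so \<open>x\<close> is stored as its graph:
  \<open>j\<close> and \<open>x j\<close> form an unordered pair whose members are told apart by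
  their summands. The number 0 and the last function are padding, and the sequence is
  constant.\<close>

definition encode :: "('j \<Rightarrow> real) \<Rightarrow> ('i, 'j, 'k) zigzag_point" where
  "encode x = range (\<lambda>j. (0, \<lambda>_. {Inr (Inl j), Inr (Inr (Inr (x j)))}, \<lambda>_. 0))"

lemma inj_encode: "inj encode"
proof (rule injI)
  fix x y :: "'j \<Rightarrow> real"
  assume e: "(encode x :: ('i, 'j, 'k) zigzag_point) = encode y"
  show "x = y"
  proof
    fix j
    have "(0, \<lambda>_. {Inr (Inl j), Inr (Inr (Inr (x j)))}, \<lambda>_. 0) \<in> (encode x :: ('i, 'j, 'k) zigzag_point)"
      by (simp add: encode_def)
    then have "(0, \<lambda>_. {Inr (Inl j), Inr (Inr (Inr (x j)))}, \<lambda>_. 0) \<in> (encode y :: ('i, 'j, 'k) zigzag_point)"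
      by (simp only: e)
    then show "x j = y j"
      by (auto simp: encode_def fun_eq_iff doubleton_eq_iff)
  qed
qed

definition decode :: "('i, 'j, 'k) zigzag_point \<Rightarrow> 'j \<Rightarrow> real" where
  "decode = inv_into UNIV encode"

lemma decode_encode [simp]: "decode (encode x) = x"
  unfolding decode_def by (rule inv_into_f_f[OF inj_encode]) simp

text \<open>The quotient topology along the injection \<open>encode\<close> is a homeomorphic copy
  of the middle space. For a morphism of pairs \<open>snd a\<close> equals \<open>fst b\<close>, so
  the map is the same seen from either side.\<close>

definition mid_functor :: "('i, 'j, 'k, ('i, 'j, 'k) zigzag_point) space_functor" where
  "mid_functor = \<lparr>
     space_of = (\<lambda>(A, B). quotient_topology (mid_space A B) encode),
     map_of_mor = (\<lambda>(A, B) (A', B') (a, b). encode \<circ> pushforward (snd a) \<circ> decode)\<rparr>"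

lemma mid_functor_simps:
  "space_of mid_functor (A, B) = quotient_topology (mid_space A B) encode"
  "map_of_mor mid_functor (A, B) (A', B') (a, b) z = encode (pushforward (snd a) (decode z))"
  by (simp_all add: mid_functor_def)

lemma continuous_map_encode: "continuous_map Y (quotient_topology Y encode) encode"
  by (rule quotient_imp_continuous_map[OF quotient_map_quotient_topology])

lemma continuous_map_decode: "continuous_map (quotient_topology Y encode) Y decode"
  by (rule continuous_compose_quotient_map[OF quotient_map_quotient_topology]) (simp add: o_def)

lemma topspace_encoded: "topspace (quotient_topology Y encode) = encode ` topspace Y"
  using quotient_imp_surjective_map[OF quotient_map_quotient_topology] by metis

text \<open>Pull \<open>v\<close> back along \<open>d\<close>, lift there, and push the homotopy
  forward along \<open>e\<close>.\<close>

lemma lifting_property_homeomorphic: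
  assumes lp: "lifting_property X Y f" and e: "continuous_map Y Z e" and d: "continuous_map Z Y d"
    and de: "\<And>y. y \<in> topspace Y \<Longrightarrow> d (e y) = y" and ed: "\<And>z. z \<in> topspace Z \<Longrightarrow> e (d z) = z"
  shows "lifting_property X Z (e \<circ> f)"
  unfolding lifting_property_def
proof (intro conjI allI impI)
  have f: "continuous_map X Y f" using lp by (simp add: lifting_property_def)
  then show "continuous_map X Z (e \<circ> f)" using e by (rule continuous_map_compose)
  fix n u v
  assume u: "continuous_map (subtopology (cube n) (cube_boundary n)) X u"
    and v: "continuous_map (cube n) Z v" and uv: "\<forall>p\<in>cube_boundary n. (e \<circ> f) (u p) = v p"
  have bd: "cube_boundary n \<subseteq> topspace (cube n)" by (auto simp: cube_boundary_def)
  have fu: "f (u p) \<in> topspace Y" if "p \<in> cube_boundary n" for p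
    using continuous_map_image_subset_topspace[OF continuous_map_compose[OF u f]] that bd by auto
  have vp: "v p \<in> topspace Z" if "p \<in> topspace (cube n)" for p
    using continuous_map_image_subset_topspace[OF v] that by blast
  have "\<forall>p\<in>cube_boundary n. f (u p) = (d \<circ> v) p"
    using uv de[OF fu] by (metis comp_apply)
  from lifting_propertyE[OF lp u continuous_map_compose[OF v d] this]
  obtain w where w: "continuous_map (cube n) X w" "\<forall>p\<in>cube_boundary n. w p = u p"
    and h: "homotopic_with (\<lambda>h. \<forall>p\<in>cube_boundary n. h p = (d \<circ> v) p) (cube n) Y (f \<circ> w) (d \<circ> v)" .
  have "homotopic_with (\<lambda>h. \<forall>p\<in>cube_boundary n. h p = v p) (cube n) Z (e \<circ> (f \<circ> w)) (e \<circ> (d \<circ> v))"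
    by (rule homotopic_with_compose_continuous_map_left[OF h e]) (use ed vp bd in auto)
  then have "homotopic_with (\<lambda>h. \<forall>p\<in>cube_boundary n. h p = v p) (cube n) Z (e \<circ> f \<circ> w) v"
  proof (rule homotopic_with_eq)
    fix h k :: "(nat \<Rightarrow> real) \<Rightarrow> 'c" assume "\<And>p. p \<in> topspace (cube n) \<Longrightarrow> h p = k p"
    then show "(\<forall>p\<in>cube_boundary n. h p = v p) = (\<forall>p\<in>cube_boundary n. k p = v p)"
      using bd by (metis subsetD)
  qed (use ed vp in auto)
  with w show "\<exists>w. continuous_map (cube n) X w \<and> (\<forall>p\<in>cube_boundary n. w p = u p) \<and>
      homotopic_with (\<lambda>h. \<forall>p\<in>cube_boundary n. h p = v p) (cube n) Z (e \<circ> f \<circ> w) v"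
    by blast
qed

lemma weak_equivalence_encode_col_coord:
  "weak_equivalence (row_space A B) (quotient_topology (mid_space A B) encode) (encode \<circ> col_coord)"
  by (rule lifting_property_imp_weak_equivalence,
      rule lifting_property_homeomorphic[OF lifting_property_col_coord continuous_map_encode continuous_map_decode])
    (auto simp: topspace_encoded simp del: topspace_complex_realization)

text \<open>The existential clause is witnessed by the remaining component of the morphism:
  \<open>snd b\<close> for the pair itself, \<open>fst a\<close> for the transposed pair.\<close>

lemma row_compatible_pair_morphism:
  assumes "pair_morphism (A, B) (A', B') (a, b)" "composable (A, B)"
  shows "row_compatible A B A' B' (fst a) (snd a)"
    "row_compatible (rel_transpose B) (rel_transpose A) (rel_transpose B') (rel_transpose A') (snd b) (fst b)"
proof -
  have AB: "col_set A = row_set B" "snd a = fst b"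
    and a: "fst a \<in> row_set A \<rightarrow> row_set A'" "snd a \<in> col_set A \<rightarrow> col_set A'"
      "\<And>i j. i \<in> row_set A \<Longrightarrow> j \<in> col_set A \<Longrightarrow> holds A i j \<Longrightarrow> holds A' (fst a i) (snd a j)"
    and b: "fst b \<in> row_set B \<rightarrow> row_set B'" "snd b \<in> col_set B \<rightarrow> col_set B'"
      "\<And>j k. j \<in> row_set B \<Longrightarrow> k \<in> col_set B \<Longrightarrow> holds B j k \<Longrightarrow> holds B' (fst b j) (snd b k)"
    using assms by (auto simp: pair_morphism_def rel_morphism_def composable_def)
  have "\<exists>k'\<in>col_set B'. \<forall>j\<in>col_set A. holds B j k \<longrightarrow> holds B' (snd a j) k'" if "k \<in> col_set B" for k
    using b(2,3) that by (intro bexI[of _ "snd b k"]) (auto simp: AB)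
  then show "row_compatible A B A' B' (fst a) (snd a)"
    unfolding row_compatible_def using a by blast
  have "\<exists>i'\<in>row_set A'. \<forall>j\<in>row_set B. holds A i j \<longrightarrow> holds A' i' (fst b j)" if "i \<in> row_set A" for i
    using a(1,3) that by (intro bexI[of _ "fst a i"]) (auto simp: AB)
  then show "row_compatible (rel_transpose B) (rel_transpose A) (rel_transpose B') (rel_transpose A') (snd b) (fst b)"
    unfolding row_compatible_def rel_transpose_def using b by simp
qed

text \<open>Transposition exchanges the two conditions and replaces the vertex set
  \<open>col_set A\<close> by \<open>row_set B\<close>, which composability identifies.\<close>

lemma mid_complex_transpose:
  "composable (A, B) \<Longrightarrow> mid_complex (rel_transpose B) (rel_transpose A) = mid_complex A B"
  by (auto simp: mid_complex_def rel_transpose_def composable_def)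

section \<open>The three functors and the natural equivalences between them\<close>

lemma BR_simps:
  "space_of BR (A, B) = row_space A B"
  "map_of_mor BR (A, B) (A', B') (a, b) = row_map A' B' (fst a) (snd a)"
  by (simp_all add: BR_def row_map_def case_prod_unfold)

lemma BC_simps:
  "space_of BC (A, B) = row_space (rel_transpose B) (rel_transpose A)"
  "map_of_mor BC (A, B) (A', B') (a, b) = row_map (rel_transpose B') (rel_transpose A') (snd b) (fst b)"
  by (simp_all add: BC_def row_map_def case_prod_unfold col_category_eq_row_category)

lemma is_space_functorI:
  assumes "\<And>A B A' B' a b. composable (A, B) \<Longrightarrow> composable (A', B') \<Longrightarrow> pair_morphism (A, B) (A', B') (a, b) \<Longrightarrow>
      continuous_map (space_of F (A, B)) (space_of F (A', B')) (map_of_mor F (A, B) (A', B') (a, b))"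
    and "\<And>A B z. composable (A, B) \<Longrightarrow> z \<in> topspace (space_of F (A, B)) \<Longrightarrow>
      map_of_mor F (A, B) (A, B) (rel_id A, rel_id B) z = z"
    and "\<And>A B A' B' A'' B'' a b a' b' z. composable (A, B) \<Longrightarrow> composable (A', B') \<Longrightarrow>
      pair_morphism (A, B) (A', B') (a, b) \<Longrightarrow> pair_morphism (A', B') (A'', B'') (a', b') \<Longrightarrow>
      z \<in> topspace (space_of F (A, B)) \<Longrightarrow>
      map_of_mor F (A, B) (A'', B'') (rel_comp A a' a, rel_comp B b' b) z =
      map_of_mor F (A', B') (A'', B'') (a', b') (map_of_mor F (A, B) (A', B') (a, b) z)"
  shows "is_space_functor F"
  unfolding is_space_functor_def
proof (intro conjI allI impI ballI; (elim conjE)?)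
  fix P P' :: "('a, 'b, 'c) rel_pair" and m
  assume "composable P" "composable P'" "pair_morphism P P' m"
  then show "continuous_map (space_of F P) (space_of F P') (map_of_mor F P P' m)"
    using assms(1) by (metis prod.collapse)
next
  fix P :: "('a, 'b, 'c) rel_pair" and z assume "composable P" "z \<in> topspace (space_of F P)"
  then show "map_of_mor F P P (pair_id P) z = z"
    using assms(2)[of "fst P" "snd P" z] by (simp add: pair_id_def case_prod_unfold)
next
  fix P P' P'' :: "('a, 'b, 'c) rel_pair" and m m' z
  assume "composable P" "composable P'" "pair_morphism P P' m" "pair_morphism P' P'' m'"
    "z \<in> topspace (space_of F P)"
  then show "map_of_mor F P P'' (pair_comp P m' m) z = map_of_mor F P' P'' m' (map_of_mor F P P' m z)"
    using assms(3)[of "fst P" "snd P" "fst P'" "snd P'" "fst m" "snd m" "fst P''" "snd P''" "fst m'" "snd m'" z]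
    by (simp add: pair_comp_def case_prod_unfold)
qed

lemma is_space_functor_BR: "is_space_functor BR"
proof (rule is_space_functorI, goal_cases)
  case (1 A B A' B' a b)
  then show ?case
    unfolding BR_simps by (intro continuous_map_row_map row_compatible_pair_morphism(1))
next
  case (2 A B z)
  then show ?case
    by (simp add: BR_simps rel_id_def row_map_id)
next
  case (3 A B A' B' A'' B'' a b a' b' z)
  from row_compatible_pair_morphism(1)[OF 3(3,1)] row_compatible_pair_morphism(1)[OF 3(4,2)] 3(5)
  show ?case
    by (simp add: BR_simps rel_comp_def row_map_compose)
qed

lemma is_space_functor_BC: "is_space_functor BC"
proof (rule is_space_functorI, goal_cases)
  case (1 A B A' B' a b)
  then show ?case
    unfolding BC_simps by (intro continuous_map_row_map row_compatible_pair_morphism(2))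
next
  case (2 A B z)
  then show ?case
    using row_map_id[of z "rel_transpose B" "rel_transpose A"]
    by (simp add: BC_simps rel_id_def rel_transpose_def)
next
  case (3 A B A' B' A'' B'' a b a' b' z)
  from row_compatible_pair_morphism(2)[OF 3(3,1)] row_compatible_pair_morphism(2)[OF 3(4,2)] 3(5)
  show ?case
    using row_map_compose[of "rel_transpose B" "rel_transpose A" "rel_transpose B'" "rel_transpose A'" "snd b" "fst b"
      "rel_transpose B''" "rel_transpose A''" "snd b'" "fst b'" z]
    by (simp add: BC_simps rel_comp_def) (simp add: rel_transpose_def)
qed

lemma is_space_functor_mid_functor: "is_space_functor mid_functor"
proof (rule is_space_functorI, goal_cases)
  case (1 A B A' B' a b)
  have "continuous_map (mid_space A B) (mid_space A' B') (pushforward (snd a))"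
    by (rule row_compatible_mid[OF row_compatible_pair_morphism(1)[OF 1(3,1)]])
  from continuous_map_compose[OF continuous_map_compose[OF continuous_map_decode this] continuous_map_encode]
  show ?case
    by (simp add: mid_functor_def o_assoc)
next
  case (2 A B z)
  then obtain x where x: "x \<in> topspace (mid_space A B)" "z = encode x"
    unfolding mid_functor_simps topspace_encoded by blast
  then show ?case
    using pushforward_restrict_id[OF mid_spaceD(2,4)[OF x(1)]] by (simp add: mid_functor_simps rel_id_def)
next
  case (3 A B A' B' A'' B'' a b a' b' z)
  then obtain x where x: "x \<in> topspace (mid_space A B)" "z = encode x"
    unfolding mid_functor_simps topspace_encoded by blast
  then show ?case
    by (simp add: mid_functor_simps rel_comp_def pushforward_compose[OF mid_spaceD(2,4)[OF x(1)]])
qed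

lemma natural_weak_equivalenceI:
  assumes "is_space_functor F" "is_space_functor G"
    and "\<And>A B. composable (A, B) \<Longrightarrow> weak_equivalence (space_of F (A, B)) (space_of G (A, B)) \<phi>"
    and "\<And>A B A' B' a b y. composable (A, B) \<Longrightarrow> composable (A', B') \<Longrightarrow> pair_morphism (A, B) (A', B') (a, b) \<Longrightarrow>
      y \<in> topspace (space_of F (A, B)) \<Longrightarrow>
      map_of_mor G (A, B) (A', B') (a, b) (\<phi> y) = \<phi> (map_of_mor F (A, B) (A', B') (a, b) y)"
  shows "natural_weak_equivalence F G (\<lambda>_. \<phi>)"
  unfolding natural_weak_equivalence_def
proof (intro conjI allI impI ballI assms(1,2); (elim conjE)?)
  fix P :: "('a, 'b, 'c) rel_pair" assume "composable P"
  then show "weak_equivalence (space_of F P) (space_of G P) \<phi>"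
    using assms(3)[of "fst P" "snd P"] by simp
next
  fix P P' :: "('a, 'b, 'c) rel_pair" and m y
  assume "composable P" "composable P'" "pair_morphism P P' m" "y \<in> topspace (space_of F P)"
  then show "map_of_mor G P P' m (\<phi> y) = \<phi> (map_of_mor F P P' m y)"
    using assms(4)[of "fst P" "snd P" "fst P'" "snd P'" "fst m" "snd m" y] by simp
qed

lemma natural_weak_equivalence_BR: "natural_weak_equivalence BR mid_functor (\<lambda>_. encode \<circ> col_coord)"
proof (rule natural_weak_equivalenceI[OF is_space_functor_BR is_space_functor_mid_functor], goal_cases)
  case (1 A B)
  then show ?case
    unfolding BR_simps mid_functor_simps by (intro weak_equivalence_encode_col_coord)
next
  case (2 A B A' B' a b y)
  from col_coord_row_map[OF row_compatible_pair_morphism(1)[OF 2(3,1)]] 2(4) show ?case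
    by (simp add: BR_simps mid_functor_simps)
qed

text \<open>\<open>BC\<close> is \<open>BR\<close> of the transposed pair, whose middle complex is
  the same, so the same projection serves at both ends of the zigzag.\<close>

lemma natural_weak_equivalence_BC: "natural_weak_equivalence BC mid_functor (\<lambda>_. encode \<circ> col_coord)"
proof (rule natural_weak_equivalenceI[OF is_space_functor_BC is_space_functor_mid_functor], goal_cases)
  case (1 A B)
  then show ?case
    using weak_equivalence_encode_col_coord[of "rel_transpose B" "rel_transpose A"]
    unfolding BC_simps mid_functor_simps by (simp only: mid_complex_transpose)
next
  case (2 A B A' B' a b y)
  have "fst b = snd a" using 2(3) by (simp add: pair_morphism_def)
  with col_coord_row_map[OF row_compatible_pair_morphism(2)[OF 2(3,1)]] 2(4) show ?case
    by (simp add: BC_simps mid_functor_simps)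
qed

theorem theorem1:
  "\<exists>(n :: nat) (Z :: nat \<Rightarrow> ('i, 'j, 'k, ('i, 'j, 'k) zigzag_point) space_functor).
     zigzag_step BR (Z 0) \<and>
     (\<forall>m<n. zigzag_step (Z m) (Z (Suc m))) \<and>
     zigzag_step (Z n) BC"
\<comment> \<open>A single intermediate functor receives weak equivalences from both ends; with
  \<open>n = 0\<close> there are no inner steps.\<close>
proof (intro exI[of _ 0] exI[of _ "\<lambda>_. mid_functor"] conjI)
  show "zigzag_step BR ((\<lambda>_. mid_functor) (0 :: nat))"
    unfolding zigzag_step_def using natural_weak_equivalence_BR by blast
  show "zigzag_step ((\<lambda>_. mid_functor) (0 :: nat)) BC"
    unfolding zigzag_step_def using natural_weak_equivalence_BC by blast
qed simp

end
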